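(* Let $K$ be a field, $k$ a positive integer, and $\Lambda$ a row-finite $k$-graph without sources. Then the following holds: (1) If $\Lambda$ is aperiodic and cofinal, and $\Lambda^0$ is infinite, then $[KP_K(\Lambda), KP_K(\Lambda)]$ is a simple Lie $K$-algebra. (2) If $\Lambda$ is aperiodic and cofinal, $\Lambda^0$ is finite, and $KP_K(\Lambda)$ is not isomorphic to $K$, then $[KP_K(\Lambda), KP_K(\Lambda)]$ is a simple Lie $K$-algebra if and only if $1_{KP_K(\Lambda)}\notin [KP_K(\Lambda), KP_K(\Lambda)]$.
   Context: View $\mathbb{N}^k$ (with $0\in\mathbb{N}$) as a category with one object. A $k$-graph is a countable category $\Lambda=(\Lambda^0,\Lambda,s,r)$ with a functor $d:\Lambda\to\mathbb{N}^k$ (the degree map) satisfying the factorisation property: if $\lambda\in\Lambda$ and $d(\lambda)=m+n$ with $m,n\in\mathbb{N}^k$, there are unique $\mu,\nu\in\Lambda$ with $d(\mu)=m$, $d(\nu)=n$ and $\lambda=\mu\nu$. Morphisms $\lambda$ go from $s(\lambda)$ to $r(\lambda)$, and $\lambda\mu=\lambda\circ\mu$ is defined iff $s(\lambda)=r(\mu)$. The object set $\Lambda^0$ is identified with the set of morphisms of degree $0$; $\Lambda^n:=d^{-1}(n)$, $v\Lambda^n:=\{\lambda\in\Lambda^n\mid r(\lambda)=v\}$, and $v\Lambda w:=\{\lambda\in\Lambda\mid r(\lambda)=v,\ s(\lambda)=w\}$. $\Lambda$ is row-finite if $v\Lambda^n$ is finite, and has no sources if $v\Lambda^n$ is nonempty,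 for every $v\in\Lambda^0$ and $n\in\mathbb{N}^k$. Let $\Omega_k=\{(m,n)\in\mathbb{N}^k\times\mathbb{N}^k\mid m\le n\}$ (componentwise order), a $k$-graph with $\Omega_k^0=\mathbb{N}^k$, $r(m,n)=m$, $s(m,n)=n$, $(m,n)(n,p)=(m,p)$, $d(m,n)=n-m$. An infinite path in $\Lambda$ is a degree-preserving functor $x:\Omega_k\to\Lambda$; $x(m)$ denotes the vertex $x(m,m)$, and $\Lambda^\infty$ is the set of infinite paths. For $\lambda\in\Lambda$, $Z(\lambda)=\{x\in\Lambda^\infty\mid x(0,d(\lambda))=\lambda\}$; for $p\in\mathbb{N}^k$, $\sigma^p:\Lambda^\infty\to\Lambda^\infty$ is given by $\sigma^p(x)(m,n)=x(m+p,n+p)$. $\Lambda$ is aperiodic if for every $v\in\Lambda^0$ there is $x\in Z(v)$ with $\sigma^m(x)\ne\sigma^n(x)$ for all distinct $m,n\in\mathbb{N}^k$. $\Lambda$ is cofinal if for every $x\in\Lambda^\infty$ and every $v\in\Lambda^0$ there is $m\in\mathbb{N}^k$ with $v\Lambda x(m)\neq\varnothing$. The Kumjian-Pask algebra $KP_K(\Lambda)$ of a row-finite $k$-graph without sources is the $K$-algebra (not necessarily unital) generated by $\Lambda\cup\Lambda^*$, where $\Lambda^*=\{\lambda^*\mid\lambda\in\Lambda\}$ is a set of ghost paths with the convention $v^*=v$ for $v\in\Lambda^0$, subject to ($\delta$ the Kronecker delta): (KP1) $vw=\delta_{v,w}w$ for all $v,w\in\Lambda^0$; (KP2) $\lambda\mu=\lambda\circ\mu$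 and $\mu^*\lambda^*=(\lambda\circ\mu)^*$ for all $\lambda,\mu\in\Lambda$ with $r(\mu)=s(\lambda)$; (KP3) $\lambda^*\mu=\delta_{\lambda,\mu}s(\lambda)$ for all $\lambda,\mu\in\Lambda$ with $d(\lambda)=d(\mu)$; (KP4) $v=\sum_{\lambda\in v\Lambda^n}\lambda\lambda^*$ for all $v\in\Lambda^0$ and $n\in\mathbb{N}^k\setminus\{0\}$. $KP_K(\Lambda)$ is unital if and only if $\Lambda^0$ is finite, and then its identity is $1_{KP_K(\Lambda)}=\sum_{v\in\Lambda^0}v$. For an associative $K$-algebra $R$ (not necessarily unital), $[R,R]$ is the $K$-span of all commutators $[x,y]=xy-yx$, $x,y\in R$; it is a Lie $K$-algebra under $[x,y]=xy-yx$. A Lie $K$-algebra $L$ is simple if $[L,L]\neq 0$ and its only Lie ideals ($K$-subspaces $I$ with $[L,I]\subseteq I$) are $0$ and $L$. *)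

theory Defs
  imports
    "HOL-Analysis.Finite_Cartesian_Product"
    "HOL-Library.Poly_Mapping"
    "HOL-Library.Countable_Set"
    "HOL-Library.FuncSet"
begin

section \<open>Higher-rank graphs\<close>

text \<open>
  Categories are presented by their morphisms: the objects are identified with the identity
  morphisms, so \<open>Obj\<close> is a subset of \<open>Mor\<close>, and source and range of a morphism are
  themselves morphisms. A morphism goes from its source to its range, and
  \<open>cmp \<Lambda> \<kappa> \<mu>\<close> stands for the composite of \<open>\<kappa>\<close> after \<open>\<mu>\<close>, which is meaningful only if
  \<open>src \<Lambda> \<kappa> = rng \<Lambda> \<mu>\<close>. The degree takes values in \<open>nat ^ 'k\<close>, where \<open>'k\<close> is a
  (nonempty) finite index type of cardinality \<open>k\<close>.
\<close>

record ('l, 'k::finite) kgraph =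
  Obj :: "'l set"
  Mor :: "'l set"
  src :: "'l \<Rightarrow> 'l"
  rng :: "'l \<Rightarrow> 'l"
  cmp :: "'l \<Rightarrow> 'l \<Rightarrow> 'l"
  deg :: "'l \<Rightarrow> nat ^ 'k"

locale k_graph =
  fixes \<Lambda> :: "('l, 'k::finite) kgraph"
  assumes Obj_subset: "Obj \<Lambda> \<subseteq> Mor \<Lambda>"
    and countable_Mor: "countable (Mor \<Lambda>)"
    and src_Obj: "\<kappa> \<in> Mor \<Lambda> \<Longrightarrow> src \<Lambda> \<kappa> \<in> Obj \<Lambda>"
    and rng_Obj: "\<kappa> \<in> Mor \<Lambda> \<Longrightarrow> rng \<Lambda> \<kappa> \<in> Obj \<Lambda>"
    and src_id: "v \<in> Obj \<Lambda> \<Longrightarrow> src \<Lambda> v = v"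
    and rng_id: "v \<in> Obj \<Lambda> \<Longrightarrow> rng \<Lambda> v = v"
    and cmp_Mor: "\<lbrakk>\<kappa> \<in> Mor \<Lambda>; \<mu> \<in> Mor \<Lambda>; src \<Lambda> \<kappa> = rng \<Lambda> \<mu>\<rbrakk> \<Longrightarrow> cmp \<Lambda> \<kappa> \<mu> \<in> Mor \<Lambda>"
    and src_cmp: "\<lbrakk>\<kappa> \<in> Mor \<Lambda>; \<mu> \<in> Mor \<Lambda>; src \<Lambda> \<kappa> = rng \<Lambda> \<mu>\<rbrakk>
                    \<Longrightarrow> src \<Lambda> (cmp \<Lambda> \<kappa> \<mu>) = src \<Lambda> \<mu>"
    and rng_cmp: "\<lbrakk>\<kappa> \<in> Mor \<Lambda>; \<mu> \<in> Mor \<Lambda>; src \<Lambda> \<kappa> = rng \<Lambda> \<mu>\<rbrakk>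
                    \<Longrightarrow> rng \<Lambda> (cmp \<Lambda> \<kappa> \<mu>) = rng \<Lambda> \<kappa>"
    and cmp_id_left: "\<kappa> \<in> Mor \<Lambda> \<Longrightarrow> cmp \<Lambda> (rng \<Lambda> \<kappa>) \<kappa> = \<kappa>"
    and cmp_id_right: "\<kappa> \<in> Mor \<Lambda> \<Longrightarrow> cmp \<Lambda> \<kappa> (src \<Lambda> \<kappa>) = \<kappa>"
    and cmp_assoc: "\<lbrakk>\<kappa> \<in> Mor \<Lambda>; \<mu> \<in> Mor \<Lambda>; \<nu> \<in> Mor \<Lambda>; src \<Lambda> \<kappa> = rng \<Lambda> \<mu>; src \<Lambda> \<mu> = rng \<Lambda> \<nu>\<rbrakk>
                    \<Longrightarrow> cmp \<Lambda> (cmp \<Lambda> \<kappa> \<mu>) \<nu> = cmp \<Lambda> \<kappa> (cmp \<Lambda> \<mu> \<nu>)"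
    and deg_id: "v \<in> Obj \<Lambda> \<Longrightarrow> deg \<Lambda> v = 0"
    and deg_cmp: "\<lbrakk>\<kappa> \<in> Mor \<Lambda>; \<mu> \<in> Mor \<Lambda>; src \<Lambda> \<kappa> = rng \<Lambda> \<mu>\<rbrakk>
                    \<Longrightarrow> deg \<Lambda> (cmp \<Lambda> \<kappa> \<mu>) = deg \<Lambda> \<kappa> + deg \<Lambda> \<mu>"
    and factorisation: "\<lbrakk>\<kappa> \<in> Mor \<Lambda>; deg \<Lambda> \<kappa> = m + n\<rbrakk>
          \<Longrightarrow> \<exists>!p. fst p \<in> Mor \<Lambda> \<and> snd p \<in> Mor \<Lambda> \<and> deg \<Lambda> (fst p) = m \<and> deg \<Lambda> (snd p) = n
                 \<and> src \<Lambda> (fst p) = rng \<Lambda> (snd p) \<and> \<kappa> = cmp \<Lambda> (fst p) (snd p)"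

lemma (in k_graph) Obj_eq_deg_0: "Obj \<Lambda> = {\<kappa> \<in> Mor \<Lambda>. deg \<Lambda> \<kappa> = 0}"
proof (intro equalityI subsetI)
  fix \<kappa> assume "\<kappa> \<in> {\<kappa> \<in> Mor \<Lambda>. deg \<Lambda> \<kappa> = 0}"
  then have l: "\<kappa> \<in> Mor \<Lambda>" "deg \<Lambda> \<kappa> = 0" by auto
  have *: "rng \<Lambda> \<kappa> \<in> Mor \<Lambda>" "src \<Lambda> \<kappa> \<in> Mor \<Lambda>" "rng \<Lambda> \<kappa> \<in> Obj \<Lambda>" "src \<Lambda> \<kappa> \<in> Obj \<Lambda>"
    using l src_Obj rng_Obj Obj_subset by auto
  have "deg \<Lambda> \<kappa> = 0 + 0" using l by simp
  then have "(rng \<Lambda> \<kappa>, \<kappa>) = (\<kappa>, src \<Lambda> \<kappa>)"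
    by (rule ex1E [OF factorisation [OF l(1)]])
       (use l * src_id rng_id deg_id cmp_id_left cmp_id_right in \<open>metis fst_conv snd_conv\<close>)
  then show "\<kappa> \<in> Obj \<Lambda>" using * by simp
qed (use Obj_subset deg_id in auto)

definition paths_from :: "('l, 'k::finite) kgraph \<Rightarrow> 'l \<Rightarrow> nat ^ 'k \<Rightarrow> 'l set" where
  "paths_from \<Lambda> v n = {\<kappa> \<in> Mor \<Lambda>. deg \<Lambda> \<kappa> = n \<and> rng \<Lambda> \<kappa> = v}"

definition hom_set :: "('l, 'k::finite) kgraph \<Rightarrow> 'l \<Rightarrow> 'l \<Rightarrow> 'l set" where
  "hom_set \<Lambda> v w = {\<kappa> \<in> Mor \<Lambda>. rng \<Lambda> \<kappa> = v \<and> src \<Lambda> \<kappa> = w}"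

definition row_finite :: "('l, 'k::finite) kgraph \<Rightarrow> bool" where
  "row_finite \<Lambda> \<longleftrightarrow> (\<forall>v\<in>Obj \<Lambda>. \<forall>n. finite (paths_from \<Lambda> v n))"

definition no_sources :: "('l, 'k::finite) kgraph \<Rightarrow> bool" where
  "no_sources \<Lambda> \<longleftrightarrow> (\<forall>v\<in>Obj \<Lambda>. \<forall>n. paths_from \<Lambda> v n \<noteq> {})"

text \<open>The vertex \<open>m\<close> of \<open>\<Omega>\<^sub>k\<close> is the identity morphism \<open>(m, m)\<close>.\<close>

definition Omega :: "((nat ^ 'k) \<times> (nat ^ 'k), 'k::finite) kgraph" where
  "Omega = \<lparr> Obj = {(m, n). m = n},
             Mor = {(m, n). m \<le> n},
             src = (\<lambda>(m, n). (n, n)),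
             rng = (\<lambda>(m, n). (m, m)),
             cmp = (\<lambda>(m, n) (n', p). (m, p)),
             deg = (\<lambda>(m, n). n - m) \<rparr>"

definition degree_functor :: "('l, 'k::finite) kgraph \<Rightarrow> ('m, 'k::finite) kgraph \<Rightarrow> ('l \<Rightarrow> 'm) \<Rightarrow> bool" where
  "degree_functor \<Gamma> \<Lambda> f \<longleftrightarrow>
     f \<in> Mor \<Gamma> \<rightarrow> Mor \<Lambda> \<and> f \<in> Obj \<Gamma> \<rightarrow> Obj \<Lambda> \<and>
     (\<forall>\<kappa>\<in>Mor \<Gamma>. src \<Lambda> (f \<kappa>) = f (src \<Gamma> \<kappa>) \<and> rng \<Lambda> (f \<kappa>) = f (rng \<Gamma> \<kappa>) \<and> deg \<Lambda> (f \<kappa>) = deg \<Gamma> \<kappa>) \<and>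
     (\<forall>\<kappa>\<in>Mor \<Gamma>. \<forall>\<mu>\<in>Mor \<Gamma>. src \<Gamma> \<kappa> = rng \<Gamma> \<mu> \<longrightarrow> f (cmp \<Gamma> \<kappa> \<mu>) = cmp \<Lambda> (f \<kappa>) (f \<mu>))"

text \<open>
  Infinite paths are required to be extensional (\<open>undefined\<close> outside \<open>\<Omega>\<^sub>k\<close>), so that
  equality of HOL functions is equality of functors.
\<close>

definition infinite_paths :: "('l, 'k::finite) kgraph \<Rightarrow> ((nat ^ 'k) \<times> (nat ^ 'k) \<Rightarrow> 'l) set" where
  "infinite_paths \<Lambda> = {x \<in> extensional (Mor Omega). degree_functor Omega \<Lambda> x}"

definition cylinder :: "('l, 'k::finite) kgraph \<Rightarrow> 'l \<Rightarrow> ((nat ^ 'k) \<times> (nat ^ 'k) \<Rightarrow> 'l) set" where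
  "cylinder \<Lambda> \<kappa> = {x \<in> infinite_paths \<Lambda>. x (0, deg \<Lambda> \<kappa>) = \<kappa>}"

definition shift ::
  "nat ^ 'k::finite \<Rightarrow> ((nat ^ 'k) \<times> (nat ^ 'k) \<Rightarrow> 'l) \<Rightarrow> ((nat ^ 'k) \<times> (nat ^ 'k) \<Rightarrow> 'l)" where
  "shift p x = restrict (\<lambda>(m, n). x (m + p, n + p)) (Mor Omega)"

definition aperiodic_graph :: "('l, 'k::finite) kgraph \<Rightarrow> bool" where
  "aperiodic_graph \<Lambda> \<longleftrightarrow>
     (\<forall>v\<in>Obj \<Lambda>. \<exists>x\<in>cylinder \<Lambda> v. \<forall>m n. m \<noteq> n \<longrightarrow> shift m x \<noteq> shift n x)"

definition cofinal_graph :: "('l, 'k::finite) kgraph \<Rightarrow> bool" where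
  "cofinal_graph \<Lambda> \<longleftrightarrow>
     (\<forall>x\<in>infinite_paths \<Lambda>. \<forall>v\<in>Obj \<Lambda>. \<exists>m. hom_set \<Lambda> v (x (m, m)) \<noteq> {})"


section \<open>Not necessarily associative or unital algebras\<close>

record ('f, 'a) kalg =
  Carr :: "'a set"
  zer :: "'a" ("\<zero>\<index>")
  add :: "'a \<Rightarrow> 'a \<Rightarrow> 'a" (infixl "\<oplus>\<index>" 65)
  scl :: "'f \<Rightarrow> 'a \<Rightarrow> 'a" (infixr "\<odot>\<index>" 75)
  mul :: "'a \<Rightarrow> 'a \<Rightarrow> 'a" (infixl "\<otimes>\<index>" 70)

locale K_algebra =
  fixes A :: "('f::field, 'a) kalg" (structure)
  assumes zer_closed: "\<zero> \<in> Carr A"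
    and add_closed: "\<lbrakk>x \<in> Carr A; y \<in> Carr A\<rbrakk> \<Longrightarrow> x \<oplus> y \<in> Carr A"
    and scl_closed: "x \<in> Carr A \<Longrightarrow> c \<odot> x \<in> Carr A"
    and mul_closed: "\<lbrakk>x \<in> Carr A; y \<in> Carr A\<rbrakk> \<Longrightarrow> x \<otimes> y \<in> Carr A"
    and add_assoc: "\<lbrakk>x \<in> Carr A; y \<in> Carr A; z \<in> Carr A\<rbrakk> \<Longrightarrow> (x \<oplus> y) \<oplus> z = x \<oplus> (y \<oplus> z)"
    and add_comm: "\<lbrakk>x \<in> Carr A; y \<in> Carr A\<rbrakk> \<Longrightarrow> x \<oplus> y = y \<oplus> x"
    and add_zer: "x \<in> Carr A \<Longrightarrow> x \<oplus> \<zero> = x"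
    and add_neg: "x \<in> Carr A \<Longrightarrow> x \<oplus> (- 1) \<odot> x = \<zero>"
    and scl_one: "x \<in> Carr A \<Longrightarrow> 1 \<odot> x = x"
    and scl_scl: "x \<in> Carr A \<Longrightarrow> c \<odot> (d \<odot> x) = (c * d) \<odot> x"
    and scl_add_left: "x \<in> Carr A \<Longrightarrow> (c + d) \<odot> x = c \<odot> x \<oplus> d \<odot> x"
    and scl_add_right: "\<lbrakk>x \<in> Carr A; y \<in> Carr A\<rbrakk> \<Longrightarrow> c \<odot> (x \<oplus> y) = c \<odot> x \<oplus> c \<odot> y"
    and mul_add_left: "\<lbrakk>x \<in> Carr A; y \<in> Carr A; z \<in> Carr A\<rbrakk> \<Longrightarrow> (x \<oplus> y) \<otimes> z = x \<otimes> z \<oplus> y \<otimes> z"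
    and mul_add_right: "\<lbrakk>x \<in> Carr A; y \<in> Carr A; z \<in> Carr A\<rbrakk> \<Longrightarrow> x \<otimes> (y \<oplus> z) = x \<otimes> y \<oplus> x \<otimes> z"
    and mul_scl_left: "\<lbrakk>x \<in> Carr A; y \<in> Carr A\<rbrakk> \<Longrightarrow> (c \<odot> x) \<otimes> y = c \<odot> (x \<otimes> y)"
    and mul_scl_right: "\<lbrakk>x \<in> Carr A; y \<in> Carr A\<rbrakk> \<Longrightarrow> x \<otimes> (c \<odot> y) = c \<odot> (x \<otimes> y)"

locale assoc_algebra = K_algebra +
  assumes mul_assoc: "\<lbrakk>x \<in> Carr A; y \<in> Carr A; z \<in> Carr A\<rbrakk> \<Longrightarrow> (x \<otimes> y) \<otimes> z = x \<otimes> (y \<otimes> z)"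

locale lie_algebra = K_algebra +
  assumes alternating: "x \<in> Carr A \<Longrightarrow> x \<otimes> x = \<zero>"
    and jacobi: "\<lbrakk>x \<in> Carr A; y \<in> Carr A; z \<in> Carr A\<rbrakk>
          \<Longrightarrow> x \<otimes> (y \<otimes> z) \<oplus> y \<otimes> (z \<otimes> x) \<oplus> z \<otimes> (x \<otimes> y) = \<zero>"

definition is_identity :: "('f, 'a) kalg \<Rightarrow> 'a \<Rightarrow> bool" where
  "is_identity A e \<longleftrightarrow> e \<in> Carr A \<and> (\<forall>x\<in>Carr A. mul A e x = x \<and> mul A x e = x)"

text \<open>Meaningful only for algebras with an identity, which is then unique.\<close>

definition alg_one :: "('f, 'a) kalg \<Rightarrow> 'a" where
  "alg_one A = (THE e. is_identity A e)"

definition isomorphic :: "('f, 'a) kalg \<Rightarrow> ('f, 'b) kalg \<Rightarrow> bool" where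
  "isomorphic A B \<longleftrightarrow>
     (\<exists>h. bij_betw h (Carr A) (Carr B) \<and>
          (\<forall>x\<in>Carr A. \<forall>y\<in>Carr A. h (add A x y) = add B (h x) (h y) \<and> h (mul A x y) = mul B (h x) (h y)) \<and>
          (\<forall>c. \<forall>x\<in>Carr A. h (scl A c x) = scl B c (h x)))"

definition field_algebra :: "('f::field, 'f) kalg" where
  "field_algebra = \<lparr> Carr = UNIV, zer = 0, add = (+), scl = (*), mul = (*) \<rparr>"

definition alg_subspace :: "('f, 'a) kalg \<Rightarrow> 'a set \<Rightarrow> bool" where
  "alg_subspace A W \<longleftrightarrow>
     W \<subseteq> Carr A \<and> zer A \<in> W \<and> (\<forall>x\<in>W. \<forall>y\<in>W. add A x y \<in> W) \<and> (\<forall>c. \<forall>x\<in>W. scl A c x \<in> W)"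

definition alg_span :: "('f, 'a) kalg \<Rightarrow> 'a set \<Rightarrow> 'a set" where
  "alg_span A S = \<Inter>{W. alg_subspace A W \<and> S \<subseteq> W}"

definition two_sided_ideal :: "('f, 'a) kalg \<Rightarrow> 'a set \<Rightarrow> bool" where
  "two_sided_ideal A I \<longleftrightarrow> alg_subspace A I \<and> (\<forall>a\<in>Carr A. \<forall>i\<in>I. mul A a i \<in> I \<and> mul A i a \<in> I)"

definition ideal_generated :: "('f, 'a) kalg \<Rightarrow> 'a set \<Rightarrow> 'a set" where
  "ideal_generated A S = \<Inter>{I. two_sided_ideal A I \<and> S \<subseteq> I}"

definition coset :: "('f, 'a) kalg \<Rightarrow> 'a set \<Rightarrow> 'a \<Rightarrow> 'a set" where
  "coset A I x = add A x ` I"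

text \<open>
  If \<open>I\<close> is a two-sided ideal, the cosets in each of the unions below all coincide, and the
  operations are the usual ones on representatives.
\<close>

definition quotient_algebra :: "('f, 'a) kalg \<Rightarrow> 'a set \<Rightarrow> ('f, 'a set) kalg" where
  "quotient_algebra A I =
     \<lparr> Carr = coset A I ` Carr A,
       zer = coset A I (zer A),
       add = (\<lambda>X Y. \<Union>x\<in>X. \<Union>y\<in>Y. coset A I (add A x y)),
       scl = (\<lambda>c X. \<Union>x\<in>X. coset A I (scl A c x)),
       mul = (\<lambda>X Y. \<Union>x\<in>X. \<Union>y\<in>Y. coset A I (mul A x y)) \<rparr>"


section \<open>Commutators and simple Lie algebras\<close>

definition commutator :: "('f::field, 'a) kalg \<Rightarrow> 'a \<Rightarrow> 'a \<Rightarrow> 'a" where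
  "commutator R x y = add R (mul R x y) (scl R (- 1) (mul R y x))"

definition commutator_space :: "('f::field, 'a) kalg \<Rightarrow> 'a set" where
  "commutator_space R = alg_span R {commutator R x y | x y. x \<in> Carr R \<and> y \<in> Carr R}"

text \<open>\<open>[R, R]\<close> as a Lie algebra: linear structure inherited from \<open>R\<close>, bracket as product.\<close>

definition commutator_lie_algebra :: "('f::field, 'a) kalg \<Rightarrow> ('f, 'a) kalg" where
  "commutator_lie_algebra R = R\<lparr> Carr := commutator_space R, mul := commutator R \<rparr>"

definition lie_derived :: "('f, 'a) kalg \<Rightarrow> 'a set" where
  "lie_derived L = alg_span L {mul L x y | x y. x \<in> Carr L \<and> y \<in> Carr L}"

definition lie_ideal :: "('f, 'a) kalg \<Rightarrow> 'a set \<Rightarrow> bool" where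
  "lie_ideal L I \<longleftrightarrow> alg_subspace L I \<and> (\<forall>x\<in>Carr L. \<forall>y\<in>I. mul L x y \<in> I)"

definition simple_lie_algebra :: "('f::field, 'a) kalg \<Rightarrow> bool" where
  "simple_lie_algebra L \<longleftrightarrow>
     lie_algebra L \<and> lie_derived L \<noteq> {zer L} \<and>
     (\<forall>I. lie_ideal L I \<longrightarrow> I = {zer L} \<or> I = Carr L)"


section \<open>Free algebras\<close>

datatype 'x fword = Word (letters: "'x list")

instantiation fword :: (type) monoid_add
begin

definition zero_fword :: "'x fword" where
  "zero_fword = Word []"

definition plus_fword :: "'x fword \<Rightarrow> 'x fword \<Rightarrow> 'x fword" where
  "plus_fword u v = Word (letters u @ letters v)"

instance
  by standard (simp_all add: zero_fword_def plus_fword_def)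

end

text \<open>
  The product of \<open>'x fword \<Rightarrow>\<^sub>0 'f\<close> from \<open>Poly_Mapping\<close> is the convolution product with respect
  to \<open>+\<close> on words, that is, concatenation. Only nonempty words are admitted, so that the
  free algebra has no identity.
\<close>

definition free_algebra :: "'x set \<Rightarrow> ('f::field, 'x fword \<Rightarrow>\<^sub>0 'f) kalg" where
  "free_algebra X =
     \<lparr> Carr = {p. \<forall>w\<in>Poly_Mapping.keys p. letters w \<noteq> [] \<and> set (letters w) \<subseteq> X},
       zer = 0, add = (+), scl = (\<lambda>c. Poly_Mapping.map ((*) c)), mul = (*) \<rparr>"

definition free_gen :: "'x \<Rightarrow> 'x fword \<Rightarrow>\<^sub>0 'f::field" where
  "free_gen x = Poly_Mapping.single (Word [x]) 1"


section \<open>The Kumjian-Pask algebra\<close>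

datatype 'l kp_letter = Path 'l | Ghost 'l

definition kp_generators :: "('l, 'k::finite) kgraph \<Rightarrow> 'l kp_letter set" where
  "kp_generators \<Lambda> = Path ` Mor \<Lambda> \<union> Ghost ` (Mor \<Lambda> - Obj \<Lambda>)"

definition path_gen :: "'l \<Rightarrow> 'l kp_letter fword \<Rightarrow>\<^sub>0 'f::field" where
  "path_gen \<kappa> = free_gen (Path \<kappa>)"

text \<open>The case distinction is the convention \<open>v\<^sup>* = v\<close> for vertices.\<close>

definition ghost_gen :: "('l, 'k::finite) kgraph \<Rightarrow> 'l \<Rightarrow> 'l kp_letter fword \<Rightarrow>\<^sub>0 'f::field" where
  "ghost_gen \<Lambda> \<kappa> = free_gen (if \<kappa> \<in> Obj \<Lambda> then Path \<kappa> else Ghost \<kappa>)"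

definition kp1 :: "('l, 'k::finite) kgraph \<Rightarrow> ('l kp_letter fword \<Rightarrow>\<^sub>0 'f::field) set" where
  "kp1 \<Lambda> = {path_gen v * path_gen w - (if v = w then path_gen w else 0) | v w.
              v \<in> Obj \<Lambda> \<and> w \<in> Obj \<Lambda>}"

definition kp2 :: "('l, 'k::finite) kgraph \<Rightarrow> ('l kp_letter fword \<Rightarrow>\<^sub>0 'f::field) set" where
  "kp2 \<Lambda> = {path_gen \<kappa> * path_gen \<mu> - path_gen (cmp \<Lambda> \<kappa> \<mu>) | \<kappa> \<mu>.
              \<kappa> \<in> Mor \<Lambda> \<and> \<mu> \<in> Mor \<Lambda> \<and> rng \<Lambda> \<mu> = src \<Lambda> \<kappa>} \<union>
           {ghost_gen \<Lambda> \<mu> * ghost_gen \<Lambda> \<kappa> - ghost_gen \<Lambda> (cmp \<Lambda> \<kappa> \<mu>) | \<kappa> \<mu>.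
              \<kappa> \<in> Mor \<Lambda> \<and> \<mu> \<in> Mor \<Lambda> \<and> rng \<Lambda> \<mu> = src \<Lambda> \<kappa>}"

definition kp3 :: "('l, 'k::finite) kgraph \<Rightarrow> ('l kp_letter fword \<Rightarrow>\<^sub>0 'f::field) set" where
  "kp3 \<Lambda> = {ghost_gen \<Lambda> \<kappa> * path_gen \<mu> - (if \<kappa> = \<mu> then path_gen (src \<Lambda> \<kappa>) else 0) | \<kappa> \<mu>.
              \<kappa> \<in> Mor \<Lambda> \<and> \<mu> \<in> Mor \<Lambda> \<and> deg \<Lambda> \<kappa> = deg \<Lambda> \<mu>}"

definition kp4 :: "('l, 'k::finite) kgraph \<Rightarrow> ('l kp_letter fword \<Rightarrow>\<^sub>0 'f::field) set" where
  "kp4 \<Lambda> = {path_gen v - (\<Sum>\<kappa>\<in>paths_from \<Lambda> v n. path_gen \<kappa> * ghost_gen \<Lambda> \<kappa>) | v n.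
              v \<in> Obj \<Lambda> \<and> n \<noteq> 0}"

definition kp_relations :: "('l, 'k::finite) kgraph \<Rightarrow> ('l kp_letter fword \<Rightarrow>\<^sub>0 'f::field) set" where
  "kp_relations \<Lambda> = kp1 \<Lambda> \<union> kp2 \<Lambda> \<union> kp3 \<Lambda> \<union> kp4 \<Lambda>"

definition kumjian_pask ::
  "'f::field itself \<Rightarrow> ('l, 'k::finite) kgraph \<Rightarrow> ('f, ('l kp_letter fword \<Rightarrow>\<^sub>0 'f) set) kalg" where
  "kumjian_pask _ \<Lambda> =
     quotient_algebra (free_algebra (kp_generators \<Lambda>))
       (ideal_generated (free_algebra (kp_generators \<Lambda>)) (kp_relations \<Lambda>))"

end

theory Submission
  imports Defs
begin

text \<open>
  Write \<open>R\<close> for the Kumjian-Pask algebra and \<open>L = [R, R]\<close>. The theorem combines three facts.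

  First, \<open>R\<close> is a simple algebra, by a Cuntz-Krieger argument. Every element of \<open>R\<close> is a linear
  combination of products \<open>\<mu> \<nu>\<^sup>*\<close>, and multiplication by a long path turns a nonzero element into a
  nonzero combination of paths. Prolonging these paths along an infinite path that differs from all
  its shifts makes one of them orthogonal to the others, so that its coefficient can be isolated: there are
  \<open>\<alpha>, \<nu>\<close> with \<open>\<alpha>\<^sup>* a \<nu>\<close> a nonzero multiple of a vertex (\<open>compress_to_vertex\<close>). The vertices in an
  ideal form a hereditary and saturated set, which by cofinality is empty or everything
  (\<open>hereditary_saturated_eq_Obj\<close>). If there are finitely many vertices, then
  compressing a central element shows that it is a multiple of the identity; if there are infinitely
  many, then a central element annihilates one of them and is zero.

  Second, a Lie ideal of \<open>L\<close> is either central in \<open>R\<close> or all of \<open>L\<close>. This is a theorem of Herstein on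
  simple rings, proved here by Peirce decomposition for simple algebras with three orthogonal
  idempotents \<open>e\<^sub>0 + e\<^sub>1 + e\<^sub>2 = 1\<close> (\<open>lie_ideal_central_or_full\<close>); it yields \<open>[L, L] \<noteq> 0\<close> as well. In \<open>R\<close>
  such idempotents come from three distinct paths of equal degree, which exist by aperiodicity.
  Consequently, if the graph is not empty, \<open>L\<close> is simple unless it contains a nonzero central element, that is, unless there are
  finitely many vertices and \<open>1 \<in> L\<close>; in that case the multiples of \<open>1\<close> are a proper Lie ideal.

  Third, \<open>R\<close> is given by generators and relations, and it has to be shown that vertices do not
  vanish in it. This follows from the representation of \<open>R\<close> on functions of infinite paths. To
  compute in \<open>R\<close> comfortably, it is embedded into a ring of linear endomorphisms
  (\<open>quotient_embedding\<close>), and the results are carried back along the embedding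
  (\<open>algebra_embedding\<close>).
\<close>

section \<open>Factorisations of paths\<close>

lemma vec_nat_le_iff_add:
  fixes m n :: "nat ^ 'k::finite"
  shows "m \<le> n \<longleftrightarrow> m + (n - m) = n"
  by (auto simp: less_eq_vec_def vec_eq_iff) (metis le_add1)

lemma vec_nat_zero_le [simp]: "0 \<le> (n :: nat ^ 'k::finite)"
  by (simp add: less_eq_vec_def)

lemma vec_nat_le_add [simp]:
  "m \<le> m + (n :: nat ^ 'k::finite)" "m \<le> n + (m :: nat ^ 'k::finite)"
  by (simp_all add: less_eq_vec_def)

lemma vec_nat_diff_add [simp]: "(m + n) - m = (n :: nat ^ 'k::finite)"
  by (simp add: vec_eq_iff)

lemma vec_nat_diff_self [simp]: "m - m = (0 :: nat ^ 'k::finite)"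
  by (simp add: vec_eq_iff)

lemma vec_nat_diff_zero [simp]: "m - 0 = (m :: nat ^ 'k::finite)"
  by (simp add: vec_eq_iff)

text \<open>
  The factorisation is unspecified unless \<open>m \<le> deg \<Lambda> \<kappa>\<close>; the same holds for its two parts.
\<close>

definition factor_path :: "('l, 'k::finite) kgraph \<Rightarrow> 'l \<Rightarrow> nat ^ 'k \<Rightarrow> 'l \<times> 'l" where
  "factor_path \<Lambda> \<kappa> m = (THE p. fst p \<in> Mor \<Lambda> \<and> snd p \<in> Mor \<Lambda> \<and> deg \<Lambda> (fst p) = m
     \<and> deg \<Lambda> (snd p) = deg \<Lambda> \<kappa> - m \<and> src \<Lambda> (fst p) = rng \<Lambda> (snd p) \<and> \<kappa> = cmp \<Lambda> (fst p) (snd p))"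

definition initial_part :: "('l, 'k::finite) kgraph \<Rightarrow> 'l \<Rightarrow> nat ^ 'k \<Rightarrow> 'l" where
  "initial_part \<Lambda> \<kappa> m = fst (factor_path \<Lambda> \<kappa> m)"

definition final_part :: "('l, 'k::finite) kgraph \<Rightarrow> 'l \<Rightarrow> nat ^ 'k \<Rightarrow> 'l" where
  "final_part \<Lambda> \<kappa> m = snd (factor_path \<Lambda> \<kappa> m)"

context k_graph
begin

lemma Obj_Mor: "v \<in> Obj \<Lambda> \<Longrightarrow> v \<in> Mor \<Lambda>"
  using Obj_subset by auto

lemma
  assumes "\<kappa> \<in> Mor \<Lambda>" "m \<le> deg \<Lambda> \<kappa>"
  shows initial_part_Mor: "initial_part \<Lambda> \<kappa> m \<in> Mor \<Lambda>"
    and final_part_Mor: "final_part \<Lambda> \<kappa> m \<in> Mor \<Lambda>"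
    and deg_initial_part: "deg \<Lambda> (initial_part \<Lambda> \<kappa> m) = m"
    and deg_final_part: "deg \<Lambda> (final_part \<Lambda> \<kappa> m) = deg \<Lambda> \<kappa> - m"
    and src_initial_part: "src \<Lambda> (initial_part \<Lambda> \<kappa> m) = rng \<Lambda> (final_part \<Lambda> \<kappa> m)"
    and cmp_initial_final: "cmp \<Lambda> (initial_part \<Lambda> \<kappa> m) (final_part \<Lambda> \<kappa> m) = \<kappa>"
proof -
  have "deg \<Lambda> \<kappa> = m + (deg \<Lambda> \<kappa> - m)"
    using assms(2) by (simp add: vec_nat_le_iff_add)
  note * = theI' [OF factorisation [OF assms(1) this], folded factor_path_def]
  then show "initial_part \<Lambda> \<kappa> m \<in> Mor \<Lambda>" "final_part \<Lambda> \<kappa> m \<in> Mor \<Lambda>"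
    "deg \<Lambda> (initial_part \<Lambda> \<kappa> m) = m" "deg \<Lambda> (final_part \<Lambda> \<kappa> m) = deg \<Lambda> \<kappa> - m"
    "src \<Lambda> (initial_part \<Lambda> \<kappa> m) = rng \<Lambda> (final_part \<Lambda> \<kappa> m)"
    "cmp \<Lambda> (initial_part \<Lambda> \<kappa> m) (final_part \<Lambda> \<kappa> m) = \<kappa>"
    unfolding initial_part_def final_part_def by auto
qed

lemma cmp_cancel:
  assumes "\<alpha> \<in> Mor \<Lambda>" "\<beta> \<in> Mor \<Lambda>" "src \<Lambda> \<alpha> = rng \<Lambda> \<beta>"
    and "\<alpha>' \<in> Mor \<Lambda>" "\<beta>' \<in> Mor \<Lambda>" "src \<Lambda> \<alpha>' = rng \<Lambda> \<beta>'"
    and "cmp \<Lambda> \<alpha> \<beta> = cmp \<Lambda> \<alpha>' \<beta>'" "deg \<Lambda> \<alpha> = deg \<Lambda> \<alpha>'"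
  shows "\<alpha> = \<alpha>' \<and> \<beta> = \<beta>'"
proof -
  have d: "deg \<Lambda> (cmp \<Lambda> \<alpha> \<beta>) = deg \<Lambda> \<alpha> + deg \<Lambda> \<beta>"
    by (rule deg_cmp [OF assms(1-3)])
  then have "deg \<Lambda> \<alpha> + deg \<Lambda> \<beta> = deg \<Lambda> \<alpha>' + deg \<Lambda> \<beta>'"
    using deg_cmp [OF assms(4-6)] assms(7) by metis
  then have "deg \<Lambda> \<beta> = deg \<Lambda> \<beta>'"
    unfolding assms(8) by (rule add_left_imp_eq)
  then have Q: "deg \<Lambda> \<alpha>' = deg \<Lambda> \<alpha>" "deg \<Lambda> \<beta>' = deg \<Lambda> \<beta>"
    using assms(8) by auto
  obtain p where p: "\<And>q. fst q \<in> Mor \<Lambda> \<and> snd q \<in> Mor \<Lambda> \<and> deg \<Lambda> (fst q) = deg \<Lambda> \<alpha>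
      \<and> deg \<Lambda> (snd q) = deg \<Lambda> \<beta> \<and> src \<Lambda> (fst q) = rng \<Lambda> (snd q)
      \<and> cmp \<Lambda> \<alpha> \<beta> = cmp \<Lambda> (fst q) (snd q) \<Longrightarrow> q = p"
    using factorisation [OF cmp_Mor [OF assms(1-3)] d] by (elim ex1E) blast
  have "(\<alpha>, \<beta>) = p"
    by (rule p) (simp add: assms)
  moreover have "(\<alpha>', \<beta>') = p"
    by (rule p) (simp add: assms(1-7) Q)
  ultimately have "(\<alpha>, \<beta>) = (\<alpha>', \<beta>')"
    by simp
  then show ?thesis by simp
qed

lemma
  assumes "\<alpha> \<in> Mor \<Lambda>" "\<beta> \<in> Mor \<Lambda>" "src \<Lambda> \<alpha> = rng \<Lambda> \<beta>" "deg \<Lambda> \<alpha> = m"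
  shows initial_part_cmp: "initial_part \<Lambda> (cmp \<Lambda> \<alpha> \<beta>) m = \<alpha>"
    and final_part_cmp: "final_part \<Lambda> (cmp \<Lambda> \<alpha> \<beta>) m = \<beta>"
proof -
  have *: "cmp \<Lambda> \<alpha> \<beta> \<in> Mor \<Lambda>" "m \<le> deg \<Lambda> (cmp \<Lambda> \<alpha> \<beta>)"
    using assms by (auto simp: cmp_Mor deg_cmp)
  have "initial_part \<Lambda> (cmp \<Lambda> \<alpha> \<beta>) m = \<alpha> \<and> final_part \<Lambda> (cmp \<Lambda> \<alpha> \<beta>) m = \<beta>"
    using assms * by (intro cmp_cancel)
      (auto simp: initial_part_Mor final_part_Mor deg_initial_part src_initial_part cmp_initial_final)
  then show "initial_part \<Lambda> (cmp \<Lambda> \<alpha> \<beta>) m = \<alpha>" "final_part \<Lambda> (cmp \<Lambda> \<alpha> \<beta>) m = \<beta>"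
    by auto
qed

lemma rng_initial_part: "\<lbrakk>\<kappa> \<in> Mor \<Lambda>; m \<le> deg \<Lambda> \<kappa>\<rbrakk> \<Longrightarrow> rng \<Lambda> (initial_part \<Lambda> \<kappa> m) = rng \<Lambda> \<kappa>"
  by (metis cmp_initial_final final_part_Mor initial_part_Mor rng_cmp src_initial_part)

lemma src_final_part: "\<lbrakk>\<kappa> \<in> Mor \<Lambda>; m \<le> deg \<Lambda> \<kappa>\<rbrakk> \<Longrightarrow> src \<Lambda> (final_part \<Lambda> \<kappa> m) = src \<Lambda> \<kappa>"
  by (metis cmp_initial_final final_part_Mor initial_part_Mor src_cmp src_initial_part)

lemma initial_part_initial_part:
  assumes "\<kappa> \<in> Mor \<Lambda>" "n \<le> m" "m \<le> deg \<Lambda> \<kappa>"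
  shows "initial_part \<Lambda> (initial_part \<Lambda> \<kappa> m) n = initial_part \<Lambda> \<kappa> n"
proof -
  let ?i = "initial_part \<Lambda> \<kappa> m" and ?f = "final_part \<Lambda> \<kappa> m"
  let ?ii = "initial_part \<Lambda> ?i n" and ?if = "final_part \<Lambda> ?i n"
  have i: "?i \<in> Mor \<Lambda>" "?f \<in> Mor \<Lambda>" "src \<Lambda> ?i = rng \<Lambda> ?f" "cmp \<Lambda> ?i ?f = \<kappa>" "n \<le> deg \<Lambda> ?i"
    using assms by (auto simp: initial_part_Mor final_part_Mor src_initial_part cmp_initial_final
        deg_initial_part)
  have ii: "?ii \<in> Mor \<Lambda>" "?if \<in> Mor \<Lambda>" "src \<Lambda> ?ii = rng \<Lambda> ?if" "cmp \<Lambda> ?ii ?if = ?i"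
    "deg \<Lambda> ?ii = n" "src \<Lambda> ?if = rng \<Lambda> ?f"
    using i by (auto simp: initial_part_Mor final_part_Mor src_initial_part cmp_initial_final
        deg_initial_part src_final_part)
  have "\<kappa> = cmp \<Lambda> ?ii (cmp \<Lambda> ?if ?f)"
    using i ii cmp_assoc by metis
  then show ?thesis
    using i ii by (metis cmp_Mor initial_part_cmp rng_cmp)
qed

lemma final_part_eq_cmp:
  assumes "\<kappa> \<in> Mor \<Lambda>" "m \<le> n" "n \<le> deg \<Lambda> \<kappa>"
  shows "final_part \<Lambda> \<kappa> m = cmp \<Lambda> (final_part \<Lambda> (initial_part \<Lambda> \<kappa> n) m) (final_part \<Lambda> \<kappa> n)"
proof -
  let ?i = "initial_part \<Lambda> \<kappa> n" and ?f = "final_part \<Lambda> \<kappa> n"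
  let ?ii = "initial_part \<Lambda> ?i m" and ?if = "final_part \<Lambda> ?i m"
  have i: "?i \<in> Mor \<Lambda>" "?f \<in> Mor \<Lambda>" "src \<Lambda> ?i = rng \<Lambda> ?f" "cmp \<Lambda> ?i ?f = \<kappa>" "m \<le> deg \<Lambda> ?i"
    using assms by (auto simp: initial_part_Mor final_part_Mor src_initial_part cmp_initial_final
        deg_initial_part)
  have ii: "?ii \<in> Mor \<Lambda>" "?if \<in> Mor \<Lambda>" "src \<Lambda> ?ii = rng \<Lambda> ?if" "cmp \<Lambda> ?ii ?if = ?i"
    "deg \<Lambda> ?ii = m" "src \<Lambda> ?if = rng \<Lambda> ?f"
    using i by (auto simp: initial_part_Mor final_part_Mor src_initial_part cmp_initial_final
        deg_initial_part src_final_part)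
  have "\<kappa> = cmp \<Lambda> ?ii (cmp \<Lambda> ?if ?f)"
    using i ii cmp_assoc by metis
  then show ?thesis
    using i ii by (metis cmp_Mor final_part_cmp rng_cmp)
qed

lemma final_part_final_part:
  assumes "\<kappa> \<in> Mor \<Lambda>" "m + n \<le> deg \<Lambda> \<kappa>"
  shows "final_part \<Lambda> (final_part \<Lambda> \<kappa> m) n = final_part \<Lambda> \<kappa> (m + n)"
proof -
  have le: "m \<le> m + n" by simp
  have m: "m \<le> deg \<Lambda> \<kappa>"
    using assms(2) le order.trans by blast
  have i: "initial_part \<Lambda> \<kappa> (m + n) \<in> Mor \<Lambda>" "deg \<Lambda> (initial_part \<Lambda> \<kappa> (m + n)) = m + n"
    using assms by (auto simp: initial_part_Mor deg_initial_part)
  show ?thesis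
    unfolding final_part_eq_cmp [OF assms(1) le assms(2)]
    by (rule final_part_cmp)
      (use assms i le in \<open>auto simp: final_part_Mor src_final_part src_initial_part deg_final_part\<close>)
qed

lemma cmp_middle_cancel:
  assumes "\<alpha> \<in> Mor \<Lambda>" "\<beta> \<in> Mor \<Lambda>" "\<gamma> \<in> Mor \<Lambda>" "src \<Lambda> \<alpha> = rng \<Lambda> \<beta>" "src \<Lambda> \<beta> = rng \<Lambda> \<gamma>"
    and "\<alpha>' \<in> Mor \<Lambda>" "\<beta>' \<in> Mor \<Lambda>" "\<gamma>' \<in> Mor \<Lambda>" "src \<Lambda> \<alpha>' = rng \<Lambda> \<beta>'" "src \<Lambda> \<beta>' = rng \<Lambda> \<gamma>'"
    and "cmp \<Lambda> \<alpha> (cmp \<Lambda> \<beta> \<gamma>) = cmp \<Lambda> \<alpha>' (cmp \<Lambda> \<beta>' \<gamma>')"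
    and "deg \<Lambda> \<alpha> = deg \<Lambda> \<alpha>'" "deg \<Lambda> \<beta> = deg \<Lambda> \<beta>'"
  shows "\<beta> = \<beta>'"
proof -
  have "cmp \<Lambda> \<beta> \<gamma> = cmp \<Lambda> \<beta>' \<gamma>'"
    using cmp_cancel [of \<alpha> "cmp \<Lambda> \<beta> \<gamma>" \<alpha>' "cmp \<Lambda> \<beta>' \<gamma>'"] assms by (simp add: cmp_Mor rng_cmp)
  then show ?thesis
    using cmp_cancel [of \<beta> \<gamma> \<beta>' \<gamma>'] assms by simp
qed

lemma paths_from_zero: "v \<in> Obj \<Lambda> \<Longrightarrow> paths_from \<Lambda> v 0 = {v}"
  using Obj_eq_deg_0 rng_id by (auto simp: paths_from_def)

section \<open>Infinite paths\<close>

text \<open>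
  An infinite path \<open>x\<close> is determined by its initial segments \<open>x (0, n)\<close>, and conversely every
  compatible choice of one path of each degree arises in this way. Such a family is easier to
  build and to modify than the functor that it represents.
\<close>

definition coherent :: "(nat ^ 'k \<Rightarrow> 'l) \<Rightarrow> bool" where
  "coherent f \<longleftrightarrow> (\<forall>n. f n \<in> Mor \<Lambda> \<and> deg \<Lambda> (f n) = n) \<and>
     (\<forall>m n. m \<le> n \<longrightarrow> initial_part \<Lambda> (f n) m = f m)"

lemma coherent_Mor: "coherent f \<Longrightarrow> f n \<in> Mor \<Lambda>"
  and coherent_deg: "coherent f \<Longrightarrow> deg \<Lambda> (f n) = n"
  and coherent_initial: "coherent f \<Longrightarrow> m \<le> n \<Longrightarrow> initial_part \<Lambda> (f n) m = f m"
  by (auto simp: coherent_def)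

lemma coherent_zero: "coherent f \<Longrightarrow> f 0 = rng \<Lambda> (f n)"
proof -
  assume f: "coherent f"
  then have "f 0 \<in> Obj \<Lambda>"
    by (simp add: Obj_eq_deg_0 coherent_Mor coherent_deg)
  then have "f 0 = rng \<Lambda> (f 0)"
    by (simp add: rng_id)
  also have "\<dots> = rng \<Lambda> (f n)"
    using rng_initial_part [of "f n" 0] f coherent_initial [OF f, of 0 n]
    by (simp add: coherent_Mor coherent_deg)
  finally show ?thesis .
qed

lemma coherent_infinite_path:
  assumes f: "coherent f"
  defines "x \<equiv> restrict (\<lambda>(m, n). final_part \<Lambda> (f n) m) (Mor Omega)"
  shows "x \<in> infinite_paths \<Lambda>" and "x (m, m) = src \<Lambda> (f m)"
proof -
  note fM = coherent_Mor [OF f] and fd = coherent_deg [OF f]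
  have x: "x (m, n) = final_part \<Lambda> (f n) m" if "m \<le> n" for m n
    using that by (simp add: x_def Omega_def)
  have xM: "x (m, n) \<in> Mor \<Lambda>" "deg \<Lambda> (x (m, n)) = n - m" "src \<Lambda> (x (m, n)) = src \<Lambda> (f n)"
    "rng \<Lambda> (x (m, n)) = src \<Lambda> (f m)"
    if "m \<le> n" for m n
    using that fM fd src_initial_part [of "f n" m] coherent_initial [OF f that]
    by (auto simp: x final_part_Mor deg_final_part src_final_part)
  have xO: "x (m, m) \<in> Obj \<Lambda>" for m
    using xM [of m m] by (simp add: Obj_eq_deg_0)
  show xm: "x (m, m) = src \<Lambda> (f m)" for m
    using xM(3) [of m m] xO [of m] by (simp add: src_id)
  have xc: "x (m, p) = cmp \<Lambda> (x (m, n)) (x (n, p))" if "m \<le> n" "n \<le> p" for m n p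
  proof -
    have "m \<le> p" using that by (rule order.trans)
    then show ?thesis
      using that final_part_eq_cmp [of "f p" m n] fM fd coherent_initial [OF f \<open>n \<le> p\<close>]
      by (simp add: x)
  qed
  have "degree_functor Omega \<Lambda> x"
    unfolding degree_functor_def
    by (auto simp: Omega_def xO xM xm src_Obj fM intro: xc)
  then show "x \<in> infinite_paths \<Lambda>"
    by (simp add: infinite_paths_def x_def)
qed


text \<open>
  The hypotheses on \<open>H\<close> say that it is hereditary and saturated. Saturation allows one to leave
  every vertex outside \<open>H\<close> along a path that ends outside \<open>H\<close> again; iterating gives an infinite
  path which, \<open>H\<close> being hereditary, avoids \<open>H\<close> altogether. Cofinality connects a vertex of \<open>H\<close>
  to that path, which is absurd.
\<close>

lemma hereditary_saturated_eq_Obj: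
  assumes cof: "cofinal_graph \<Lambda>" and H: "H \<subseteq> Obj \<Lambda>" "w \<in> H"
    and hereditary: "\<And>\<kappa>. \<lbrakk>\<kappa> \<in> Mor \<Lambda>; rng \<Lambda> \<kappa> \<in> H\<rbrakk> \<Longrightarrow> src \<Lambda> \<kappa> \<in> H"
    and saturated: "\<And>v n. \<lbrakk>v \<in> Obj \<Lambda>; \<And>\<kappa>. \<kappa> \<in> paths_from \<Lambda> v n \<Longrightarrow> src \<Lambda> \<kappa> \<in> H\<rbrakk> \<Longrightarrow> v \<in> H"
  shows "H = Obj \<Lambda>"
proof (rule ccontr)
  assume "H \<noteq> Obj \<Lambda>"
  then obtain v where v: "v \<in> Obj \<Lambda>" "v \<notin> H" using H by auto
  have "\<exists>\<kappa>. \<kappa> \<in> paths_from \<Lambda> u 1 \<and> src \<Lambda> \<kappa> \<notin> H" if "u \<in> Obj \<Lambda> - H" for u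
    using saturated [of u 1] that by auto
  then obtain ext where ext: "\<And>u. u \<in> Obj \<Lambda> - H \<Longrightarrow> ext u \<in> paths_from \<Lambda> u 1 \<and> src \<Lambda> (ext u) \<notin> H"
    by metis
  define \<rho> where "\<rho> = rec_nat v (\<lambda>_ \<kappa>. cmp \<Lambda> \<kappa> (ext (src \<Lambda> \<kappa>)))"
  have \<rho>0: "\<rho> 0 = v" and \<rho>S: "\<rho> (Suc j) = cmp \<Lambda> (\<rho> j) (ext (src \<Lambda> (\<rho> j)))" for j
    by (simp_all add: \<rho>_def)
  have \<rho>: "\<rho> j \<in> Mor \<Lambda> \<and> deg \<Lambda> (\<rho> j) = vec j \<and> src \<Lambda> (\<rho> j) \<in> Obj \<Lambda> - H" for j
  proof (induction j)
    case 0
    then show ?case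
      using v by (simp add: \<rho>0 Obj_Mor deg_id src_id vec_eq_iff)
  next
    case (Suc j)
    then show ?case
      using ext [of "src \<Lambda> (\<rho> j)"]
      by (auto simp: \<rho>S paths_from_def cmp_Mor deg_cmp src_cmp src_Obj vec_eq_iff)
  qed
  have vec_mono: "vec i \<le> (vec j :: nat ^ 'k)" if "i \<le> j" for i j
    using that by (simp add: less_eq_vec_def)
  have "initial_part \<Lambda> (\<rho> (j + i)) (vec j) = \<rho> j" for i j
  proof (induction i)
    case 0
    have "cmp \<Lambda> (\<rho> j) (src \<Lambda> (\<rho> j)) = \<rho> j"
      by (simp add: \<rho> cmp_id_right)
    then show ?case
      using initial_part_cmp [of "\<rho> j" "src \<Lambda> (\<rho> j)" "vec j"] \<rho> [of j]
      by (simp add: rng_id Obj_Mor)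
  next
    case (Suc i)
    let ?e = "ext (src \<Lambda> (\<rho> (j + i)))"
    have e: "?e \<in> Mor \<Lambda>" "src \<Lambda> (\<rho> (j + i)) = rng \<Lambda> ?e"
      using ext [of "src \<Lambda> (\<rho> (j + i))"] \<rho> [of "j + i"] by (auto simp: paths_from_def)
    have "initial_part \<Lambda> (\<rho> (j + Suc i)) (vec (j + i)) = \<rho> (j + i)"
      using initial_part_cmp [of "\<rho> (j + i)" ?e] e \<rho> [of "j + i"] by (simp add: \<rho>S)
    then show ?case
      using initial_part_initial_part [of "\<rho> (j + Suc i)" "vec j" "vec (j + i)"] \<rho> [of "j + Suc i"] Suc
      by (simp add: vec_mono del: add_Suc_right)
  qed
  then have \<rho>_initial: "initial_part \<Lambda> (\<rho> k) (vec j) = \<rho> j" if "j \<le> k" for j k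
    using that le_Suc_ex by blast
  \<comment> \<open>\<open>\<rho> j\<close> has degree \<open>(j, \<dots>, j)\<close>, which dominates \<open>n\<close> as soon as \<open>j\<close> is the sum of its entries.\<close>
  define tot where "tot n = (\<Sum>i\<in>UNIV. n $ i)" for n :: "nat ^ 'k"
  have tot: "n \<le> vec (tot n)" for n
    by (simp add: less_eq_vec_def tot_def member_le_sum)
  define f where "f n = initial_part \<Lambda> (\<rho> (tot n)) n" for n
  have f: "f n = initial_part \<Lambda> (\<rho> k) n" if "tot n \<le> k" for n k
    using initial_part_initial_part [of "\<rho> k" n "vec (tot n)"] \<rho> [of k] \<rho>_initial [OF that] tot
    by (simp add: f_def vec_mono that)
  have tot_mono: "tot m \<le> tot n" if "m \<le> n" for m n
    using that by (auto simp: tot_def less_eq_vec_def intro: sum_mono)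
  have "coherent f"
    unfolding coherent_def
  proof (intro conjI allI impI)
    show "f n \<in> Mor \<Lambda>" "deg \<Lambda> (f n) = n" for n
      using \<rho> [of "tot n"] tot by (auto simp: f_def initial_part_Mor deg_initial_part)
    show "initial_part \<Lambda> (f n) m = f m" if "m \<le> n" for m n
      using initial_part_initial_part [of "\<rho> (tot n)" m n] \<rho> [of "tot n"] tot [of n] that
        f [OF tot_mono [OF that]]
      by (simp add: f_def [of n])
  qed
  from coherent_infinite_path [OF this] obtain x where x: "x \<in> infinite_paths \<Lambda>" "\<And>m. x (m, m) = src \<Lambda> (f m)"
    by metis
  obtain m where "hom_set \<Lambda> w (x (m, m)) \<noteq> {}"
    using cof x(1) H unfolding cofinal_graph_def by blast
  then obtain \<kappa> where "\<kappa> \<in> Mor \<Lambda>" "rng \<Lambda> \<kappa> = w" "src \<Lambda> \<kappa> = src \<Lambda> (f m)"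
    using x(2) by (auto simp: hom_set_def)
  then have "src \<Lambda> (f m) \<in> H"
    using hereditary H(2) by metis
  then have "rng \<Lambda> (final_part \<Lambda> (\<rho> (tot m)) m) \<in> H"
    using \<rho> [of "tot m"] tot [of m] by (simp add: f_def src_initial_part)
  then have "src \<Lambda> (final_part \<Lambda> (\<rho> (tot m)) m) \<in> H"
    using \<rho> [of "tot m"] tot [of m] by (intro hereditary final_part_Mor) auto
  then show False
    using \<rho> [of "tot m"] tot [of m] by (simp add: src_final_part)
qed

end

section \<open>Aperiodic paths\<close>

context k_graph
begin

lemma
  assumes x: "x \<in> infinite_paths \<Lambda>" and mn: "m \<le> n"
  shows infinite_path_Mor: "x (m, n) \<in> Mor \<Lambda>"
    and deg_infinite_path: "deg \<Lambda> (x (m, n)) = n - m"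
    and src_infinite_path: "src \<Lambda> (x (m, n)) = x (n, n)"
    and rng_infinite_path: "rng \<Lambda> (x (m, n)) = x (m, m)"
    and infinite_path_Obj: "x (m, m) \<in> Obj \<Lambda>"
    and cmp_infinite_path: "n \<le> p \<Longrightarrow> cmp \<Lambda> (x (m, n)) (x (n, p)) = x (m, p)"
proof -
  have f: "degree_functor Omega \<Lambda> x"
    using x by (simp add: infinite_paths_def)
  have mn': "(m, n) \<in> Mor Omega" "(m, m) \<in> Obj Omega"
    using mn by (auto simp: Omega_def)
  show "x (m, n) \<in> Mor \<Lambda>" "x (m, m) \<in> Obj \<Lambda>"
    using f mn' unfolding degree_functor_def by blast+
  have "src \<Lambda> (x (m, n)) = x (src Omega (m, n)) \<and> rng \<Lambda> (x (m, n)) = x (rng Omega (m, n))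
      \<and> deg \<Lambda> (x (m, n)) = deg Omega (m, n)"
    using f mn' unfolding degree_functor_def by blast
  then show "deg \<Lambda> (x (m, n)) = n - m" "src \<Lambda> (x (m, n)) = x (n, n)" "rng \<Lambda> (x (m, n)) = x (m, m)"
    by (simp_all add: Omega_def)
  show "cmp \<Lambda> (x (m, n)) (x (n, p)) = x (m, p)" if "n \<le> p"
  proof -
    have "(n, p) \<in> Mor Omega" "src Omega (m, n) = rng Omega (n, p)"
      using that by (auto simp: Omega_def)
    then have "x (cmp Omega (m, n) (n, p)) = cmp \<Lambda> (x (m, n)) (x (n, p))"
      using f mn' unfolding degree_functor_def by blast
    then show ?thesis by (simp add: Omega_def)
  qed
qed

lemma shift_eqI:
  assumes x: "x \<in> infinite_paths \<Lambda>" and eq: "\<And>j. x (p, p + j) = x (q, q + j)"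
  shows "shift p x = shift q x"
proof -
  have "x (m + p, n + p) = x (m + q, n + q)" if mn: "m \<le> n" for m n
  proof -
    have split: "x (a, a + n) = cmp \<Lambda> (x (a, a + m)) (x (m + a, n + a))"
      and Mor: "x (a, a + m) \<in> Mor \<Lambda>" "x (m + a, n + a) \<in> Mor \<Lambda>"
      and sr: "src \<Lambda> (x (a, a + m)) = rng \<Lambda> (x (m + a, n + a))"
      and deg: "deg \<Lambda> (x (a, a + m)) = m" for a
    proof -
      have *: "a \<le> a + m" "a + m \<le> a + n" "m + a \<le> n + a"
        using mn by (auto simp: less_eq_vec_def)
      show "x (a, a + n) = cmp \<Lambda> (x (a, a + m)) (x (m + a, n + a))"
        using cmp_infinite_path [OF x *(1,2)] by (simp add: add.commute)
      show "x (a, a + m) \<in> Mor \<Lambda>" "x (m + a, n + a) \<in> Mor \<Lambda>"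
        using infinite_path_Mor [OF x] * by auto
      show "src \<Lambda> (x (a, a + m)) = rng \<Lambda> (x (m + a, n + a))"
        using src_infinite_path [OF x *(1)] rng_infinite_path [OF x *(3)] by (simp add: add.commute)
      show "deg \<Lambda> (x (a, a + m)) = m"
        using deg_infinite_path [OF x *(1)] by simp
    qed
    show ?thesis
      using cmp_cancel [OF Mor [of p] sr [of p] Mor [of q] sr [of q]] eq [of n] deg [of p] deg [of q]
      by (simp add: split)
  qed
  then show ?thesis
    by (auto simp: shift_def Omega_def fun_eq_iff)
qed

text \<open>
  If \<open>\<alpha> x\<^sub>n\<close> and \<open>\<mu> x\<^sub>n\<close>, where \<open>x\<^sub>n = x (0, n)\<close>, have a common extension for a large \<open>n\<close>, then
  comparing its segments that start in degree \<open>deg \<alpha> + deg \<mu>\<close> shows that a long initial piece of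
  \<open>x\<close> shifted by \<open>deg \<mu>\<close> agrees with one of \<open>x\<close> shifted by \<open>deg \<alpha>\<close>.
\<close>

lemma no_common_extension:
  assumes x: "x \<in> infinite_paths \<Lambda>" and aperiodic: "\<And>m n. m \<noteq> n \<Longrightarrow> shift m x \<noteq> shift n x"
    and \<alpha>: "\<alpha> \<in> Mor \<Lambda>" "src \<Lambda> \<alpha> = x (0, 0)" and \<mu>: "\<mu> \<in> Mor \<Lambda>" "src \<Lambda> \<mu> = x (0, 0)"
    and ne: "\<alpha> \<noteq> \<mu>"
  shows "\<exists>N. \<forall>n\<ge>N. \<forall>\<eta>\<in>Mor \<Lambda>. \<forall>\<zeta>\<in>Mor \<Lambda>. rng \<Lambda> \<eta> = x (n, n) \<longrightarrow> rng \<Lambda> \<zeta> = x (n, n) \<longrightarrow>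
           cmp \<Lambda> (cmp \<Lambda> \<alpha> (x (0, n))) \<eta> \<noteq> cmp \<Lambda> (cmp \<Lambda> \<mu> (x (0, n))) \<zeta>"
proof -
  note facts = infinite_path_Mor [OF x] deg_infinite_path [OF x] src_infinite_path [OF x]
    rng_infinite_path [OF x]
  let ?p = "deg \<Lambda> \<alpha>" and ?q = "deg \<Lambda> \<mu>"
  have assoc: "cmp \<Lambda> (cmp \<Lambda> \<kappa> (x (0, n))) \<eta> = cmp \<Lambda> \<kappa> (cmp \<Lambda> (x (0, n)) \<eta>)"
    if "\<kappa> \<in> Mor \<Lambda>" "src \<Lambda> \<kappa> = x (0, 0)" "\<eta> \<in> Mor \<Lambda>" "rng \<Lambda> \<eta> = x (n, n)" for \<kappa> n \<eta>
    using that by (intro cmp_assoc) (auto simp: facts)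
  show ?thesis
  proof (cases "?p = ?q")
    case True
    have "cmp \<Lambda> (cmp \<Lambda> \<alpha> (x (0, n))) \<eta> \<noteq> cmp \<Lambda> (cmp \<Lambda> \<mu> (x (0, n))) \<zeta>"
      if \<eta>: "\<eta> \<in> Mor \<Lambda>" "rng \<Lambda> \<eta> = x (n, n)" and \<zeta>: "\<zeta> \<in> Mor \<Lambda>" "rng \<Lambda> \<zeta> = x (n, n)" for n \<eta> \<zeta>
    proof
      assume "cmp \<Lambda> (cmp \<Lambda> \<alpha> (x (0, n))) \<eta> = cmp \<Lambda> (cmp \<Lambda> \<mu> (x (0, n))) \<zeta>"
      then have "cmp \<Lambda> \<alpha> (cmp \<Lambda> (x (0, n)) \<eta>) = cmp \<Lambda> \<mu> (cmp \<Lambda> (x (0, n)) \<zeta>)"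
        using \<alpha> \<mu> \<eta> \<zeta> by (simp add: assoc)
      then have "\<alpha> = \<mu>"
        using cmp_cancel [of \<alpha> "cmp \<Lambda> (x (0, n)) \<eta>" \<mu> "cmp \<Lambda> (x (0, n)) \<zeta>"] \<alpha> \<mu> \<eta> \<zeta> True
        by (simp add: facts cmp_Mor rng_cmp)
      then show False using ne by simp
    qed
    then show ?thesis by blast
  next
    case False
    then obtain j where j: "x (?p, ?p + j) \<noteq> x (?q, ?q + j)"
      using aperiodic shift_eqI [OF x] by metis
    have "cmp \<Lambda> (cmp \<Lambda> \<alpha> (x (0, n))) \<eta> \<noteq> cmp \<Lambda> (cmp \<Lambda> \<mu> (x (0, n))) \<zeta>"
      if n: "?p + ?q + j \<le> n"
        and \<eta>: "\<eta> \<in> Mor \<Lambda>" "rng \<Lambda> \<eta> = x (n, n)" and \<zeta>: "\<zeta> \<in> Mor \<Lambda>" "rng \<Lambda> \<zeta> = x (n, n)" for n \<eta> \<zeta>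
    proof
      assume eq: "cmp \<Lambda> (cmp \<Lambda> \<alpha> (x (0, n))) \<eta> = cmp \<Lambda> (cmp \<Lambda> \<mu> (x (0, n))) \<zeta>"
      have split: "cmp \<Lambda> (cmp \<Lambda> \<kappa> (x (0, n))) \<theta>
          = cmp \<Lambda> (cmp \<Lambda> \<kappa> (x (0, a))) (cmp \<Lambda> (x (a, a + j)) (cmp \<Lambda> (x (a + j, n)) \<theta>))"
        if a: "a + j \<le> n" and \<kappa>: "\<kappa> \<in> Mor \<Lambda>" "src \<Lambda> \<kappa> = x (0, 0)" and \<theta>: "\<theta> \<in> Mor \<Lambda>" "rng \<Lambda> \<theta> = x (n, n)"
        for a \<kappa> \<theta>
      proof -
        have le: "a \<le> n" using a vec_nat_le_add(1) order.trans by blast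
        have "x (0, n) = cmp \<Lambda> (x (0, a)) (cmp \<Lambda> (x (a, a + j)) (x (a + j, n)))"
          using a le cmp_infinite_path [OF x] by simp
        then show ?thesis
          using a le \<kappa> \<theta> by (simp add: cmp_assoc facts cmp_Mor src_cmp rng_cmp)
      qed
      have le: "?q + j \<le> n" "?p + j \<le> n"
        using n by (auto simp: less_eq_vec_def) (metis add.assoc add.commute add_leD1 add_leD2)+
      have eq': "cmp \<Lambda> (cmp \<Lambda> \<alpha> (x (0, ?q))) (cmp \<Lambda> (x (?q, ?q + j)) (cmp \<Lambda> (x (?q + j, n)) \<eta>))
          = cmp \<Lambda> (cmp \<Lambda> \<mu> (x (0, ?p))) (cmp \<Lambda> (x (?p, ?p + j)) (cmp \<Lambda> (x (?p + j, n)) \<zeta>))"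
        using eq unfolding split [OF le(1) \<alpha> \<eta>] split [OF le(2) \<mu> \<zeta>] .
      have "x (?q, ?q + j) = x (?p, ?p + j)"
        by (rule cmp_middle_cancel [OF _ _ _ _ _ _ _ _ _ _ eq'])
          (use \<alpha> \<mu> \<eta> \<zeta> le in \<open>simp_all add: facts cmp_Mor src_cmp rng_cmp deg_cmp add.commute\<close>)
      then show False using j by simp
    qed
    then show ?thesis by blast
  qed
qed

text \<open>
  If \<open>v\<close> received only one path of each degree, then the unique infinite path from \<open>v\<close> would,
  among finitely many vertices, visit one of them twice, and would look the same from there both
  times, so that two of its shifts would agree.
\<close>

lemma two_paths_from:
  assumes aperiodic: "aperiodic_graph \<Lambda>" and fin: "finite (Obj \<Lambda>)" and v: "v \<in> Obj \<Lambda>"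
  shows "\<exists>n \<kappa> \<mu>. \<kappa> \<in> paths_from \<Lambda> v n \<and> \<mu> \<in> paths_from \<Lambda> v n \<and> \<kappa> \<noteq> \<mu>"
proof (rule ccontr)
  assume "\<not> ?thesis"
  then have unique: "\<kappa> = \<mu>" if "\<kappa> \<in> paths_from \<Lambda> v n" "\<mu> \<in> paths_from \<Lambda> v n" for n \<kappa> \<mu>
    using that by blast
  obtain x where "x \<in> cylinder \<Lambda> v" and ap: "\<And>m n. m \<noteq> n \<Longrightarrow> shift m x \<noteq> shift n x"
    using aperiodic v unfolding aperiodic_graph_def by blast
  then have x: "x \<in> infinite_paths \<Lambda>" and x0: "x (0, 0) = v"
    using v by (auto simp: cylinder_def deg_id)
  note facts = infinite_path_Mor [OF x] deg_infinite_path [OF x] src_infinite_path [OF x]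
    rng_infinite_path [OF x]
  let ?w = "\<lambda>i::nat. x (vec i, vec i)"
  have "range ?w \<subseteq> Obj \<Lambda>"
    using infinite_path_Obj [OF x order.refl] by auto
  then have "\<not> inj ?w"
    using fin finite_subset range_inj_infinite by blast
  then obtain i j where ij: "i \<noteq> j" "?w i = ?w j"
    by (auto simp: inj_def)
  let ?m = "vec i :: nat ^ 'k" and ?n = "vec j :: nat ^ 'k"
  have ne: "?m \<noteq> ?n" using ij(1) by (simp add: vec_eq_iff)
  have "x (?m, ?m + q) = x (?n, ?n + q)" for q
  proof -
    have "cmp \<Lambda> (x (0, ?m)) (x (?m, ?m + q)) \<in> paths_from \<Lambda> v (?m + q)"
      "cmp \<Lambda> (x (0, ?m)) (x (?n, ?n + q)) \<in> paths_from \<Lambda> v (?m + q)"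
      using ij(2) by (auto simp: paths_from_def cmp_Mor deg_cmp rng_cmp facts x0)
    then have "cmp \<Lambda> (x (0, ?m)) (x (?m, ?m + q)) = cmp \<Lambda> (x (0, ?m)) (x (?n, ?n + q))"
      by (rule unique)
    then show ?thesis
      using cmp_cancel [of "x (0, ?m)" "x (?m, ?m + q)" "x (0, ?m)" "x (?n, ?n + q)"] ij(2)
      by (simp add: facts)
  qed
  then show False
    using ap [OF ne] shift_eqI [OF x] by blast
qed

text \<open>
  If there are infinitely many vertices, then three of them will do. Otherwise a vertex receives
  two paths of some degree; prolonging one of them in two ways and the other in one way gives three
  paths.
\<close>

lemma three_paths:
  assumes ns: "no_sources \<Lambda>" and aperiodic: "aperiodic_graph \<Lambda>" and ne: "Obj \<Lambda> \<noteq> {}"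
  shows "\<exists>\<kappa> \<mu> \<nu>. {\<kappa>, \<mu>, \<nu>} \<subseteq> Mor \<Lambda> \<and> \<kappa> \<noteq> \<mu> \<and> \<kappa> \<noteq> \<nu> \<and> \<mu> \<noteq> \<nu> \<and> deg \<Lambda> \<kappa> = deg \<Lambda> \<mu> \<and> deg \<Lambda> \<mu> = deg \<Lambda> \<nu>"
proof (cases "finite (Obj \<Lambda>)")
  case False
  then obtain u where u: "u \<in> Obj \<Lambda>" by (metis finite.emptyI ex_in_conv)
  from False have "infinite (Obj \<Lambda> - {u})" by simp
  then obtain v where v: "v \<in> Obj \<Lambda> - {u}" by (metis finite.emptyI ex_in_conv)
  from False have "infinite (Obj \<Lambda> - {u, v})" by simp
  then obtain w where w: "w \<in> Obj \<Lambda> - {u, v}" by (metis finite.emptyI ex_in_conv)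
  show ?thesis
    using u v w by (intro exI [of _ u] exI [of _ v] exI [of _ w]) (auto simp: Obj_Mor deg_id)
next
  case True
  obtain v where v: "v \<in> Obj \<Lambda>" using ne by auto
  obtain n \<kappa> \<mu> where \<kappa>\<mu>: "\<kappa> \<in> paths_from \<Lambda> v n" "\<mu> \<in> paths_from \<Lambda> v n" "\<kappa> \<noteq> \<mu>"
    using two_paths_from [OF aperiodic True v] by blast
  then have Mor: "\<kappa> \<in> Mor \<Lambda>" "\<mu> \<in> Mor \<Lambda>" "deg \<Lambda> \<kappa> = n" "deg \<Lambda> \<mu> = n"
    by (auto simp: paths_from_def)
  obtain m \<eta> \<zeta> where \<eta>\<zeta>: "\<eta> \<in> paths_from \<Lambda> (src \<Lambda> \<kappa>) m" "\<zeta> \<in> paths_from \<Lambda> (src \<Lambda> \<kappa>) m" "\<eta> \<noteq> \<zeta>"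
    using two_paths_from [OF aperiodic True src_Obj [OF Mor(1)]] by blast
  obtain \<theta> where \<theta>: "\<theta> \<in> paths_from \<Lambda> (src \<Lambda> \<mu>) m"
    using ns src_Obj [OF Mor(2)] unfolding no_sources_def by blast
  have M: "\<eta> \<in> Mor \<Lambda>" "\<zeta> \<in> Mor \<Lambda>" "\<theta> \<in> Mor \<Lambda>" "rng \<Lambda> \<eta> = src \<Lambda> \<kappa>" "rng \<Lambda> \<zeta> = src \<Lambda> \<kappa>"
    "rng \<Lambda> \<theta> = src \<Lambda> \<mu>" "deg \<Lambda> \<eta> = m" "deg \<Lambda> \<zeta> = m" "deg \<Lambda> \<theta> = m"
    using \<eta>\<zeta> \<theta> by (auto simp: paths_from_def)
  have "cmp \<Lambda> \<kappa> \<eta> \<noteq> cmp \<Lambda> \<kappa> \<zeta>"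
    using cmp_cancel [OF Mor(1) M(1) M(4) [symmetric] Mor(1) M(2) M(5) [symmetric]] \<eta>\<zeta>(3) by blast
  moreover have "cmp \<Lambda> \<kappa> \<eta> \<noteq> cmp \<Lambda> \<mu> \<theta>"
    using cmp_cancel [OF Mor(1) M(1) M(4) [symmetric] Mor(2) M(3) M(6) [symmetric]] \<kappa>\<mu>(3) Mor(3,4) by metis
  moreover have "cmp \<Lambda> \<kappa> \<zeta> \<noteq> cmp \<Lambda> \<mu> \<theta>"
    using cmp_cancel [OF Mor(1) M(2) M(5) [symmetric] Mor(2) M(3) M(6) [symmetric]] \<kappa>\<mu>(3) Mor(3,4) by metis
  ultimately show ?thesis
    using Mor M by (intro exI [of _ "cmp \<Lambda> \<kappa> \<eta>"] exI [of _ "cmp \<Lambda> \<kappa> \<zeta>"] exI [of _ "cmp \<Lambda> \<mu> \<theta>"])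
      (auto simp: cmp_Mor deg_cmp)
qed

end

section \<open>Lie ideals of commutators in simple algebras\<close>

locale algebra_1 = vector_space scale
  for scale :: "'f::field \<Rightarrow> 'a::ring_1 \<Rightarrow> 'a" (infixr "\<cdot>" 75) +
  assumes scale_mult_left: "(c \<cdot> x) * y = c \<cdot> (x * y)"
    and scale_mult_right: "x * (c \<cdot> y) = c \<cdot> (x * y)"
begin

definition comm_span :: "'a set \<Rightarrow> 'a set" where
  "comm_span A = span {x * y - y * x | x y. x \<in> A \<and> y \<in> A}"

definition lie_ideal_in :: "'a set \<Rightarrow> 'a set \<Rightarrow> bool" where
  "lie_ideal_in L U \<longleftrightarrow> subspace U \<and> U \<subseteq> L \<and> (\<forall>x\<in>L. \<forall>u\<in>U. x * u - u * x \<in> U)"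

lemma comm_in_comm_span: "\<lbrakk>x \<in> A; y \<in> A\<rbrakk> \<Longrightarrow> x * y - y * x \<in> comm_span A"
  unfolding comm_span_def by (rule span_base) auto

lemma subspace_two_sided_preimage: "subspace S \<Longrightarrow> subspace {x. p * x * q \<in> S}"
  by (rule subspaceI)
    (auto simp: subspace_0 subspace_add subspace_scale distrib_left distrib_right
      scale_mult_left scale_mult_right)

end

text \<open>
  The subset \<open>A\<close> is a subalgebra without regard to the unit of the ambient ring: it may have
  another unit or none. The ambient unit serves for complementary idempotents \<open>1 - e\<close>.
\<close>

locale subalgebra = algebra_1 scale
  for scale :: "'f::field \<Rightarrow> 'a::ring_1 \<Rightarrow> 'a" (infixr "\<cdot>" 75) +
  fixes A :: "'a set"
  assumes subspace_A: "subspace A"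
    and mult_A: "\<lbrakk>x \<in> A; y \<in> A\<rbrakk> \<Longrightarrow> x * y \<in> A"
begin

lemma diff_A: "\<lbrakk>x \<in> A; y \<in> A\<rbrakk> \<Longrightarrow> x - y \<in> A"
  and scale_A: "x \<in> A \<Longrightarrow> c \<cdot> x \<in> A"
  using subspace_A by (auto intro: subspace_diff subspace_scale)

lemma comm_span_subset: "comm_span A \<subseteq> A"
  unfolding comm_span_def by (rule span_minimal) (auto simp: subspace_A diff_A mult_A)

end

locale simple_subalgebra = subalgebra scale A
  for scale :: "'f::field \<Rightarrow> 'a::ring_1 \<Rightarrow> 'a" (infixr "\<cdot>" 75) and A :: "'a set" +
  assumes simple: "\<lbrakk>a \<in> A; a \<noteq> 0\<rbrakk> \<Longrightarrow> A \<subseteq> span {x * a * y | x y. x \<in> A \<and> y \<in> A}"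
begin

text \<open>
  Every \<open>r \<in> A\<close> is a combination of elements \<open>x * a * y\<close>, and \<open>r \<mapsto> p * r * q\<close> is linear. So it
  suffices to reach a subspace from the elements of the ideal generated by one nonzero \<open>a\<close>.
\<close>

lemma ideal_span_induct:
  assumes "a \<in> A" "a \<noteq> 0" "subspace S" "\<And>x y. \<lbrakk>x \<in> A; y \<in> A\<rbrakk> \<Longrightarrow> p * (x * a * y) * q \<in> S"
    and "r \<in> A"
  shows "p * r * q \<in> S"
proof -
  have "span {x * a * y | x y. x \<in> A \<and> y \<in> A} \<subseteq> {r. p * r * q \<in> S}"
    by (rule span_minimal) (use assms(3,4) in \<open>auto simp: subspace_two_sided_preimage\<close>)
  then show ?thesis
    using simple [OF assms(1,2)] assms(5) by auto
qed

text \<open>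
  If \<open>a * A * b = 0\<close>, then \<open>A * b = 0\<close> because \<open>a\<close> generates \<open>A\<close> as an ideal; then the ideal generated
  by \<open>b\<close> vanishes as well.
\<close>

lemma prime:
  assumes a: "a \<in> A" "a \<noteq> 0" and b: "b \<in> A" "b \<noteq> 0"
  shows "\<exists>c\<in>A. a * c * b \<noteq> 0"
proof (rule ccontr)
  assume "\<not> (\<exists>c\<in>A. a * c * b \<noteq> 0)"
  then have 0: "\<And>c. c \<in> A \<Longrightarrow> a * c * b = 0" by auto
  have "1 * r * b \<in> {0}" if "r \<in> A" for r
    by (rule ideal_span_induct [OF a _ _ that]) (simp_all add: mult.assoc 0 [unfolded mult.assoc])
  then have rb: "r * b = 0" if "r \<in> A" for r using that by simp
  have "1 * b * 1 \<in> {0}"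
    by (rule ideal_span_induct [OF b _ _ b(1)]) (simp_all add: rb)
  then show False using b by simp
qed

end

text \<open>
  The third idempotent is \<open>1 - e 0 - e 1\<close>. If \<open>A\<close> has no unit, or another one than the ambient
  ring, then it lies outside of \<open>A\<close>, but multiplication by it still preserves \<open>A\<close>.
\<close>

locale idempotent_triple = simple_subalgebra scale A
  for scale :: "'f::field \<Rightarrow> 'a::ring_1 \<Rightarrow> 'a" (infixr "\<cdot>" 75) and A :: "'a set" +
  fixes e :: "nat \<Rightarrow> 'a"
  assumes orthogonal: "\<lbrakk>i < 3; j < 3\<rbrakk> \<Longrightarrow> e i * e j = (if i = j then e i else 0)"
    and complete: "e 0 + e 1 + e 2 = 1"
    and mult_e: "\<lbrakk>i < 3; x \<in> A\<rbrakk> \<Longrightarrow> e i * x \<in> A" "\<lbrakk>i < 3; x \<in> A\<rbrakk> \<Longrightarrow> x * e i \<in> A"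
    and e_in_A: "i < 2 \<Longrightarrow> e i \<in> A"
    and e_acts: "i < 3 \<Longrightarrow> \<exists>x\<in>A. e i * x \<noteq> 0"
begin

lemma ee: "\<lbrakk>i < 3; j < 3; i \<noteq> j\<rbrakk> \<Longrightarrow> e i * e j = 0"
  and ee': "\<lbrakk>i < 3; j < 3; i \<noteq> j\<rbrakk> \<Longrightarrow> e i * (e j * x) = 0"
  and e2: "i < 3 \<Longrightarrow> e i * e i = e i"
  and e2': "i < 3 \<Longrightarrow> e i * (e i * x) = e i * x"
  by (simp_all add: orthogonal mult.assoc [symmetric])

lemmas e_simps = ee ee' e2 e2' mult.assoc

lemma e_acts_right: "i < 3 \<Longrightarrow> \<exists>x\<in>A. x * e i \<noteq> 0"
proof -
  assume i: "i < 3"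
  obtain x where x: "x \<in> A" "e i * x \<noteq> 0" using e_acts [OF i] by auto
  then obtain c where "c \<in> A" "(e i * x) * c * (e i * x) \<noteq> 0"
    using prime [of "e i * x" "e i * x"] mult_e i by auto
  then have "(e i * x * c) * e i \<noteq> 0" "e i * x * c \<in> A"
    using x i by (auto simp: mult_e mult_A mult.assoc [symmetric])
  then show ?thesis by blast
qed

lemma corner_nonzero:
  assumes "i < 3" "j < 3"
  shows "\<exists>r\<in>A. e i * r * e j \<noteq> 0"
proof -
  obtain x y where xy: "x \<in> A" "e i * x \<noteq> 0" "y \<in> A" "y * e j \<noteq> 0"
    using e_acts e_acts_right assms by meson
  then obtain c where "c \<in> A" "(e i * x) * c * (y * e j) \<noteq> 0"
    using prime [of "e i * x" "y * e j"] mult_e assms by auto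
  then have "e i * (x * c * y) * e j \<noteq> 0" "x * c * y \<in> A"
    using xy by (auto simp: mult.assoc mult_A)
  then show ?thesis by blast
qed

lemma corner_A: "\<lbrakk>i < 3; j < 3; r \<in> A\<rbrakk> \<Longrightarrow> e i * r * e j \<in> A"
  by (simp add: mult_e)

text \<open>
  An off-diagonal element is its own commutator with the idempotent on one of its sides, up to
  sign. At least one of the two lies in \<open>A\<close>, because the indices differ.
\<close>

lemma off_diagonal_comm_span:
  assumes "i < 3" "j < 3" "i \<noteq> j" "r \<in> A"
  shows "e i * r * e j \<in> comm_span A"
proof (cases "i < 2")
  case True
  then have "e i * (e i * r * e j) - (e i * r * e j) * e i \<in> comm_span A"
    using assms by (intro comm_in_comm_span) (auto simp: e_in_A corner_A)
  then show ?thesis using assms by (simp add: e_simps)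
next
  case False
  then have "j < 2" using assms by auto
  then have "(e i * r * e j) * e j - e j * (e i * r * e j) \<in> comm_span A"
    using assms by (intro comm_in_comm_span) (auto simp: e_in_A corner_A)
  then show ?thesis using assms by (simp add: e_simps)
qed

lemma peirce: "x = (\<Sum>i<3. \<Sum>j<3. e i * x * e j)"
proof -
  have "(\<Sum>i<3. e i) = 1"
    using complete by (simp add: numeral_3_eq_3 numeral_2_eq_2)
  moreover have "(\<Sum>i<3. e i) * x * (\<Sum>j<3. e j) = (\<Sum>i<3. \<Sum>j<3. e i * x * e j)"
    by (simp only: sum_distrib_right [of _ _ x] sum_product)
  ultimately show ?thesis by simp
qed

lemma other_index: "\<exists>l<3. l \<noteq> i \<and> l \<noteq> (j::nat)"
proof -
  have "0 < (3::nat)" "1 < (3::nat)" "2 < (3::nat)" by auto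
  moreover have "(0::nat) \<noteq> 1" "(0::nat) \<noteq> 2" "(1::nat) \<noteq> 2" by auto
  ultimately show ?thesis by metis
qed

text \<open>
  By simplicity, each diagonal corner \<open>e i * A * e i\<close> is spanned by products of two off-diagonal
  elements, so the off-diagonal corners control the whole algebra.
\<close>

lemma off_diagonal_induct:
  assumes S: "subspace S"
    and off: "\<And>i j r. \<lbrakk>i < 3; j < 3; i \<noteq> j; r \<in> A\<rbrakk> \<Longrightarrow> e i * r * e j \<in> S"
    and prod: "\<And>i j r s. \<lbrakk>i < 3; j < 3; i \<noteq> j; r \<in> A; s \<in> A\<rbrakk>
                 \<Longrightarrow> (e i * r * e j) * (e j * s * e i) \<in> S"
    and x: "x \<in> A"
  shows "x \<in> S"
proof -
  have "e i * x * e j \<in> S" if ij: "i < 3" "j < 3" for i j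
  proof (cases "i = j")
    case False
    then show ?thesis using off ij x by blast
  next
    case True
    obtain k where k: "k < 3" "k \<noteq> i" using other_index by blast
    obtain a where a: "a \<in> A" "e k * a \<noteq> 0" using e_acts [OF k(1)] by auto
    have step: "e i * (y * (e k * a) * z) * e i \<in> S" if "y \<in> A" "z \<in> A" for y z
      using prod [of i k y "a * z"] that a ij k by (simp add: e_simps mult_A)
    have "e i * x * e i \<in> S"
      by (rule ideal_span_induct [OF _ a(2) S _ x]) (auto simp: step mult_e k a)
    then show ?thesis by (simp add: True)
  qed
  then show ?thesis
    using S by (subst peirce [of x]) (intro subspace_sum, auto)
qed

context
  fixes U
  assumes U: "lie_ideal_in (comm_span A) U"
begin

lemma U_subspace: "subspace U"
  and U_subset: "u \<in> U \<Longrightarrow> u \<in> comm_span A"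
  and U_bracket: "\<lbrakk>x \<in> comm_span A; u \<in> U\<rbrakk> \<Longrightarrow> x * u - u * x \<in> U"
  using U by (auto simp: lie_ideal_in_def)

lemma U_A: "u \<in> U \<Longrightarrow> u \<in> A"
  using U_subset comm_span_subset by auto

lemma U_bracket': "\<lbrakk>x \<in> comm_span A; u \<in> U\<rbrakk> \<Longrightarrow> u * x - x * u \<in> U"
  using subspace_neg [OF U_subspace U_bracket] by fastforce

text \<open>
  For a nonzero \<open>a\<close> of \<open>U\<close> in the \<open>(i, j)\<close> corner, bracketing with the \<open>(j, k)\<close> and then with the
  \<open>(j, i)\<close> corner produces all \<open>e j * y * a * x * e k\<close>, and these span the \<open>(j, k)\<close> corner.
\<close>

lemma rotate_corner:
  assumes ijk: "i < 3" "j < 3" "k < 3" "i \<noteq> j" "j \<noteq> k" "i \<noteq> k"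
    and a: "e i * a * e j \<in> U" "e i * a * e j \<noteq> 0" and r: "r \<in> A"
  shows "e j * r * e k \<in> U"
proof -
  let ?a = "e i * a * e j"
  have step: "e j * (y * ?a * x) * e k \<in> U" if x: "x \<in> A" and y: "y \<in> A" for x y
  proof -
    have "?a * (e j * x * e k) - (e j * x * e k) * ?a \<in> U"
      using ijk x a by (intro U_bracket' off_diagonal_comm_span) auto
    then have "?a * x * e k \<in> U"
      using ijk by (simp add: e_simps)
    then have "(e j * y * e i) * (?a * x * e k) - (?a * x * e k) * (e j * y * e i) \<in> U"
      using ijk y by (intro U_bracket off_diagonal_comm_span) auto
    then show ?thesis
      using ijk by (simp add: e_simps)
  qed
  show ?thesis
    by (rule ideal_span_induct [OF U_A [OF a(1)] a(2) U_subspace step r])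
qed

lemma change_left_corner:
  assumes ijk: "i < 3" "j < 3" "k < 3" "i \<noteq> j" "j \<noteq> k" "i \<noteq> k"
    and full: "\<And>r. r \<in> A \<Longrightarrow> e j * r * e k \<in> U" and r: "r \<in> A"
  shows "e i * r * e k \<in> U"
proof -
  obtain a where a: "a \<in> A" "e j * a \<noteq> 0" using e_acts ijk by blast
  have step: "e i * (x * (e j * a) * y) * e k \<in> U" if x: "x \<in> A" and y: "y \<in> A" for x y
  proof -
    have "(e i * x * e j) * (e j * (a * y) * e k) - (e j * (a * y) * e k) * (e i * x * e j) \<in> U"
      using ijk x y a by (intro U_bracket off_diagonal_comm_span full) (auto simp: mult_A)
    then show ?thesis using ijk by (simp add: e_simps)
  qed
  show ?thesis
    by (rule ideal_span_induct [OF _ a(2) U_subspace step r]) (auto simp: mult_e ijk a)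
qed

lemma off_diagonal_in_U:
  assumes ij: "i < 3" "j < 3" "i \<noteq> j" and a: "e i * a * e j \<in> U" "e i * a * e j \<noteq> 0"
    and pq: "p < 3" "q < 3" "p \<noteq> q" and r: "r \<in> A"
  shows "e p * r * e q \<in> U"
proof -
  obtain k where k: "k < 3" "k \<noteq> i" "k \<noteq> j" using other_index by blast
  define full where "full m n \<longleftrightarrow> (\<forall>r\<in>A. e m * r * e n \<in> U)" for m n
  have jk: "full j k"
    unfolding full_def using rotate_corner [OF _ _ _ _ _ _ a] ij k by auto
  have rot: "full n l" if "full m n" "m < 3" "n < 3" "l < 3" "m \<noteq> n" "n \<noteq> l" "m \<noteq> l" for m n l
    using corner_nonzero [of m n] that rotate_corner [of m n l] unfolding full_def by metis
  have left: "full l n" if "full m n" "m < 3" "n < 3" "l < 3" "m \<noteq> n" "n \<noteq> l" "m \<noteq> l" for m n l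
    using that change_left_corner [of l m n] unfolding full_def by metis
  have ki: "full k i" using rot [OF jk] ij k by auto
  have ij': "full i j" using rot [OF ki] ij k by auto
  have "full j i" "full k j" "full i k"
    using left [OF ki] left [OF ij'] left [OF jk] ij k by auto
  moreover have "p \<in> {i, j, k}" "q \<in> {i, j, k}"
    using ij k pq by auto
  ultimately have "full p q" using jk ki ij' pq by auto
  then show ?thesis using r by (simp add: full_def)
qed

text \<open>
  By Peirce decomposition, a commutator with an off-diagonal element is a sum of brackets of two
  off-diagonal elements and of off-diagonal elements, all of which lie in \<open>U\<close>. The
  identity \<open>[b c, y] = [b, c y] + [c, y b]\<close> reduces the commutators with products of two
  off-diagonal elements to them.
\<close>

lemma comm_span_subset_U:
  assumes full: "\<And>i j r. \<lbrakk>i < 3; j < 3; i \<noteq> j; r \<in> A\<rbrakk> \<Longrightarrow> e i * r * e j \<in> U"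
  shows "comm_span A \<subseteq> U"
proof -
  have off: "(e i * r * e j) * w - w * (e i * r * e j) \<in> U"
    if ij: "i < 3" "j < 3" "i \<noteq> j" and r: "r \<in> A" and w: "w \<in> A" for i j r w
  proof -
    let ?b = "e i * r * e j"
    have "?b * (e k * w * e l) - (e k * w * e l) * ?b \<in> U" if kl: "k < 3" "l < 3" for k l
    proof (cases "k = l")
      case False
      then show ?thesis
        using ij r w kl by (intro U_bracket' off_diagonal_comm_span full) auto
    next
      case True
      consider "k = i" | "k = j" | "k \<noteq> i" "k \<noteq> j" by blast
      then show ?thesis
      proof cases
        case 1
        then have "?b * (e k * w * e l) - (e k * w * e l) * ?b = - (e i * (w * e i * r) * e j)"
          using ij True by (simp add: e_simps)
        then show ?thesis
          using ij r w by (simp only:) (intro subspace_neg U_subspace full mult_A mult_e)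
      next
        case 2
        then have "?b * (e k * w * e l) - (e k * w * e l) * ?b = e i * (r * e j * w) * e j"
          using ij True by (simp add: e_simps)
        then show ?thesis
          using ij r w by (auto intro!: full mult_A mult_e)
      next
        case 3
        then show ?thesis using ij True kl by (simp add: e_simps subspace_0 U_subspace)
      qed
    qed
    then have "(\<Sum>k<3. \<Sum>l<3. ?b * (e k * w * e l) - (e k * w * e l) * ?b) \<in> U"
      by (intro subspace_sum U_subspace) auto
    also have "(\<Sum>k<3. \<Sum>l<3. ?b * (e k * w * e l) - (e k * w * e l) * ?b)
        = ?b * (\<Sum>k<3. \<Sum>l<3. e k * w * e l) - (\<Sum>k<3. \<Sum>l<3. e k * w * e l) * ?b"
      by (simp only: sum_subtractf sum_distrib_left sum_distrib_right)
    also have "\<dots> = ?b * w - w * ?b"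
      by (simp only: peirce [of w, symmetric])
    finally show ?thesis .
  qed
  let ?S = "{x. \<forall>y\<in>A. x * y - y * x \<in> U}"
  have add: "x + x' \<in> ?S" if "x \<in> ?S" "x' \<in> ?S" for x x'
  proof -
    have "(x + x') * y - y * (x + x') = (x * y - y * x) + (x' * y - y * x')" for y
      by (simp add: algebra_simps)
    then show ?thesis using that by (simp add: subspace_add U_subspace)
  qed
  have scale: "c \<cdot> x \<in> ?S" if "x \<in> ?S" for c x
  proof -
    have "(c \<cdot> x) * y - y * (c \<cdot> x) = c \<cdot> (x * y - y * x)" for y
      by (simp add: scale_mult_left scale_mult_right scale_right_diff_distrib)
    then show ?thesis using that by (simp add: subspace_scale U_subspace)
  qed
  have S: "subspace ?S"
    by (rule subspaceI) (use add scale in \<open>auto simp: subspace_0 U_subspace\<close>)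
  have "x \<in> ?S" if x: "x \<in> A" for x
  proof (rule off_diagonal_induct [OF S _ _ x])
    fix i j :: nat and r
    assume "i < 3" "j < 3" "i \<noteq> j" "r \<in> A"
    then show "e i * r * e j \<in> ?S" using off by auto
  next
    fix i j :: nat and r s
    assume *: "i < 3" "j < 3" "i \<noteq> j" "r \<in> A" "s \<in> A"
    let ?b = "e i * r * e j" and ?c = "e j * s * e i"
    have "(?b * ?c) * y - y * (?b * ?c) \<in> U" if y: "y \<in> A" for y
    proof -
      have "(?b * ?c) * y - y * (?b * ?c)
          = (?b * (?c * y) - (?c * y) * ?b) + (?c * (y * ?b) - (y * ?b) * ?c)"
        by (simp add: mult.assoc)
      also have "\<dots> \<in> U"
        using * y by (intro subspace_add U_subspace off mult_A corner_A) auto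
      finally show ?thesis .
    qed
    then show "?b * ?c \<in> ?S" by blast
  qed
  then show ?thesis
    unfolding comm_span_def by (intro span_minimal U_subspace) auto
qed

text \<open>
  Let \<open>x, y, z\<close> lie in the corners \<open>(i, j)\<close>, \<open>(i, l)\<close>, \<open>(l, j)\<close>, where \<open>i, j, l\<close> are distinct. In
  \<open>[[[u, x], y], z]\<close> all terms vanish except, up to sign, \<open>x u y z\<close>. It lies in the \<open>(i, j)\<close>
  corner and is nonzero for a suitable choice because \<open>A\<close> is prime.
\<close>

lemma off_diagonal_entry:
  assumes u: "u \<in> U" and ij: "i < 3" "j < 3" "i \<noteq> j" and nz: "e j * u * e i \<noteq> 0"
  shows "\<exists>a. e i * a * e j \<in> U \<and> e i * a * e j \<noteq> 0"
proof -
  obtain l where l: "l < 3" "l \<noteq> i" "l \<noteq> j" using other_index by blast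
  obtain p q s where pqs: "p \<in> A" "e i * p \<noteq> 0" "q \<in> A" "q * e j \<noteq> 0" "s \<in> A" "e l * s \<noteq> 0"
    using e_acts e_acts_right ij l by meson
  note uA = U_A [OF u]
  obtain x where x: "x \<in> A" "(e i * p) * x * (e j * u * e i) \<noteq> 0"
    using prime [of "e i * p" "e j * u * e i"] pqs nz ij uA by (auto simp: mult_e)
  obtain y where y: "y \<in> A" "((e i * p) * x * (e j * u * e i)) * y * (e l * s) \<noteq> 0"
    using prime [of "(e i * p) * x * (e j * u * e i)" "e l * s"] pqs x ij l uA
    by (auto simp: mult_e mult_A)
  obtain z where z: "z \<in> A"
    "(((e i * p) * x * (e j * u * e i)) * y * (e l * s)) * z * (q * e j) \<noteq> 0"
    using prime [of "((e i * p) * x * (e j * u * e i)) * y * (e l * s)" "q * e j"] pqs x y ij l uA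
    by (auto simp: mult_e mult_A)
  let ?X = "e i * (p * x) * e j" and ?Y = "e i * y * e l" and ?Z = "e l * (s * z * q) * e j"
  let ?u1 = "u * ?X - ?X * u"
  let ?u2 = "?u1 * ?Y - ?Y * ?u1"
  have 1: "?u1 \<in> U"
    using u ij pqs x by (intro U_bracket' off_diagonal_comm_span mult_A) auto
  have 2: "?u2 \<in> U"
    by (rule U_bracket' [OF off_diagonal_comm_span 1]) (use ij l y in auto)
  have 3: "?Z * ?u2 - ?u2 * ?Z \<in> U"
    by (rule U_bracket [OF off_diagonal_comm_span 2]) (use ij l pqs z in \<open>auto intro!: mult_A\<close>)
  have "?Z * ?u2 - ?u2 * ?Z = e i * (p * x * e j * u * e i * y * e l * s * z * q) * e j"
    using ij l by (simp add: algebra_simps ee ee' e2 e2')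
  then show ?thesis
    using 3 z by (intro exI [of _ "p * x * e j * u * e i * y * e l * s * z * q"]) (simp add: mult.assoc)
qed

text \<open>
  If some element of \<open>U\<close> has a nonzero off-diagonal entry, then \<open>U\<close> contains a nonzero element of an
  off-diagonal corner, hence all off-diagonal corners, hence all commutators. Otherwise all
  elements \<open>u\<close> of \<open>U\<close> are diagonal; for an off-diagonal \<open>b\<close> the commutator \<open>[u, b]\<close> is
  both diagonal and off-diagonal, so \<open>u\<close> commutes with all off-diagonal elements, and with the
  algebra that they generate. Working with three idempotents avoids divisions by two; for two
  by two matrices in characteristic two the statement fails.
\<close>

theorem lie_ideal_central_or_full:
  "(\<forall>u\<in>U. \<forall>r\<in>A. u * r = r * u) \<or> U = comm_span A"
proof (cases "\<exists>u i j. u \<in> U \<and> i < 3 \<and> j < 3 \<and> i \<noteq> j \<and> e j * u * e i \<noteq> 0")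
  case True
  then obtain i j a where ij: "i < 3" "j < 3" "i \<noteq> j" "e i * a * e j \<in> U" "e i * a * e j \<noteq> 0"
    using off_diagonal_entry by metis
  have "comm_span A \<subseteq> U"
    by (rule comm_span_subset_U) (rule off_diagonal_in_U [OF ij])
  then show ?thesis using U_subset by auto
next
  case False
  then have diag: "e j * u * e i = 0" if "u \<in> U" "i < 3" "j < 3" "i \<noteq> j" for u i j
    using that by blast
  have off: "u * (e i * r * e j) = (e i * r * e j) * u"
    if u: "u \<in> U" and ij: "i < 3" "j < 3" "i \<noteq> j" and r: "r \<in> A" for u i j r
  proof -
    let ?b = "e i * r * e j"
    have right: "u * e k = e k * u * e k" if "k < 3" for k
    proof -
      have "u * e k = (\<Sum>i<3. e i * u * e k)"
        using complete by (simp add: numeral_3_eq_3 distrib_right [symmetric] numeral_2_eq_2)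
      also have "\<dots> = (\<Sum>i<3. if i = k then e k * u * e k else 0)"
        using diag u that by (intro sum.cong) auto
      finally show ?thesis using that by simp
    qed
    have left: "e k * u = e k * u * e k" if "k < 3" for k
    proof -
      have "e k * u = (\<Sum>i<3. e k * u * e i)"
        using complete by (simp add: numeral_3_eq_3 distrib_left [symmetric] numeral_2_eq_2)
      also have "\<dots> = (\<Sum>i<3. if i = k then e k * u * e k else 0)"
        using diag u that by (intro sum.cong) auto
      finally show ?thesis using that by simp
    qed
    have "u * ?b - ?b * u \<in> U"
      using u ij r by (intro U_bracket' off_diagonal_comm_span)
    then have "e i * (u * ?b - ?b * u) * e j = 0"
      using ij by (intro diag) auto
    moreover have "e i * (u * ?b) * e j = u * ?b"
      using right [OF ij(1)] ij by (metis (no_types, lifting) e2 mult.assoc)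
    moreover have "e i * (?b * u) * e j = ?b * u"
      using left [OF ij(2)] ij by (metis (no_types, lifting) e2 mult.assoc)
    ultimately show ?thesis by (simp add: right_diff_distrib left_diff_distrib)
  qed
  have "u * r = r * u" if u: "u \<in> U" and r: "r \<in> A" for u r
  proof -
    let ?S = "{r. u * r = r * u}"
    have S: "subspace ?S"
      by (rule subspaceI) (auto simp: distrib_left distrib_right scale_mult_left scale_mult_right)
    have prod: "b * c \<in> ?S" if "b \<in> ?S" "c \<in> ?S" for b c
    proof -
      have "u * (b * c) = (u * b) * c" by (rule mult.assoc [symmetric])
      also have "\<dots> = b * (u * c)" using that(1) by (simp add: mult.assoc)
      also have "\<dots> = (b * c) * u" using that(2) by (simp add: mult.assoc)
      finally show ?thesis by blast
    qed
    have off_S: "e i * r * e j \<in> ?S" if "i < 3" "j < 3" "i \<noteq> j" "r \<in> A" for i j r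
      using off [OF u that] by blast
    have "r \<in> ?S"
    proof (rule off_diagonal_induct [OF S _ _ r])
      show "e i * r * e j \<in> ?S" if "i < 3" "j < 3" "i \<noteq> j" "r \<in> A" for i j r
        by (rule off_S [OF that])
      show "(e i * r * e j) * (e j * s * e i) \<in> ?S"
        if "i < 3" "j < 3" "i \<noteq> j" "r \<in> A" "s \<in> A" for i j r s
        by (intro prod off_S) (use that in auto)
    qed
    then show ?thesis by simp
  qed
  then show ?thesis by blast
qed

end

text \<open>
  Off-diagonal \<open>a\<close> and \<open>b\<close> in opposite corners with \<open>a * b \<noteq> 0\<close> do not commute, since \<open>a * b\<close> and
  \<open>b * a\<close> lie in different diagonal corners.
\<close>

lemma comm_span_noncommutative: "\<exists>x\<in>comm_span A. \<exists>y\<in>comm_span A. x * y - y * x \<noteq> 0"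
proof -
  obtain x where x: "x \<in> A" "e 0 * x * e 1 \<noteq> 0" using corner_nonzero [of 0 1] by auto
  obtain y where y: "y \<in> A" "y * e 0 \<noteq> 0" using e_acts_right [of 0] by auto
  obtain c where c: "c \<in> A" "(e 0 * x * e 1) * c * (y * e 0) \<noteq> 0"
    using prime [of "e 0 * x * e 1" "y * e 0"] x y by (auto simp: mult_e)
  let ?a = "e 0 * x * e 1" and ?b = "e 1 * (c * y) * e 0"
  have "e 0 * (?a * ?b - ?b * ?a) * e 0 = ?a * c * (y * e 0)"
    by (simp add: e_simps right_diff_distrib left_diff_distrib)
  then have "?a * ?b - ?b * ?a \<noteq> 0" using c by auto
  moreover have "?a \<in> comm_span A" "?b \<in> comm_span A"
    using x y c by (auto intro!: off_diagonal_comm_span mult_A)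
  ultimately show ?thesis by blast
qed

end

section \<open>Families satisfying the Kumjian-Pask relations\<close>

context algebra_1
begin

lemma span_mult_closed:
  assumes S: "\<And>x y. \<lbrakk>x \<in> S; y \<in> S\<rbrakk> \<Longrightarrow> x * y \<in> span S" and x: "x \<in> span S" and y: "y \<in> span S"
  shows "x * y \<in> span S"
proof -
  have 1: "span S \<subseteq> {y. x * y \<in> span S}" if "x \<in> S" for x
    by (rule span_minimal)
      (use S that in \<open>auto intro!: subspaceI simp: distrib_left scale_mult_right span_add span_scale span_zero\<close>)
  have "span S \<subseteq> {x. x * y \<in> span S}"
    by (rule span_minimal)
      (use 1 y in \<open>auto intro!: subspaceI simp: distrib_right scale_mult_left span_add span_scale span_zero\<close>)
  then show ?thesis using x by auto
qed

end

text \<open>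
  \<open>P \<kappa>\<close> and \<open>Q \<kappa>\<close> are the images of a path and of its ghost path in some algebra. That no vertex
  becomes zero is part of the definition; for the universal algebra this is a theorem.
\<close>

locale kp_family = k_graph \<Lambda> + algebra_1 scale
  for \<Lambda> :: "('l, 'k::finite) kgraph"
    and scale :: "'f::field \<Rightarrow> 'a::ring_1 \<Rightarrow> 'a" (infixr "\<cdot>" 75) +
  fixes P Q :: "'l \<Rightarrow> 'a"
  assumes no_sources: "no_sources \<Lambda>"
    and P_vertex: "\<lbrakk>v \<in> Obj \<Lambda>; w \<in> Obj \<Lambda>\<rbrakk> \<Longrightarrow> P v * P w = (if v = w then P w else 0)"
    and P_mult: "\<lbrakk>\<kappa> \<in> Mor \<Lambda>; \<mu> \<in> Mor \<Lambda>; rng \<Lambda> \<mu> = src \<Lambda> \<kappa>\<rbrakk> \<Longrightarrow> P \<kappa> * P \<mu> = P (cmp \<Lambda> \<kappa> \<mu>)"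
    and Q_mult: "\<lbrakk>\<kappa> \<in> Mor \<Lambda>; \<mu> \<in> Mor \<Lambda>; rng \<Lambda> \<mu> = src \<Lambda> \<kappa>\<rbrakk> \<Longrightarrow> Q \<mu> * Q \<kappa> = Q (cmp \<Lambda> \<kappa> \<mu>)"
    and Q_P: "\<lbrakk>\<kappa> \<in> Mor \<Lambda>; \<mu> \<in> Mor \<Lambda>; deg \<Lambda> \<kappa> = deg \<Lambda> \<mu>\<rbrakk>
                \<Longrightarrow> Q \<kappa> * P \<mu> = (if \<kappa> = \<mu> then P (src \<Lambda> \<kappa>) else 0)"
    and P_Q_sum: "\<lbrakk>v \<in> Obj \<Lambda>; n \<noteq> 0\<rbrakk> \<Longrightarrow> P v = (\<Sum>\<kappa>\<in>paths_from \<Lambda> v n. P \<kappa> * Q \<kappa>)"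
    and Q_vertex: "v \<in> Obj \<Lambda> \<Longrightarrow> Q v = P v"
    and P_nonzero: "v \<in> Obj \<Lambda> \<Longrightarrow> P v \<noteq> 0"
begin

lemma P_Q_sum': "v \<in> Obj \<Lambda> \<Longrightarrow> P v = (\<Sum>\<kappa>\<in>paths_from \<Lambda> v n. P \<kappa> * Q \<kappa>)"
  by (cases "n = 0") (simp_all add: P_Q_sum paths_from_zero P_vertex Q_vertex)

lemma P_src: "\<kappa> \<in> Mor \<Lambda> \<Longrightarrow> P \<kappa> * P (src \<Lambda> \<kappa>) = P \<kappa>"
  by (simp add: P_mult cmp_id_right src_Obj rng_id Obj_Mor)

lemma P_rng: "\<kappa> \<in> Mor \<Lambda> \<Longrightarrow> P (rng \<Lambda> \<kappa>) * P \<kappa> = P \<kappa>"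
  by (simp add: P_mult cmp_id_left rng_Obj src_id Obj_Mor)

lemma Q_src: "\<kappa> \<in> Mor \<Lambda> \<Longrightarrow> P (src \<Lambda> \<kappa>) * Q \<kappa> = Q \<kappa>"
  using Q_mult [of \<kappa> "src \<Lambda> \<kappa>"] by (simp add: cmp_id_right src_Obj rng_id Obj_Mor Q_vertex)

lemma Q_rng: "\<kappa> \<in> Mor \<Lambda> \<Longrightarrow> Q \<kappa> * P (rng \<Lambda> \<kappa>) = Q \<kappa>"
  using Q_mult [of "rng \<Lambda> \<kappa>" \<kappa>] by (simp add: cmp_id_left rng_Obj src_id Obj_Mor Q_vertex)

lemma P_P_zero: "\<lbrakk>\<kappa> \<in> Mor \<Lambda>; \<mu> \<in> Mor \<Lambda>; rng \<Lambda> \<mu> \<noteq> src \<Lambda> \<kappa>\<rbrakk> \<Longrightarrow> P \<kappa> * P \<mu> = 0"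
proof -
  assume *: "\<kappa> \<in> Mor \<Lambda>" "\<mu> \<in> Mor \<Lambda>" "rng \<Lambda> \<mu> \<noteq> src \<Lambda> \<kappa>"
  have "P \<kappa> * P \<mu> = P \<kappa> * (P (src \<Lambda> \<kappa>) * P (rng \<Lambda> \<mu>)) * P \<mu>"
    using * P_src P_rng by (metis mult.assoc)
  then show ?thesis using * by (simp add: P_vertex src_Obj rng_Obj)
qed

lemma Q_Q_zero: "\<lbrakk>\<kappa> \<in> Mor \<Lambda>; \<mu> \<in> Mor \<Lambda>; rng \<Lambda> \<mu> \<noteq> src \<Lambda> \<kappa>\<rbrakk> \<Longrightarrow> Q \<mu> * Q \<kappa> = 0"
proof -
  assume *: "\<kappa> \<in> Mor \<Lambda>" "\<mu> \<in> Mor \<Lambda>" "rng \<Lambda> \<mu> \<noteq> src \<Lambda> \<kappa>"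
  have "Q \<mu> * Q \<kappa> = Q \<mu> * (P (rng \<Lambda> \<mu>) * P (src \<Lambda> \<kappa>)) * Q \<kappa>"
    using * Q_src Q_rng by (metis mult.assoc)
  then show ?thesis using * by (simp add: P_vertex src_Obj rng_Obj)
qed

text \<open>
  Inserting the fourth relation on both sides reduces the product \<open>Q \<kappa> * P \<mu>\<close> to products of
  paths of equal degree.
\<close>

lemma Q_P_expand:
  assumes \<kappa>: "\<kappa> \<in> Mor \<Lambda>" and \<mu>: "\<mu> \<in> Mor \<Lambda>"
  shows "Q \<kappa> * P \<mu> = (\<Sum>\<eta>\<in>paths_from \<Lambda> (src \<Lambda> \<kappa>) (deg \<Lambda> \<mu>). \<Sum>\<zeta>\<in>paths_from \<Lambda> (src \<Lambda> \<mu>) (deg \<Lambda> \<kappa>).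
           if cmp \<Lambda> \<kappa> \<eta> = cmp \<Lambda> \<mu> \<zeta> then P \<eta> * Q \<zeta> else 0)"
proof -
  let ?E = "paths_from \<Lambda> (src \<Lambda> \<kappa>) (deg \<Lambda> \<mu>)" and ?Z = "paths_from \<Lambda> (src \<Lambda> \<mu>) (deg \<Lambda> \<kappa>)"
  have "Q \<kappa> = (\<Sum>\<eta>\<in>?E. P \<eta> * Q \<eta>) * Q \<kappa>"
    using Q_src [OF \<kappa>] P_Q_sum' [OF src_Obj [OF \<kappa>], of "deg \<Lambda> \<mu>"] by simp
  also have "\<dots> = (\<Sum>\<eta>\<in>?E. P \<eta> * Q (cmp \<Lambda> \<kappa> \<eta>))"
    using \<kappa> by (auto simp: sum_distrib_right mult.assoc Q_mult paths_from_def intro!: sum.cong)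
  finally have 1: "Q \<kappa> = (\<Sum>\<eta>\<in>?E. P \<eta> * Q (cmp \<Lambda> \<kappa> \<eta>))" .
  have "P \<mu> = P \<mu> * (\<Sum>\<zeta>\<in>?Z. P \<zeta> * Q \<zeta>)"
    using P_src [OF \<mu>] P_Q_sum' [OF src_Obj [OF \<mu>], of "deg \<Lambda> \<kappa>"] by simp
  also have "\<dots> = (\<Sum>\<zeta>\<in>?Z. P (cmp \<Lambda> \<mu> \<zeta>) * Q \<zeta>)"
    using \<mu> by (auto simp: sum_distrib_left mult.assoc [symmetric] P_mult paths_from_def intro!: sum.cong)
  finally have 2: "P \<mu> = (\<Sum>\<zeta>\<in>?Z. P (cmp \<Lambda> \<mu> \<zeta>) * Q \<zeta>)" .
  have 3: "(P \<eta> * Q (cmp \<Lambda> \<kappa> \<eta>)) * (P (cmp \<Lambda> \<mu> \<zeta>) * Q \<zeta>)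
      = (if cmp \<Lambda> \<kappa> \<eta> = cmp \<Lambda> \<mu> \<zeta> then P \<eta> * Q \<zeta> else 0)" if \<eta>: "\<eta> \<in> ?E" and \<zeta>: "\<zeta> \<in> ?Z" for \<eta> \<zeta>
  proof -
    have M: "\<eta> \<in> Mor \<Lambda>" "\<zeta> \<in> Mor \<Lambda>" "rng \<Lambda> \<eta> = src \<Lambda> \<kappa>" "rng \<Lambda> \<zeta> = src \<Lambda> \<mu>"
      "deg \<Lambda> \<eta> = deg \<Lambda> \<mu>" "deg \<Lambda> \<zeta> = deg \<Lambda> \<kappa>"
      using \<eta> \<zeta> by (auto simp: paths_from_def)
    have deg: "deg \<Lambda> (cmp \<Lambda> \<kappa> \<eta>) = deg \<Lambda> (cmp \<Lambda> \<mu> \<zeta>)"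
      using \<kappa> \<mu> M by (simp add: deg_cmp add.commute)
    have "Q (cmp \<Lambda> \<kappa> \<eta>) * P (cmp \<Lambda> \<mu> \<zeta>) = (if cmp \<Lambda> \<kappa> \<eta> = cmp \<Lambda> \<mu> \<zeta> then P (src \<Lambda> \<eta>) else 0)"
      using Q_P [OF cmp_Mor cmp_Mor deg] src_cmp [OF \<kappa> M(1)] \<kappa> \<mu> M by metis
    moreover have "(P \<eta> * Q (cmp \<Lambda> \<kappa> \<eta>)) * (P (cmp \<Lambda> \<mu> \<zeta>) * Q \<zeta>)
        = P \<eta> * (Q (cmp \<Lambda> \<kappa> \<eta>) * P (cmp \<Lambda> \<mu> \<zeta>)) * Q \<zeta>"
      by (simp only: mult.assoc)
    ultimately show ?thesis using P_src [OF M(1)] by (cases "cmp \<Lambda> \<kappa> \<eta> = cmp \<Lambda> \<mu> \<zeta>") simp_all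
  qed
  have "Q \<kappa> * P \<mu> = (\<Sum>\<eta>\<in>?E. \<Sum>\<zeta>\<in>?Z. (P \<eta> * Q (cmp \<Lambda> \<kappa> \<eta>)) * (P (cmp \<Lambda> \<mu> \<zeta>) * Q \<zeta>))"
    by (subst 1, subst 2) (rule sum_product)
  also have "\<dots> = (\<Sum>\<eta>\<in>?E. \<Sum>\<zeta>\<in>?Z. if cmp \<Lambda> \<kappa> \<eta> = cmp \<Lambda> \<mu> \<zeta> then P \<eta> * Q \<zeta> else 0)"
    by (intro sum.cong refl 3)
  finally show ?thesis .
qed

lemma Q_P_zero:
  assumes "\<kappa> \<in> Mor \<Lambda>" "\<mu> \<in> Mor \<Lambda>"
    and "\<And>\<eta> \<zeta>. \<lbrakk>\<eta> \<in> Mor \<Lambda>; \<zeta> \<in> Mor \<Lambda>; rng \<Lambda> \<eta> = src \<Lambda> \<kappa>; rng \<Lambda> \<zeta> = src \<Lambda> \<mu>\<rbrakk> \<Longrightarrow> cmp \<Lambda> \<kappa> \<eta> \<noteq> cmp \<Lambda> \<mu> \<zeta>"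
  shows "Q \<kappa> * P \<mu> = 0"
  unfolding Q_P_expand [OF assms(1,2)] using assms(3)
  by (auto intro!: sum.neutral simp: paths_from_def)

definition kp_span :: "'a set" where
  "kp_span = span {P \<mu> * Q \<nu> | \<mu> \<nu>. \<mu> \<in> Mor \<Lambda> \<and> \<nu> \<in> Mor \<Lambda>}"

lemma P_Q_in_kp_span: "\<lbrakk>\<mu> \<in> Mor \<Lambda>; \<nu> \<in> Mor \<Lambda>\<rbrakk> \<Longrightarrow> P \<mu> * Q \<nu> \<in> kp_span"
  unfolding kp_span_def by (rule span_base) blast

lemma P_in_kp_span: "\<mu> \<in> Mor \<Lambda> \<Longrightarrow> P \<mu> \<in> kp_span"
  using P_Q_in_kp_span [of \<mu> "src \<Lambda> \<mu>"] by (simp add: P_src Q_vertex src_Obj Obj_Mor)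

lemma Q_in_kp_span: "\<mu> \<in> Mor \<Lambda> \<Longrightarrow> Q \<mu> \<in> kp_span"
  using P_Q_in_kp_span [of "src \<Lambda> \<mu>" \<mu>] by (simp add: Q_src src_Obj Obj_Mor)

lemma kp_span_mult:
  assumes "x \<in> kp_span" "y \<in> kp_span"
  shows "x * y \<in> kp_span"
  using assms unfolding kp_span_def
proof (rule span_mult_closed [rotated])
  fix x y
  assume "x \<in> {P \<mu> * Q \<nu> | \<mu> \<nu>. \<mu> \<in> Mor \<Lambda> \<and> \<nu> \<in> Mor \<Lambda>}" "y \<in> {P \<mu> * Q \<nu> | \<mu> \<nu>. \<mu> \<in> Mor \<Lambda> \<and> \<nu> \<in> Mor \<Lambda>}"
  then obtain \<mu> \<nu> \<kappa> \<xi> where xy: "x = P \<mu> * Q \<nu>" "y = P \<kappa> * Q \<xi>"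
    and M: "\<mu> \<in> Mor \<Lambda>" "\<nu> \<in> Mor \<Lambda>" "\<kappa> \<in> Mor \<Lambda>" "\<xi> \<in> Mor \<Lambda>" by blast
  have term_in: "P \<mu> * (P \<eta> * Q \<zeta>) * Q \<xi> \<in> kp_span" if "\<eta> \<in> Mor \<Lambda>" "\<zeta> \<in> Mor \<Lambda>" for \<eta> \<zeta>
  proof -
    have eq: "P \<mu> * (P \<eta> * Q \<zeta>) * Q \<xi> = (P \<mu> * P \<eta>) * (Q \<zeta> * Q \<xi>)"
      by (simp add: mult.assoc)
    show ?thesis
    proof (cases "rng \<Lambda> \<eta> = src \<Lambda> \<mu> \<and> rng \<Lambda> \<zeta> = src \<Lambda> \<xi>")
      case True
      then show ?thesis
        unfolding eq using M that by (simp add: P_mult Q_mult P_Q_in_kp_span cmp_Mor)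
    next
      case False
      then have "P \<mu> * P \<eta> = 0 \<or> Q \<zeta> * Q \<xi> = 0"
        using M that P_P_zero Q_Q_zero by blast
      then show ?thesis unfolding eq by (auto simp: kp_span_def span_zero)
    qed
  qed
  have "x * y = P \<mu> * (Q \<nu> * P \<kappa>) * Q \<xi>"
    by (simp add: xy mult.assoc)
  also have "\<dots> = (\<Sum>\<eta>\<in>paths_from \<Lambda> (src \<Lambda> \<nu>) (deg \<Lambda> \<kappa>). \<Sum>\<zeta>\<in>paths_from \<Lambda> (src \<Lambda> \<kappa>) (deg \<Lambda> \<nu>).
      P \<mu> * (if cmp \<Lambda> \<nu> \<eta> = cmp \<Lambda> \<kappa> \<zeta> then P \<eta> * Q \<zeta> else 0) * Q \<xi>)"
    using M by (simp only: Q_P_expand sum_distrib_left sum_distrib_right)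
  also have "\<dots> \<in> kp_span"
    unfolding kp_span_def
    by (intro span_sum) (use term_in in \<open>auto simp: paths_from_def span_zero kp_span_def\<close>)
  finally show "x * y \<in> span {P \<mu> * Q \<nu> | \<mu> \<nu>. \<mu> \<in> Mor \<Lambda> \<and> \<nu> \<in> Mor \<Lambda>}"
    by (simp add: kp_span_def)
qed

sublocale subalgebra scale kp_span
  by unfold_locales (simp_all add: kp_span_mult, simp add: kp_span_def)

lemma kp_span_induct [consumes 1, case_names gen zero add scale]:
  assumes "a \<in> kp_span"
    and "\<And>\<mu> \<nu>. \<lbrakk>\<mu> \<in> Mor \<Lambda>; \<nu> \<in> Mor \<Lambda>\<rbrakk> \<Longrightarrow> R (P \<mu> * Q \<nu>)" and "R 0"
    and "\<And>x y. \<lbrakk>R x; R y\<rbrakk> \<Longrightarrow> R (x + y)" and "\<And>c x. R x \<Longrightarrow> R (c \<cdot> x)"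
  shows "R a"
proof -
  have "span {P \<mu> * Q \<nu> | \<mu> \<nu>. \<mu> \<in> Mor \<Lambda> \<and> \<nu> \<in> Mor \<Lambda>} \<subseteq> {a. R a}"
    by (rule span_minimal) (use assms(2-5) in \<open>auto intro: subspaceI\<close>)
  then show ?thesis using assms(1) by (auto simp: kp_span_def)
qed

lemma sum_vertices_mult_P:
  assumes "finite G" "G \<subseteq> Obj \<Lambda>" "\<mu> \<in> Mor \<Lambda>" "rng \<Lambda> \<mu> \<in> G"
  shows "(\<Sum>v\<in>G. P v) * P \<mu> = P \<mu>"
proof -
  have "(\<Sum>v\<in>G. P v) * P \<mu> = (\<Sum>v\<in>G. if v = rng \<Lambda> \<mu> then P \<mu> else 0)"
    unfolding sum_distrib_right
    by (rule sum.cong) (use assms in \<open>auto simp: P_rng src_id Obj_Mor intro!: P_P_zero\<close>)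
  then show ?thesis using assms by simp
qed

lemma Q_mult_sum_vertices:
  assumes "finite G" "G \<subseteq> Obj \<Lambda>" "\<nu> \<in> Mor \<Lambda>" "rng \<Lambda> \<nu> \<in> G"
  shows "Q \<nu> * (\<Sum>v\<in>G. P v) = Q \<nu>"
proof -
  have "Q \<nu> * P v = 0" if "v \<in> G" "v \<noteq> rng \<Lambda> \<nu>" for v
    using Q_Q_zero [of v \<nu>] that assms by (auto simp: Q_vertex src_id Obj_Mor)
  then have "Q \<nu> * (\<Sum>v\<in>G. P v) = (\<Sum>v\<in>G. if v = rng \<Lambda> \<nu> then Q \<nu> else 0)"
    unfolding sum_distrib_left by (intro sum.cong) (use assms in \<open>auto simp: Q_rng\<close>)
  then show ?thesis using assms by simp
qed

text \<open>
  Finite sums of vertices serve as a substitute for the identity, and they are the identity if there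
  are only finitely many vertices.
\<close>

lemma local_unit:
  assumes "a \<in> kp_span"
  shows "\<exists>F. finite F \<and> F \<subseteq> Obj \<Lambda> \<and> (\<forall>G. finite G \<longrightarrow> F \<subseteq> G \<longrightarrow> G \<subseteq> Obj \<Lambda> \<longrightarrow>
           (\<Sum>v\<in>G. P v) * a = a \<and> a * (\<Sum>v\<in>G. P v) = a)"
  using assms
proof (induction rule: kp_span_induct)
  case (gen \<mu> \<nu>)
  have "(\<Sum>v\<in>G. P v) * (P \<mu> * Q \<nu>) = P \<mu> * Q \<nu>" "P \<mu> * Q \<nu> * (\<Sum>v\<in>G. P v) = P \<mu> * Q \<nu>"
    if "finite G" "{rng \<Lambda> \<mu>, rng \<Lambda> \<nu>} \<subseteq> G" "G \<subseteq> Obj \<Lambda>" for G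
    using that gen sum_vertices_mult_P [of G \<mu>] Q_mult_sum_vertices [of G \<nu>]
    by (simp_all add: mult.assoc [symmetric], simp add: mult.assoc)
  then show ?case
    using gen by (intro exI [of _ "{rng \<Lambda> \<mu>, rng \<Lambda> \<nu>}"]) (auto simp: rng_Obj)
next
  case zero
  then show ?case by (intro exI [of _ "{}"]) auto
next
  case (add x y)
  then obtain F F' where "finite F" "F \<subseteq> Obj \<Lambda>" "finite F'" "F' \<subseteq> Obj \<Lambda>"
    and "\<And>G. \<lbrakk>finite G; F \<subseteq> G; G \<subseteq> Obj \<Lambda>\<rbrakk> \<Longrightarrow> (\<Sum>v\<in>G. P v) * x = x \<and> x * (\<Sum>v\<in>G. P v) = x"
    and "\<And>G. \<lbrakk>finite G; F' \<subseteq> G; G \<subseteq> Obj \<Lambda>\<rbrakk> \<Longrightarrow> (\<Sum>v\<in>G. P v) * y = y \<and> y * (\<Sum>v\<in>G. P v) = y"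
    by metis
  then show ?case
    by (intro exI [of _ "F \<union> F'"]) (auto simp: distrib_left distrib_right)
next
  case (scale c x)
  then obtain F where "finite F" "F \<subseteq> Obj \<Lambda>"
    and "\<And>G. \<lbrakk>finite G; F \<subseteq> G; G \<subseteq> Obj \<Lambda>\<rbrakk> \<Longrightarrow> (\<Sum>v\<in>G. P v) * x = x \<and> x * (\<Sum>v\<in>G. P v) = x"
    by metis
  then show ?case by (intro exI [of _ F]) (auto simp: scale_mult_left scale_mult_right)
qed

lemma one_in_kp_span: "(\<Sum>v\<in>Obj \<Lambda>. P v) \<in> kp_span"
  by (intro subspace_sum subspace_A P_in_kp_span Obj_Mor)

text \<open>
  By the fourth relation an element that annihilates all paths of one degree annihilates all
  vertices, and therefore its own local unit.
\<close>

lemma mult_P_nonzero: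
  assumes a: "a \<in> kp_span" "a \<noteq> 0"
  shows "\<exists>\<kappa>\<in>Mor \<Lambda>. deg \<Lambda> \<kappa> = n \<and> a * P \<kappa> \<noteq> 0"
proof (rule ccontr)
  assume "\<not> ?thesis"
  then have 0: "a * P \<kappa> = 0" if "\<kappa> \<in> Mor \<Lambda>" "deg \<Lambda> \<kappa> = n" for \<kappa>
    using that by blast
  have "a * P v = 0" if v: "v \<in> Obj \<Lambda>" for v
    unfolding P_Q_sum' [OF v, of n] sum_distrib_left
    by (rule sum.neutral) (auto simp: paths_from_def 0 mult.assoc [symmetric])
  moreover obtain F where "F \<subseteq> Obj \<Lambda>" "a = (\<Sum>v\<in>F. a * P v)"
    using local_unit [OF a(1)] by (metis order.refl sum_distrib_left)
  ultimately have "a = 0"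
    by (metis (no_types, lifting) subsetD sum.neutral)
  then show False using a(2) by simp
qed

text \<open>
  A path that is longer than all ghost paths occurring in \<open>a\<close> cancels them from the right.
\<close>

lemma mult_P_in_span_P:
  assumes "a \<in> kp_span"
  shows "\<exists>N. \<forall>\<kappa>\<in>Mor \<Lambda>. N \<le> deg \<Lambda> \<kappa> \<longrightarrow> a * P \<kappa> \<in> span (P ` Mor \<Lambda>)"
  using assms
proof (induction rule: kp_span_induct)
  case (gen \<mu> \<nu>)
  have "P \<mu> * Q \<nu> * P \<kappa> \<in> span (P ` Mor \<Lambda>)" if \<kappa>: "\<kappa> \<in> Mor \<Lambda>" "deg \<Lambda> \<nu> \<le> deg \<Lambda> \<kappa>" for \<kappa>
  proof -
    let ?i = "initial_part \<Lambda> \<kappa> (deg \<Lambda> \<nu>)" and ?f = "final_part \<Lambda> \<kappa> (deg \<Lambda> \<nu>)"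
    have M: "?i \<in> Mor \<Lambda>" "?f \<in> Mor \<Lambda>" "deg \<Lambda> ?i = deg \<Lambda> \<nu>" "src \<Lambda> ?i = rng \<Lambda> ?f"
      using \<kappa> by (auto simp: initial_part_Mor final_part_Mor deg_initial_part src_initial_part)
    have "P \<kappa> = P ?i * P ?f"
      using M \<kappa> by (simp add: P_mult cmp_initial_final)
    then have "P \<mu> * Q \<nu> * P \<kappa> = P \<mu> * (Q \<nu> * P ?i) * P ?f"
      by (simp add: mult.assoc)
    also have "\<dots> = (if \<nu> = ?i then P \<mu> * P ?f else 0)"
      using M gen P_rng [of ?f] by (auto simp: Q_P mult.assoc)
    also have "\<dots> \<in> span (P ` Mor \<Lambda>)"
      using M gen P_P_zero [of \<mu> ?f] P_mult [of \<mu> ?f]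
      by (cases "rng \<Lambda> ?f = src \<Lambda> \<mu>") (auto simp: span_zero cmp_Mor intro!: span_base)
    finally show ?thesis .
  qed
  then show ?case by blast
next
  case zero
  then show ?case by (auto simp: span_zero)
next
  case (add x y)
  then obtain N N' where N: "\<And>\<kappa>. \<lbrakk>\<kappa> \<in> Mor \<Lambda>; N \<le> deg \<Lambda> \<kappa>\<rbrakk> \<Longrightarrow> x * P \<kappa> \<in> span (P ` Mor \<Lambda>)"
    "\<And>\<kappa>. \<lbrakk>\<kappa> \<in> Mor \<Lambda>; N' \<le> deg \<Lambda> \<kappa>\<rbrakk> \<Longrightarrow> y * P \<kappa> \<in> span (P ` Mor \<Lambda>)"
    by blast
  have "(x + y) * P \<kappa> \<in> span (P ` Mor \<Lambda>)" if "\<kappa> \<in> Mor \<Lambda>" "N + N' \<le> deg \<Lambda> \<kappa>" for \<kappa>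
    unfolding distrib_right
    using that order.trans [OF vec_nat_le_add(1) that(2)] order.trans [OF vec_nat_le_add(2) that(2)]
    by (intro span_add N)
  then show ?case by blast
next
  case (scale c x)
  then obtain N where "\<And>\<kappa>. \<lbrakk>\<kappa> \<in> Mor \<Lambda>; N \<le> deg \<Lambda> \<kappa>\<rbrakk> \<Longrightarrow> x * P \<kappa> \<in> span (P ` Mor \<Lambda>)"
    by blast
  then show ?case by (intro exI [of _ N]) (auto simp: scale_mult_left span_scale)
qed

lemma span_P_explicit:
  assumes "b \<in> span (P ` Mor \<Lambda>)"
  obtains F c where "finite F" "F \<subseteq> Mor \<Lambda>" "b = (\<Sum>\<mu>\<in>F. c \<mu> \<cdot> P \<mu>)"
proof -
  obtain t r where t: "finite t" "t \<subseteq> P ` Mor \<Lambda>" "b = (\<Sum>a\<in>t. r a \<cdot> a)"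
    using assms unfolding span_explicit by blast
  obtain F where F: "F \<subseteq> Mor \<Lambda>" "inj_on P F" "t = P ` F"
    using t(2) unfolding subset_image_inj by blast
  show thesis
    using that [of F "\<lambda>\<mu>. r (P \<mu>)"] t F by (simp add: sum.reindex finite_image_iff)
qed

text \<open>
  This is the analogue of the Cuntz-Krieger uniqueness argument. Multiplying \<open>a\<close> by a long path
  turns it into a nonzero combination of paths. Prolonging these along an aperiodic infinite path
  makes one of them orthogonal to the others, so that compression by it extracts a single
  coefficient.
\<close>

lemma compress_to_vertex:
  assumes aperiodic: "aperiodic_graph \<Lambda>" and a: "a \<in> kp_span" "a \<noteq> 0"
  obtains \<alpha> \<nu> c where "\<alpha> \<in> Mor \<Lambda>" "\<nu> \<in> Mor \<Lambda>" "c \<noteq> 0" "Q \<alpha> * a * P \<nu> = c \<cdot> P (src \<Lambda> \<nu>)"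
    "\<alpha> = \<nu> \<or> Q \<alpha> * P \<nu> = 0"
proof -
  obtain N where N: "\<And>\<kappa>. \<lbrakk>\<kappa> \<in> Mor \<Lambda>; N \<le> deg \<Lambda> \<kappa>\<rbrakk> \<Longrightarrow> a * P \<kappa> \<in> span (P ` Mor \<Lambda>)"
    using mult_P_in_span_P [OF a(1)] by blast
  obtain \<nu> where \<nu>: "\<nu> \<in> Mor \<Lambda>" "deg \<Lambda> \<nu> = N" "a * P \<nu> \<noteq> 0"
    using mult_P_nonzero [OF a] by blast
  let ?v = "src \<Lambda> \<nu>"
  obtain F' c where F': "finite F'" "F' \<subseteq> Mor \<Lambda>" "a * P \<nu> = (\<Sum>\<mu>\<in>F'. c \<mu> \<cdot> P \<mu>)"
    using span_P_explicit [OF N [OF \<nu>(1)]] \<nu>(2) by auto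
  define F where "F = {\<mu> \<in> F'. src \<Lambda> \<mu> = ?v \<and> c \<mu> \<noteq> 0}"
  have F: "finite F" "F \<subseteq> Mor \<Lambda>" "\<And>\<mu>. \<mu> \<in> F \<Longrightarrow> src \<Lambda> \<mu> = ?v" "\<And>\<mu>. \<mu> \<in> F \<Longrightarrow> c \<mu> \<noteq> 0"
    using F' by (auto simp: F_def)
  have "a * P \<nu> = (a * P \<nu>) * P ?v"
    using \<nu>(1) by (simp add: P_src mult.assoc)
  also have "\<dots> = (\<Sum>\<mu>\<in>F'. c \<mu> \<cdot> (P \<mu> * P ?v))"
    by (simp add: F'(3) sum_distrib_right scale_mult_left)
  also have "\<dots> = (\<Sum>\<mu>\<in>F. c \<mu> \<cdot> (P \<mu> * P ?v))"
  proof (rule sum.mono_neutral_right [OF F'(1)])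
    show "F \<subseteq> F'" by (auto simp: F_def)
    show "\<forall>\<mu>\<in>F' - F. c \<mu> \<cdot> (P \<mu> * P ?v) = 0"
      using F'(2) \<nu>(1) by (auto simp: F_def src_Obj rng_id Obj_Mor intro!: P_P_zero)
  qed
  also have "\<dots> = (\<Sum>\<mu>\<in>F. c \<mu> \<cdot> P \<mu>)"
    using F(2,3) by (intro sum.cong refl) (metis P_src subsetD)
  finally have aP: "a * P \<nu> = (\<Sum>\<mu>\<in>F. c \<mu> \<cdot> P \<mu>)" .
  then obtain \<alpha> where \<alpha>: "\<alpha> \<in> F" using \<nu>(3) by fastforce
  have \<alpha>M: "\<alpha> \<in> Mor \<Lambda>" "src \<Lambda> \<alpha> = ?v" using \<alpha> F by auto
  obtain x where "x \<in> cylinder \<Lambda> ?v" and ap: "\<And>m n. m \<noteq> n \<Longrightarrow> shift m x \<noteq> shift n x"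
    using aperiodic src_Obj [OF \<nu>(1)] unfolding aperiodic_graph_def by blast
  then have x: "x \<in> infinite_paths \<Lambda>" and x0: "x (0, 0) = ?v"
    using \<nu>(1) by (auto simp: cylinder_def deg_id src_Obj)
  note facts = infinite_path_Mor [OF x] src_infinite_path [OF x] rng_infinite_path [OF x]
  have "\<exists>M. \<forall>n\<ge>M. Q (cmp \<Lambda> \<alpha> (x (0, n))) * P (cmp \<Lambda> \<mu> (x (0, n))) = 0"
    if \<mu>: "\<mu> \<in> Mor \<Lambda>" "src \<Lambda> \<mu> = ?v" "\<alpha> \<noteq> \<mu>" for \<mu>
  proof -
    obtain M where M: "\<forall>n\<ge>M. \<forall>\<eta>\<in>Mor \<Lambda>. \<forall>\<zeta>\<in>Mor \<Lambda>. rng \<Lambda> \<eta> = x (n, n) \<longrightarrow> rng \<Lambda> \<zeta> = x (n, n) \<longrightarrow>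
        cmp \<Lambda> (cmp \<Lambda> \<alpha> (x (0, n))) \<eta> \<noteq> cmp \<Lambda> (cmp \<Lambda> \<mu> (x (0, n))) \<zeta>"
      using no_common_extension [OF x ap \<alpha>M(1) _ \<mu>(1) _ \<mu>(3)] \<alpha>M \<mu> x0 by auto
    show ?thesis
    proof (intro exI allI impI)
      fix n assume "M \<le> n"
      then show "Q (cmp \<Lambda> \<alpha> (x (0, n))) * P (cmp \<Lambda> \<mu> (x (0, n))) = 0"
        using M \<alpha>M \<mu> x0 by (intro Q_P_zero) (auto simp: facts cmp_Mor src_cmp)
    qed
  qed
  then obtain M where M: "\<And>\<mu> n. \<lbrakk>\<mu> \<in> Mor \<Lambda>; src \<Lambda> \<mu> = ?v; \<alpha> \<noteq> \<mu>; M \<mu> \<le> n\<rbrakk> \<Longrightarrow>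
      Q (cmp \<Lambda> \<alpha> (x (0, n))) * P (cmp \<Lambda> \<mu> (x (0, n))) = 0"
    by metis
  define n where "n = (\<Sum>\<mu>\<in>insert \<nu> F. M \<mu>)"
  have n: "M \<mu> \<le> n" if "\<mu> \<in> insert \<nu> F" for \<mu>
  proof -
    have "n = M \<mu> + (\<Sum>\<mu>\<in>insert \<nu> F - {\<mu>}. M \<mu>)"
      unfolding n_def using F(1) that by (intro sum.remove) auto
    then show ?thesis by simp
  qed
  let ?\<tau> = "x (0, n)"
  have \<tau>: "?\<tau> \<in> Mor \<Lambda>" "rng \<Lambda> ?\<tau> = ?v"
    using x0 by (auto simp: facts)
  have zero: "Q (cmp \<Lambda> \<alpha> ?\<tau>) * P (cmp \<Lambda> \<mu> ?\<tau>) = 0" if "\<mu> \<in> insert \<nu> F" "\<mu> \<noteq> \<alpha>" for \<mu>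
    using M [of \<mu> n] n [OF that(1)] that F \<nu>(1) by auto
  have "Q (cmp \<Lambda> \<alpha> ?\<tau>) * a * P (cmp \<Lambda> \<nu> ?\<tau>) = Q (cmp \<Lambda> \<alpha> ?\<tau>) * (a * P \<nu>) * P ?\<tau>"
    using \<nu>(1) \<tau> by (simp add: P_mult [symmetric] mult.assoc)
  also have "\<dots> = (\<Sum>\<mu>\<in>F. c \<mu> \<cdot> (Q (cmp \<Lambda> \<alpha> ?\<tau>) * P (cmp \<Lambda> \<mu> ?\<tau>)))"
    unfolding aP sum_distrib_left sum_distrib_right
    by (rule sum.cong) (use F \<tau> in \<open>auto simp: scale_mult_left scale_mult_right P_mult [symmetric] mult.assoc\<close>)
  also have "\<dots> = (\<Sum>\<mu>\<in>F. if \<mu> = \<alpha> then c \<alpha> \<cdot> P (src \<Lambda> ?\<tau>) else 0)"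
    using zero \<alpha>M \<tau> by (intro sum.cong) (auto simp: Q_P cmp_Mor src_cmp)
  also have "\<dots> = c \<alpha> \<cdot> P (src \<Lambda> (cmp \<Lambda> \<nu> ?\<tau>))"
    using \<alpha> F(1) \<nu>(1) \<tau> by (simp add: src_cmp)
  finally have "Q (cmp \<Lambda> \<alpha> ?\<tau>) * a * P (cmp \<Lambda> \<nu> ?\<tau>) = c \<alpha> \<cdot> P (src \<Lambda> (cmp \<Lambda> \<nu> ?\<tau>))" .
  moreover have "cmp \<Lambda> \<alpha> ?\<tau> = cmp \<Lambda> \<nu> ?\<tau> \<or> Q (cmp \<Lambda> \<alpha> ?\<tau>) * P (cmp \<Lambda> \<nu> ?\<tau>) = 0"
    using zero by auto
  ultimately show thesis
    using that [of "cmp \<Lambda> \<alpha> ?\<tau>" "cmp \<Lambda> \<nu> ?\<tau>" "c \<alpha>"] \<alpha>M \<nu>(1) \<tau> F(4) [OF \<alpha>] by (simp add: cmp_Mor)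
qed


text \<open>
  The ideal generated by \<open>a\<close> contains a vertex by compression. Its set of vertices is hereditary
  because of \<open>\<kappa>\<^sup>* r(\<kappa>) \<kappa> = s(\<kappa>)\<close>, and saturated because of \<open>v = (\<Sum>\<kappa>. \<kappa> s(\<kappa>) \<kappa>\<^sup>*)\<close>.
\<close>

lemma ideal_contains_kp_span:
  assumes aperiodic: "aperiodic_graph \<Lambda>" and cofinal: "cofinal_graph \<Lambda>"
    and a: "a \<in> kp_span" "a \<noteq> 0"
  shows "kp_span \<subseteq> span {x * a * y | x y. x \<in> kp_span \<and> y \<in> kp_span}" (is "_ \<subseteq> ?J")
proof -
  have left: "b * z \<in> ?J" and right: "z * b \<in> ?J" if z: "z \<in> ?J" and b: "b \<in> kp_span" for b z
  proof -
    have "?J \<subseteq> {z. b * z \<in> ?J}"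
    proof (rule span_minimal)
      show "{x * a * y | x y. x \<in> kp_span \<and> y \<in> kp_span} \<subseteq> {z. b * z \<in> ?J}"
      proof clarify
        fix x y assume "x \<in> kp_span" "y \<in> kp_span"
        then have "(b * x) * a * y \<in> ?J" using b by (intro span_base) (auto intro: kp_span_mult)
        then show "b * (x * a * y) \<in> ?J" by (simp add: mult.assoc)
      qed
      show "subspace {z. b * z \<in> ?J}"
        by (auto intro!: subspaceI simp: distrib_left scale_mult_right span_add span_scale span_zero)
    qed
    then show "b * z \<in> ?J" using z by auto
    have "?J \<subseteq> {z. z * b \<in> ?J}"
    proof (rule span_minimal)
      show "{x * a * y | x y. x \<in> kp_span \<and> y \<in> kp_span} \<subseteq> {z. z * b \<in> ?J}"
      proof clarify
        fix x y assume "x \<in> kp_span" "y \<in> kp_span"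
        then have "x * a * (y * b) \<in> ?J" using b by (intro span_base) (auto intro: kp_span_mult)
        then show "x * a * y * b \<in> ?J" by (simp add: mult.assoc)
      qed
      show "subspace {z. z * b \<in> ?J}"
        by (auto intro!: subspaceI simp: distrib_right scale_mult_left span_add span_scale span_zero)
    qed
    then show "z * b \<in> ?J" using z by auto
  qed
  let ?H = "{v \<in> Obj \<Lambda>. P v \<in> ?J}"
  obtain \<alpha> \<nu> c where \<alpha>\<nu>: "\<alpha> \<in> Mor \<Lambda>" "\<nu> \<in> Mor \<Lambda>" "c \<noteq> 0" "Q \<alpha> * a * P \<nu> = c \<cdot> P (src \<Lambda> \<nu>)"
    using compress_to_vertex [OF aperiodic a] by metis
  have "Q \<alpha> * a * P \<nu> \<in> ?J"
    using Q_in_kp_span [OF \<alpha>\<nu>(1)] P_in_kp_span [OF \<alpha>\<nu>(2)] by (intro span_base) blast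
  then have "(1 / c) \<cdot> (Q \<alpha> * a * P \<nu>) \<in> ?J" by (rule span_scale)
  then have w: "src \<Lambda> \<nu> \<in> ?H" using \<alpha>\<nu> by (simp add: src_Obj)
  have H: "?H = Obj \<Lambda>"
  proof (rule hereditary_saturated_eq_Obj [OF cofinal _ w])
    fix \<kappa> assume \<kappa>: "\<kappa> \<in> Mor \<Lambda>" "rng \<Lambda> \<kappa> \<in> ?H"
    then have "Q \<kappa> * P (rng \<Lambda> \<kappa>) * P \<kappa> \<in> ?J"
      by (intro left right) (auto intro: Q_in_kp_span P_in_kp_span)
    then show "src \<Lambda> \<kappa> \<in> ?H" using \<kappa> by (simp add: Q_rng Q_P src_Obj)
  next
    fix v n assume v: "v \<in> Obj \<Lambda>" and sat: "\<And>\<kappa>. \<kappa> \<in> paths_from \<Lambda> v n \<Longrightarrow> src \<Lambda> \<kappa> \<in> ?H"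
    have "P \<kappa> * Q \<kappa> \<in> ?J" if \<kappa>: "\<kappa> \<in> paths_from \<Lambda> v n" for \<kappa>
    proof -
      have M: "\<kappa> \<in> Mor \<Lambda>" using \<kappa> by (simp add: paths_from_def)
      have "P \<kappa> * P (src \<Lambda> \<kappa>) * Q \<kappa> \<in> ?J"
        using M sat [OF \<kappa>] by (intro left right) (auto intro: Q_in_kp_span P_in_kp_span)
      then show ?thesis using M by (simp add: P_src)
    qed
    then have "P v \<in> ?J" unfolding P_Q_sum' [OF v, of n] by (rule span_sum)
    then show "v \<in> ?H" using v by simp
  qed auto
  have "P \<mu> * Q \<nu> \<in> ?J" if M: "\<mu> \<in> Mor \<Lambda>" "\<nu> \<in> Mor \<Lambda>" for \<mu> \<nu>
  proof -
    have "src \<Lambda> \<mu> \<in> ?H" unfolding H by (rule src_Obj [OF M(1)])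
    then have "P \<mu> * P (src \<Lambda> \<mu>) * Q \<nu> \<in> ?J"
      using M by (intro left right) (auto intro: Q_in_kp_span P_in_kp_span)
    then show ?thesis using M by (simp add: P_src)
  qed
  then show ?thesis
    unfolding kp_span_def by (intro span_minimal) auto
qed

context
  assumes aperiodic: "aperiodic_graph \<Lambda>" and cofinal: "cofinal_graph \<Lambda>"
begin

interpretation simple_subalgebra scale kp_span
  by unfold_locales (rule ideal_contains_kp_span [OF aperiodic cofinal])

text \<open>
  The first two idempotents are \<open>\<kappa> \<kappa>\<^sup>*\<close> and \<open>\<mu> \<mu>\<^sup>*\<close> for distinct paths of equal degree; a third path of
  that degree shows that their sum does not act as an identity.
\<close>

lemma idempotent_triple:
  assumes ne: "Obj \<Lambda> \<noteq> {}"
  shows "\<exists>e. idempotent_triple scale kp_span e"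
proof -
  obtain \<kappa> \<mu> \<nu> where M: "{\<kappa>, \<mu>, \<nu>} \<subseteq> Mor \<Lambda>" and dist: "\<kappa> \<noteq> \<mu>" "\<kappa> \<noteq> \<nu>" "\<mu> \<noteq> \<nu>"
    and deg: "deg \<Lambda> \<kappa> = deg \<Lambda> \<mu>" "deg \<Lambda> \<mu> = deg \<Lambda> \<nu>"
    using three_paths [OF no_sources aperiodic ne] by blast
  define p where "p \<alpha> = P \<alpha> * Q \<alpha>" for \<alpha>
  have p_mult: "p \<alpha> * p \<beta> = (if \<alpha> = \<beta> then p \<alpha> else 0)" if "\<alpha> \<in> {\<kappa>, \<mu>, \<nu>}" "\<beta> \<in> {\<kappa>, \<mu>, \<nu>}" for \<alpha> \<beta>
  proof -
    have \<alpha>\<beta>: "\<alpha> \<in> Mor \<Lambda>" "\<beta> \<in> Mor \<Lambda>" "deg \<Lambda> \<alpha> = deg \<Lambda> \<beta>" using that M deg by auto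
    have "p \<alpha> * p \<beta> = P \<alpha> * (Q \<alpha> * P \<beta>) * Q \<beta>" by (simp add: p_def mult.assoc)
    then show ?thesis using \<alpha>\<beta> by (simp add: Q_P P_src p_def)
  qed
  have pA: "p \<alpha> \<in> kp_span" if "\<alpha> \<in> {\<kappa>, \<mu>, \<nu>}" for \<alpha>
    using that M by (auto simp: p_def intro: P_Q_in_kp_span)
  have p_nz: "p \<alpha> \<noteq> 0" if "\<alpha> \<in> {\<kappa>, \<mu>, \<nu>}" for \<alpha>
  proof
    assume 0: "p \<alpha> = 0"
    have \<alpha>: "\<alpha> \<in> Mor \<Lambda>" using that M by auto
    have "Q \<alpha> * p \<alpha> * P \<alpha> = (Q \<alpha> * P \<alpha>) * (Q \<alpha> * P \<alpha>)" by (simp add: p_def mult.assoc)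
    also have "\<dots> = P (src \<Lambda> \<alpha>)" using \<alpha> by (simp add: Q_P P_vertex src_Obj)
    finally show False using 0 \<alpha> P_nonzero src_Obj by simp
  qed
  define e where "e i = (if i = 0 then p \<kappa> else if i = 1 then p \<mu> else 1 - p \<kappa> - p \<mu>)" for i :: nat
  have "idempotent_triple scale kp_span e"
  proof unfold_locales
    have i3: "i = 0 \<or> i = 1 \<or> i = 2" if "i < 3" for i :: nat using that by auto
    show "e i * e j = (if i = j then e i else 0)" if "i < 3" "j < 3" for i j
      using i3 [OF that(1)] i3 [OF that(2)] dist
      by (auto simp: e_def p_mult left_diff_distrib right_diff_distrib)
    show "e 0 + e 1 + e 2 = 1" by (simp add: e_def)
    show "e i * x \<in> kp_span" "x * e i \<in> kp_span" if "i < 3" "x \<in> kp_span" for i x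
      using that pA by (auto simp: e_def left_diff_distrib right_diff_distrib intro!: diff_A mult_A)
    show "e i \<in> kp_span" if "i < 2" for i
      using that pA by (auto simp: e_def)
    show "\<exists>x\<in>kp_span. e i * x \<noteq> 0" if i: "i < 3" for i
    proof -
      consider "i = 0" | "i = 1" | "i = 2" using i3 [OF i] by blast
      then show ?thesis
      proof cases
        case 1 then show ?thesis
          using p_mult [of \<kappa> \<kappa>] p_nz [of \<kappa>] pA [of \<kappa>] by (intro bexI [of _ "p \<kappa>"]) (auto simp: e_def)
      next
        case 2 then show ?thesis
          using p_mult [of \<mu> \<mu>] p_nz [of \<mu>] pA [of \<mu>] by (intro bexI [of _ "p \<mu>"]) (auto simp: e_def)
      next
        case 3 then show ?thesis
          using p_mult [of \<kappa> \<nu>] p_mult [of \<mu> \<nu>] p_nz [of \<nu>] pA [of \<nu>] dist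
          by (intro bexI [of _ "p \<nu>"]) (auto simp: e_def left_diff_distrib)
      qed
    qed
  qed
  then show ?thesis by blast
qed

lemma kp_lie_ideal:
  assumes "Obj \<Lambda> \<noteq> {}" and U: "lie_ideal_in (comm_span kp_span) U"
  shows "(\<forall>u\<in>U. \<forall>r\<in>kp_span. u * r = r * u) \<or> U = comm_span kp_span"
proof -
  obtain e where "idempotent_triple scale kp_span e"
    using idempotent_triple [OF assms(1)] by blast
  then interpret idempotent_triple scale kp_span e .
  show ?thesis using U by (rule lie_ideal_central_or_full)
qed

lemma kp_comm_span_noncommutative:
  assumes "Obj \<Lambda> \<noteq> {}"
  shows "\<exists>x\<in>comm_span kp_span. \<exists>y\<in>comm_span kp_span. x * y - y * x \<noteq> 0"
proof -
  obtain e where "idempotent_triple scale kp_span e"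
    using idempotent_triple [OF assms(1)] by blast
  then interpret idempotent_triple scale kp_span e .
  show ?thesis by (rule comm_span_noncommutative)
qed

text \<open>
  If \<open>z\<close> is central, then \<open>z * P v = 0\<close> implies \<open>z * r * P v = r * z * P v = 0\<close> for all \<open>r\<close>, which a
  prime algebra forbids for nonzero \<open>z\<close>.
\<close>

lemma central_eq_zero:
  assumes z: "z \<in> kp_span" "\<And>r. r \<in> kp_span \<Longrightarrow> z * r = r * z"
    and v: "v \<in> Obj \<Lambda>" "z * P v = 0"
  shows "z = 0"
proof (rule ccontr)
  assume "z \<noteq> 0"
  then obtain r where r: "r \<in> kp_span" "z * r * P v \<noteq> 0"
    using prime [OF z(1) _ P_in_kp_span [OF Obj_Mor [OF v(1)]] P_nonzero [OF v(1)]] by blast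
  have "z * r * P v = r * (z * P v)" using z(2) r(1) by (simp add: mult.assoc)
  then show False using r v by simp
qed

text \<open>
  A vertex outside of a local unit of \<open>z\<close> is annihilated by \<open>z\<close>.
\<close>

lemma central_eq_zero_if_infinite:
  assumes inf: "infinite (Obj \<Lambda>)" and z: "z \<in> kp_span" "\<And>r. r \<in> kp_span \<Longrightarrow> z * r = r * z"
  shows "z = 0"
proof -
  obtain F where F: "finite F" "F \<subseteq> Obj \<Lambda>"
    "\<And>G. \<lbrakk>finite G; F \<subseteq> G; G \<subseteq> Obj \<Lambda>\<rbrakk> \<Longrightarrow> z * (\<Sum>v\<in>G. P v) = z"
    using local_unit [OF z(1)] by metis
  obtain v where v: "v \<in> Obj \<Lambda>" "v \<notin> F"
    using inf F(1) by (metis finite_subset subsetI)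
  have "z * (\<Sum>v\<in>F. P v) = z" "z * (\<Sum>v\<in>insert v F. P v) = z"
    using F v by (intro F(3); auto)+
  then have "z * P v = 0" using F v by (simp add: distrib_left)
  then show ?thesis using central_eq_zero z v by blast
qed

text \<open>
  Compression gives \<open>z * (\<alpha>\<^sup>* \<nu>) = \<alpha>\<^sup>* z \<nu> = c w\<close> with \<open>c \<noteq> 0\<close> and a vertex \<open>w\<close>. Hence \<open>\<alpha>\<^sup>* \<nu> \<noteq> 0\<close>, which
  leaves \<open>\<alpha> = \<nu>\<close> and \<open>z w = c w\<close>; so the central element \<open>z - c 1\<close> annihilates \<open>w\<close>.
\<close>

lemma central_eq_scalar:
  assumes fin: "finite (Obj \<Lambda>)" and z: "z \<in> kp_span" "\<And>r. r \<in> kp_span \<Longrightarrow> z * r = r * z"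
  shows "\<exists>c. z = c \<cdot> (\<Sum>v\<in>Obj \<Lambda>. P v)"
proof (cases "z = 0")
  case True
  then show ?thesis by (intro exI [of _ 0]) simp
next
  case False
  let ?one = "\<Sum>v\<in>Obj \<Lambda>. P v"
  have one: "?one * r = r" "r * ?one = r" if "r \<in> kp_span" for r
    using local_unit [OF that] fin by auto
  obtain \<alpha> \<nu> c where \<alpha>\<nu>: "\<alpha> \<in> Mor \<Lambda>" "\<nu> \<in> Mor \<Lambda>" "c \<noteq> 0" "Q \<alpha> * z * P \<nu> = c \<cdot> P (src \<Lambda> \<nu>)"
    "\<alpha> = \<nu> \<or> Q \<alpha> * P \<nu> = 0"
    by (rule compress_to_vertex [OF aperiodic z(1) False])
  let ?w = "src \<Lambda> \<nu>"
  have w: "?w \<in> Obj \<Lambda>" "P ?w \<in> kp_span" using \<alpha>\<nu>(2) by (simp_all add: src_Obj P_in_kp_span Obj_Mor)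
  have "z * (Q \<alpha> * P \<nu>) = c \<cdot> P ?w"
    using \<alpha>\<nu>(4) z(2) [OF Q_in_kp_span [OF \<alpha>\<nu>(1)]] by (simp add: mult.assoc [symmetric])
  moreover have "c \<cdot> P ?w \<noteq> 0" using \<alpha>\<nu>(3) P_nonzero [OF w(1)] by simp
  ultimately have "\<alpha> = \<nu>" using \<alpha>\<nu>(5) by auto
  then have zw: "z * P ?w = c \<cdot> P ?w"
    using \<open>z * (Q \<alpha> * P \<nu>) = c \<cdot> P ?w\<close> \<alpha>\<nu>(2) by (simp add: Q_P)
  let ?z = "z - c \<cdot> ?one"
  have "?z = 0"
  proof (rule central_eq_zero [OF _ _ w(1)])
    show "?z \<in> kp_span" by (intro diff_A scale_A one_in_kp_span z(1))
    show "?z * r = r * ?z" if "r \<in> kp_span" for r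
      using that z(2) by (simp add: left_diff_distrib right_diff_distrib scale_mult_left scale_mult_right one)
    show "?z * P ?w = 0"
      using w(2) by (simp add: left_diff_distrib scale_mult_left one zw)
  qed
  then show ?thesis by auto
qed

end

end

section \<open>The representation on functions of infinite paths\<close>

context k_graph
begin

text \<open>
  The path \<open>cmp \<Lambda> \<kappa> (f n)\<close> has degree \<open>deg \<Lambda> \<kappa> + n\<close> and is cut off at degree \<open>n\<close>.
\<close>

definition prepend :: "'l \<Rightarrow> (nat ^ 'k \<Rightarrow> 'l) \<Rightarrow> nat ^ 'k \<Rightarrow> 'l" where
  "prepend \<kappa> f n = initial_part \<Lambda> (cmp \<Lambda> \<kappa> (f n)) n"

definition drop_path :: "nat ^ 'k \<Rightarrow> (nat ^ 'k \<Rightarrow> 'l) \<Rightarrow> nat ^ 'k \<Rightarrow> 'l" where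
  "drop_path p f n = final_part \<Lambda> (f (p + n)) p"

text \<open>
  A coherent family is determined by its values in the degrees above \<open>p\<close>. This is how equations
  between families are proved below, since in degree \<open>deg \<Lambda> \<kappa> + n\<close> the family \<open>prepend \<kappa> f\<close> is just
  \<open>\<kappa>\<close> followed by \<open>f n\<close>.
\<close>

lemma coherent_eqI:
  assumes "coherent f" "coherent g" "\<And>n. f (p + n) = g (p + n)"
  shows "f = g"
proof
  fix n
  have "initial_part \<Lambda> (f (p + n)) n = f n" "initial_part \<Lambda> (g (p + n)) n = g n"
    using assms(1,2) by (simp_all add: coherent_initial)
  then show "f n = g n" using assms(3) by simp
qed

lemma coherent_cmp_drop_path:
  assumes f: "coherent f"
  shows "drop_path p f n \<in> Mor \<Lambda>" "deg \<Lambda> (drop_path p f n) = n"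
    "rng \<Lambda> (drop_path p f n) = src \<Lambda> (f p)" "cmp \<Lambda> (f p) (drop_path p f n) = f (p + n)"
proof -
  have *: "f (p + n) \<in> Mor \<Lambda>" "p \<le> deg \<Lambda> (f (p + n))" "initial_part \<Lambda> (f (p + n)) p = f p"
    using f by (auto simp: coherent_Mor coherent_deg coherent_initial)
  show "drop_path p f n \<in> Mor \<Lambda>" "deg \<Lambda> (drop_path p f n) = n"
    "rng \<Lambda> (drop_path p f n) = src \<Lambda> (f p)" "cmp \<Lambda> (f p) (drop_path p f n) = f (p + n)"
    using final_part_Mor [OF *(1,2)] deg_final_part [OF *(1,2)] src_initial_part [OF *(1,2)]
      cmp_initial_final [OF *(1,2)] f
    by (simp_all add: drop_path_def * coherent_deg)
qed

lemma coherent_drop_path: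
  assumes f: "coherent f"
  shows "coherent (drop_path p f)"
  unfolding coherent_def
proof (intro conjI allI impI)
  show "drop_path p f n \<in> Mor \<Lambda>" "deg \<Lambda> (drop_path p f n) = n" for n
    using coherent_cmp_drop_path [OF f] by auto
  show "initial_part \<Lambda> (drop_path p f n) m = drop_path p f m" if "m \<le> n" for m n
  proof -
    have le: "p \<le> p + m" "p + m \<le> p + n" using that by (auto simp: less_eq_vec_def)
    have "drop_path p f n = cmp \<Lambda> (drop_path p f m) (final_part \<Lambda> (f (p + n)) (p + m))"
      using final_part_eq_cmp [of "f (p + n)" p "p + m"] f le
      by (simp add: drop_path_def coherent_Mor coherent_deg coherent_initial)
    moreover have "src \<Lambda> (drop_path p f m) = rng \<Lambda> (final_part \<Lambda> (f (p + n)) (p + m))"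
      using f le src_final_part [of "f (p + m)" p] src_initial_part [of "f (p + n)" "p + m"]
      by (simp add: drop_path_def coherent_Mor coherent_deg coherent_initial)
    ultimately show ?thesis
      using f le by (simp add: initial_part_cmp coherent_cmp_drop_path final_part_Mor coherent_Mor coherent_deg)
  qed
qed

lemma drop_path_zero: "coherent f \<Longrightarrow> drop_path p f 0 = src \<Lambda> (f p)"
  using coherent_zero [OF coherent_drop_path] coherent_cmp_drop_path(3) by metis

lemma prepend_add:
  assumes f: "coherent f" and \<kappa>: "\<kappa> \<in> Mor \<Lambda>" "src \<Lambda> \<kappa> = f 0"
  shows "prepend \<kappa> f (deg \<Lambda> \<kappa> + n) = cmp \<Lambda> \<kappa> (f n)"
proof -
  let ?p = "deg \<Lambda> \<kappa>"
  have r: "rng \<Lambda> (f m) = src \<Lambda> \<kappa>" for m using coherent_zero [OF f] \<kappa> by metis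
  have "cmp \<Lambda> \<kappa> (f (?p + n)) = cmp \<Lambda> \<kappa> (cmp \<Lambda> (f n) (drop_path n f ?p))"
    using coherent_cmp_drop_path(4) [OF f, of n ?p] by (simp add: add.commute)
  also have "\<dots> = cmp \<Lambda> (cmp \<Lambda> \<kappa> (f n)) (drop_path n f ?p)"
    using \<kappa> r f by (intro cmp_assoc [symmetric]) (auto simp: coherent_Mor coherent_cmp_drop_path)
  finally show ?thesis
    unfolding prepend_def using \<kappa> r f
    by (simp add: initial_part_cmp cmp_Mor coherent_Mor coherent_cmp_drop_path src_cmp deg_cmp coherent_deg)
qed

lemma coherent_prepend:
  assumes f: "coherent f" and \<kappa>: "\<kappa> \<in> Mor \<Lambda>" "src \<Lambda> \<kappa> = f 0"
  shows "coherent (prepend \<kappa> f)"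
  unfolding coherent_def
proof (intro conjI allI impI)
  have r: "rng \<Lambda> (f m) = src \<Lambda> \<kappa>" for m using coherent_zero [OF f] \<kappa> by metis
  have c: "cmp \<Lambda> \<kappa> (f n) \<in> Mor \<Lambda>" "n \<le> deg \<Lambda> (cmp \<Lambda> \<kappa> (f n))" for n
    using \<kappa> r f by (auto simp: cmp_Mor coherent_Mor deg_cmp coherent_deg)
  show "prepend \<kappa> f n \<in> Mor \<Lambda>" "deg \<Lambda> (prepend \<kappa> f n) = n" for n
    using c by (auto simp: prepend_def initial_part_Mor deg_initial_part)
  show "initial_part \<Lambda> (prepend \<kappa> f n) m = prepend \<kappa> f m" if mn: "m \<le> n" for m n
  proof -
    have split: "f n = cmp \<Lambda> (f m) (drop_path m f (n - m))"
      using coherent_cmp_drop_path(4) [OF f, of m "n - m"] mn by (simp add: vec_nat_le_iff_add)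
    have "cmp \<Lambda> \<kappa> (f n) = cmp \<Lambda> (cmp \<Lambda> \<kappa> (f m)) (drop_path m f (n - m))"
      unfolding split
      using \<kappa> r f by (intro cmp_assoc [symmetric]) (auto simp: coherent_Mor coherent_cmp_drop_path)
    then have i: "initial_part \<Lambda> (cmp \<Lambda> \<kappa> (f n)) (deg \<Lambda> (cmp \<Lambda> \<kappa> (f m))) = cmp \<Lambda> \<kappa> (f m)"
      using \<kappa> r f c by (simp add: initial_part_cmp coherent_Mor coherent_cmp_drop_path src_cmp)
    have le: "deg \<Lambda> (cmp \<Lambda> \<kappa> (f m)) \<le> deg \<Lambda> (cmp \<Lambda> \<kappa> (f n))"
      using \<kappa> r f mn by (simp add: deg_cmp coherent_Mor coherent_deg less_eq_vec_def)
    have "initial_part \<Lambda> (prepend \<kappa> f n) m = initial_part \<Lambda> (cmp \<Lambda> \<kappa> (f n)) m"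
      unfolding prepend_def by (rule initial_part_initial_part) (use c mn in auto)
    also have "\<dots> = initial_part \<Lambda> (cmp \<Lambda> \<kappa> (f m)) m"
      using initial_part_initial_part [OF c(1) c(2) [of m] le] i by simp
    finally show ?thesis by (simp add: prepend_def)
  qed
qed

lemma prepend_deg:
  "\<lbrakk>coherent f; \<kappa> \<in> Mor \<Lambda>; src \<Lambda> \<kappa> = f 0\<rbrakk> \<Longrightarrow> prepend \<kappa> f (deg \<Lambda> \<kappa>) = \<kappa>"
  using prepend_add [of f \<kappa> 0] cmp_id_right [of \<kappa>] by simp

lemma prepend_zero:
  assumes "coherent f" "\<kappa> \<in> Mor \<Lambda>" "src \<Lambda> \<kappa> = f 0"
  shows "prepend \<kappa> f 0 = rng \<Lambda> \<kappa>"
  using coherent_zero [OF coherent_prepend [OF assms], of "deg \<Lambda> \<kappa>"] prepend_deg [OF assms] by simp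

lemma drop_path_prepend:
  assumes f: "coherent f" and \<kappa>: "\<kappa> \<in> Mor \<Lambda>" "src \<Lambda> \<kappa> = f 0"
  shows "drop_path (deg \<Lambda> \<kappa>) (prepend \<kappa> f) = f"
proof
  fix n
  have "src \<Lambda> \<kappa> = rng \<Lambda> (f n)" using coherent_zero [OF f] \<kappa> by metis
  then show "drop_path (deg \<Lambda> \<kappa>) (prepend \<kappa> f) n = f n"
    unfolding drop_path_def prepend_add [OF f \<kappa>]
    using \<kappa> f by (intro final_part_cmp) (auto simp: coherent_Mor)
qed

lemma prepend_drop_path:
  assumes f: "coherent f"
  shows "prepend (f p) (drop_path p f) = f"
proof (rule coherent_eqI)
  have *: "coherent (drop_path p f)" "f p \<in> Mor \<Lambda>" "src \<Lambda> (f p) = drop_path p f 0"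
    using f by (auto simp: coherent_drop_path coherent_Mor drop_path_zero)
  show "coherent (prepend (f p) (drop_path p f))" by (rule coherent_prepend [OF *])
  show "prepend (f p) (drop_path p f) (p + n) = f (p + n)" for n
    using prepend_add [OF *, of n] f by (simp add: coherent_deg coherent_cmp_drop_path)
qed (rule f)

lemma drop_path_drop_path: "coherent f \<Longrightarrow> drop_path q (drop_path p f) = drop_path (p + q) f"
  by (auto simp: drop_path_def fun_eq_iff add.assoc [symmetric] coherent_Mor coherent_deg
      final_part_final_part)

lemma prepend_prepend:
  assumes f: "coherent f" and \<mu>: "\<mu> \<in> Mor \<Lambda>" "src \<Lambda> \<mu> = f 0" and \<kappa>: "\<kappa> \<in> Mor \<Lambda>" "src \<Lambda> \<kappa> = rng \<Lambda> \<mu>"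
  shows "prepend \<kappa> (prepend \<mu> f) = prepend (cmp \<Lambda> \<kappa> \<mu>) f"
proof (rule coherent_eqI)
  have 1: "coherent (prepend \<mu> f)" "src \<Lambda> \<kappa> = prepend \<mu> f 0"
    using coherent_prepend [OF f \<mu>] prepend_zero [OF f \<mu>] \<kappa> by auto
  have 2: "cmp \<Lambda> \<kappa> \<mu> \<in> Mor \<Lambda>" "src \<Lambda> (cmp \<Lambda> \<kappa> \<mu>) = f 0"
    using \<kappa> \<mu> by (auto simp: cmp_Mor src_cmp)
  show "coherent (prepend \<kappa> (prepend \<mu> f))" by (rule coherent_prepend [OF 1(1) \<kappa>(1) 1(2)])
  show "coherent (prepend (cmp \<Lambda> \<kappa> \<mu>) f)" by (rule coherent_prepend [OF f 2])
  show "prepend \<kappa> (prepend \<mu> f) (deg \<Lambda> (cmp \<Lambda> \<kappa> \<mu>) + n) = prepend (cmp \<Lambda> \<kappa> \<mu>) f (deg \<Lambda> (cmp \<Lambda> \<kappa> \<mu>) + n)" for n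
  proof -
    have r: "src \<Lambda> \<mu> = rng \<Lambda> (f n)" using coherent_zero [OF f] \<mu> by metis
    have "prepend \<kappa> (prepend \<mu> f) (deg \<Lambda> (cmp \<Lambda> \<kappa> \<mu>) + n) = cmp \<Lambda> \<kappa> (cmp \<Lambda> \<mu> (f n))"
      using prepend_add [OF 1(1) \<kappa>(1) 1(2), of "deg \<Lambda> \<mu> + n"] prepend_add [OF f \<mu>, of n] \<kappa> \<mu>
      by (simp add: deg_cmp add.assoc)
    then show ?thesis
      using prepend_add [OF f 2, of n] \<kappa> \<mu> r f by (simp add: cmp_assoc coherent_Mor)
  qed
qed

lemma coherent_initial_segments:
  assumes x: "x \<in> infinite_paths \<Lambda>"
  shows "coherent (\<lambda>n. x (0, n))"
  unfolding coherent_def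
proof (intro conjI allI impI)
  show "x (0, n) \<in> Mor \<Lambda>" "deg \<Lambda> (x (0, n)) = n" for n
    using infinite_path_Mor [OF x, of 0 n] deg_infinite_path [OF x, of 0 n] by auto
  show "initial_part \<Lambda> (x (0, n)) m = x (0, m)" if "m \<le> n" for m n
    using initial_part_cmp [of "x (0, m)" "x (m, n)" m] cmp_infinite_path [OF x _ that, of 0] that
      infinite_path_Mor [OF x, of 0 m] infinite_path_Mor [OF x that] deg_infinite_path [OF x, of 0 m]
      src_infinite_path [OF x, of 0 m] rng_infinite_path [OF x that]
    by simp
qed

text \<open>
  A path acts on functions of infinite paths by removing itself from the argument, a ghost path by
  putting the path in front of the argument.
\<close>

definition path_op :: "'l \<Rightarrow> ((nat ^ 'k \<Rightarrow> 'l) \<Rightarrow> 'f::field) \<Rightarrow> (nat ^ 'k \<Rightarrow> 'l) \<Rightarrow> 'f" where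
  "path_op \<kappa> g f = (if coherent f \<and> f (deg \<Lambda> \<kappa>) = \<kappa> then g (drop_path (deg \<Lambda> \<kappa>) f) else 0)"

definition ghost_op :: "'l \<Rightarrow> ((nat ^ 'k \<Rightarrow> 'l) \<Rightarrow> 'f::field) \<Rightarrow> (nat ^ 'k \<Rightarrow> 'l) \<Rightarrow> 'f" where
  "ghost_op \<kappa> g f = (if coherent f \<and> f 0 = src \<Lambda> \<kappa> then g (prepend \<kappa> f) else 0)"

lemma vertex_op:
  assumes v: "v \<in> Obj \<Lambda>"
  shows "path_op v g f = (if coherent f \<and> f 0 = v then g f else 0)"
    and "ghost_op v g f = path_op v g f"
proof -
  have "drop_path 0 f = f \<and> prepend v f = f" if f: "coherent f" "f 0 = v"
  proof
    show "drop_path 0 f = f"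
    proof
      fix n
      have "cmp \<Lambda> v (drop_path 0 f n) = drop_path 0 f n"
        using coherent_cmp_drop_path [OF f(1), of 0 n] f(2) v cmp_id_left [of "drop_path 0 f n"]
        by (simp add: src_id)
      then show "drop_path 0 f n = f n"
        using coherent_cmp_drop_path(4) [OF f(1), of 0 n] f(2) by simp
    qed
    then show "prepend v f = f" using prepend_drop_path [OF f(1), of 0] f(2) by simp
  qed
  then show "path_op v g f = (if coherent f \<and> f 0 = v then g f else 0)" "ghost_op v g f = path_op v g f"
    using v by (auto simp: path_op_def ghost_op_def deg_id src_id)
qed

lemma path_op_cmp:
  assumes "\<kappa> \<in> Mor \<Lambda>" "\<mu> \<in> Mor \<Lambda>" "rng \<Lambda> \<mu> = src \<Lambda> \<kappa>"
  shows "path_op \<kappa> (path_op \<mu> g) = path_op (cmp \<Lambda> \<kappa> \<mu>) g"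
proof
  fix f
  have iff: "f (deg \<Lambda> \<kappa>) = \<kappa> \<and> drop_path (deg \<Lambda> \<kappa>) f (deg \<Lambda> \<mu>) = \<mu>
      \<longleftrightarrow> f (deg \<Lambda> (cmp \<Lambda> \<kappa> \<mu>)) = cmp \<Lambda> \<kappa> \<mu>" if f: "coherent f"
  proof -
    let ?d = "drop_path (deg \<Lambda> \<kappa>) f (deg \<Lambda> \<mu>)"
    have "f (deg \<Lambda> (cmp \<Lambda> \<kappa> \<mu>)) = cmp \<Lambda> (f (deg \<Lambda> \<kappa>)) ?d"
      using coherent_cmp_drop_path [OF f] assms by (simp add: deg_cmp)
    then show ?thesis
      using cmp_cancel [of "f (deg \<Lambda> \<kappa>)" ?d \<kappa> \<mu>] assms coherent_cmp_drop_path [OF f]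
        coherent_Mor [OF f] coherent_deg [OF f] by metis
  qed
  show "path_op \<kappa> (path_op \<mu> g) f = path_op (cmp \<Lambda> \<kappa> \<mu>) g f"
  proof (cases "coherent f")
    case True
    have "drop_path (deg \<Lambda> \<mu>) (drop_path (deg \<Lambda> \<kappa>) f) = drop_path (deg \<Lambda> (cmp \<Lambda> \<kappa> \<mu>)) f"
      using assms True by (simp add: drop_path_drop_path deg_cmp)
    then show ?thesis
      using iff [OF True] True by (auto simp: path_op_def coherent_drop_path)
  qed (simp add: path_op_def)
qed

lemma ghost_op_cmp:
  assumes "\<kappa> \<in> Mor \<Lambda>" "\<mu> \<in> Mor \<Lambda>" "rng \<Lambda> \<mu> = src \<Lambda> \<kappa>"
  shows "ghost_op \<mu> (ghost_op \<kappa> g) = ghost_op (cmp \<Lambda> \<kappa> \<mu>) g"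
  using assms
  by (auto simp: ghost_op_def fun_eq_iff coherent_prepend prepend_zero prepend_prepend src_cmp)

lemma ghost_path_op:
  assumes "\<kappa> \<in> Mor \<Lambda>" "\<mu> \<in> Mor \<Lambda>" "deg \<Lambda> \<kappa> = deg \<Lambda> \<mu>"
  shows "ghost_op \<kappa> (path_op \<mu> g) = (if \<kappa> = \<mu> then path_op (src \<Lambda> \<kappa>) g else (\<lambda>_. 0))"
proof
  fix f
  have "prepend \<kappa> f (deg \<Lambda> \<mu>) = \<kappa>" if "coherent f" "f 0 = src \<Lambda> \<kappa>"
    using prepend_deg [of f \<kappa>] that assms by simp
  then show "ghost_op \<kappa> (path_op \<mu> g) f = (if \<kappa> = \<mu> then path_op (src \<Lambda> \<kappa>) g else (\<lambda>_. 0)) f"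
    using assms drop_path_prepend [of f \<mu>] src_Obj [of \<mu>] coherent_prepend [of f]
    by (auto simp: ghost_op_def vertex_op path_op_def [of \<mu>])
qed

lemma sum_path_ghost_op:
  assumes rf: "row_finite \<Lambda>" and v: "v \<in> Obj \<Lambda>"
  shows "(\<Sum>\<kappa>\<in>paths_from \<Lambda> v n. path_op \<kappa> (ghost_op \<kappa> g) f) = path_op v g f"
proof -
  have *: "path_op \<kappa> (ghost_op \<kappa> g) f = (if coherent f \<and> \<kappa> = f n then g f else 0)"
    if "\<kappa> \<in> paths_from \<Lambda> v n" for \<kappa>
    using that prepend_drop_path [of f n]
    by (auto simp: path_op_def ghost_op_def paths_from_def coherent_drop_path drop_path_zero)
  have "(\<Sum>\<kappa>\<in>paths_from \<Lambda> v n. path_op \<kappa> (ghost_op \<kappa> g) f)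
      = (\<Sum>\<kappa>\<in>paths_from \<Lambda> v n. if coherent f \<and> \<kappa> = f n then g f else 0)"
    by (intro sum.cong refl *)
  also have "\<dots> = (if coherent f \<and> f 0 = v then g f else 0)"
  proof (cases "coherent f")
    case True
    have "f n \<in> paths_from \<Lambda> v n \<longleftrightarrow> f 0 = v"
      using coherent_zero [OF True, of n] True by (auto simp: paths_from_def coherent_Mor coherent_deg)
    then show ?thesis using rf v True by (simp add: row_finite_def)
  qed simp
  finally show ?thesis by (simp add: vertex_op [OF v])
qed

end

section \<open>Linear extension to the free algebra\<close>

lemma poly_mapping_eq_sum_single:
  "p = (\<Sum>w\<in>Poly_Mapping.keys p. Poly_Mapping.single w (Poly_Mapping.lookup p w))"
  by (rule poly_mapping_eqI)
    (simp add: lookup_sum lookup_single when_def in_keys_iff)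

lemma poly_mapping_single_induct [case_names zero add single]:
  assumes "R 0" "\<And>p q. \<lbrakk>R p; R q\<rbrakk> \<Longrightarrow> R (p + q)" "\<And>w c. R (Poly_Mapping.single w c)"
  shows "R (p :: 'w \<Rightarrow>\<^sub>0 'f::comm_monoid_add)"
proof -
  have "R (\<Sum>w\<in>S. Poly_Mapping.single w (Poly_Mapping.lookup p w))" if "finite S" for S
    using that by induction (auto intro: assms)
  from this [OF finite_keys [of p]] show ?thesis
    by (subst poly_mapping_eq_sum_single [of p])
qed

primrec letter_op :: "('l, 'k::finite) kgraph \<Rightarrow> 'l kp_letter
    \<Rightarrow> ((nat ^ 'k \<Rightarrow> 'l) \<Rightarrow> 'f::field) \<Rightarrow> (nat ^ 'k \<Rightarrow> 'l) \<Rightarrow> 'f" where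
  "letter_op \<Lambda> (Path \<kappa>) = k_graph.path_op \<Lambda> \<kappa>"
| "letter_op \<Lambda> (Ghost \<kappa>) = k_graph.ghost_op \<Lambda> \<kappa>"

definition word_op :: "('l, 'k::finite) kgraph \<Rightarrow> 'l kp_letter fword
    \<Rightarrow> ((nat ^ 'k \<Rightarrow> 'l) \<Rightarrow> 'f::field) \<Rightarrow> (nat ^ 'k \<Rightarrow> 'l) \<Rightarrow> 'f" where
  "word_op \<Lambda> w = foldr (letter_op \<Lambda>) (letters w)"

definition free_op :: "('l, 'k::finite) kgraph \<Rightarrow> ('l kp_letter fword \<Rightarrow>\<^sub>0 'f)
    \<Rightarrow> ((nat ^ 'k \<Rightarrow> 'l) \<Rightarrow> 'f::field) \<Rightarrow> (nat ^ 'k \<Rightarrow> 'l) \<Rightarrow> 'f" where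
  "free_op \<Lambda> p g f = (\<Sum>w\<in>Poly_Mapping.keys p. Poly_Mapping.lookup p w * word_op \<Lambda> w g f)"

context k_graph
begin

lemma letter_op_add: "letter_op \<Lambda> x (\<lambda>f. g f + g' f) = (\<lambda>f. letter_op \<Lambda> x g f + letter_op \<Lambda> x g' f)"
  and letter_op_scale: "letter_op \<Lambda> x (\<lambda>f. c * g f) = (\<lambda>f. c * letter_op \<Lambda> x g f)"
  by (cases x; auto simp: path_op_def ghost_op_def fun_eq_iff)+

lemma word_op_plus: "word_op \<Lambda> (u + w) g = word_op \<Lambda> u (word_op \<Lambda> w g)"
  by (simp add: word_op_def plus_fword_def)

lemma word_op_add: "word_op \<Lambda> w (\<lambda>f. g f + g' f) = (\<lambda>f. word_op \<Lambda> w g f + word_op \<Lambda> w g' f)"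
  and word_op_scale: "word_op \<Lambda> w (\<lambda>f. c * g f) = (\<lambda>f. c * word_op \<Lambda> w g f)"
proof -
  have "foldr (letter_op \<Lambda>) xs (\<lambda>f. g f + g' f)
      = (\<lambda>f. foldr (letter_op \<Lambda>) xs g f + foldr (letter_op \<Lambda>) xs g' f)" for xs
    by (induction xs) (auto simp: letter_op_add)
  moreover have "foldr (letter_op \<Lambda>) xs (\<lambda>f. c * g f) = (\<lambda>f. c * foldr (letter_op \<Lambda>) xs g f)" for xs
    by (induction xs) (auto simp: letter_op_scale)
  ultimately show "word_op \<Lambda> w (\<lambda>f. g f + g' f) = (\<lambda>f. word_op \<Lambda> w g f + word_op \<Lambda> w g' f)"
    "word_op \<Lambda> w (\<lambda>f. c * g f) = (\<lambda>f. c * word_op \<Lambda> w g f)"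
    by (simp_all add: word_op_def)
qed

lemma free_op_superset:
  assumes "finite S" "Poly_Mapping.keys p \<subseteq> S"
  shows "free_op \<Lambda> p g f = (\<Sum>w\<in>S. Poly_Mapping.lookup p w * word_op \<Lambda> w g f)"
  unfolding free_op_def
  by (rule sum.mono_neutral_left) (use assms in \<open>auto simp: in_keys_iff\<close>)

lemma free_op_zero: "free_op \<Lambda> 0 g = (\<lambda>_. 0)"
  by (simp add: free_op_def fun_eq_iff)

lemma free_op_single: "free_op \<Lambda> (Poly_Mapping.single w c) g f = c * word_op \<Lambda> w g f"
  by (simp add: free_op_def)

lemma free_op_add: "free_op \<Lambda> (p + q) g f = free_op \<Lambda> p g f + free_op \<Lambda> q g f"
proof -
  let ?S = "Poly_Mapping.keys p \<union> Poly_Mapping.keys q"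
  have "free_op \<Lambda> (p + q) g f = (\<Sum>w\<in>?S. Poly_Mapping.lookup (p + q) w * word_op \<Lambda> w g f)"
    by (rule free_op_superset) (auto simp: keys_add)
  also have "\<dots> = (\<Sum>w\<in>?S. Poly_Mapping.lookup p w * word_op \<Lambda> w g f)
      + (\<Sum>w\<in>?S. Poly_Mapping.lookup q w * word_op \<Lambda> w g f)"
    by (simp add: lookup_add distrib_right sum.distrib)
  also have "\<dots> = free_op \<Lambda> p g f + free_op \<Lambda> q g f"
    by (simp add: free_op_superset [of ?S])
  finally show ?thesis .
qed

lemma free_op_diff: "free_op \<Lambda> (p - q) g f = free_op \<Lambda> p g f - free_op \<Lambda> q g f"
  using free_op_add [of "p - q" q g f] by simp

lemma free_op_sum: "free_op \<Lambda> (\<Sum>i\<in>S. p i) g f = (\<Sum>i\<in>S. free_op \<Lambda> (p i) g f)"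
  by (induction S rule: infinite_finite_induct) (auto simp: free_op_zero free_op_add)

lemma free_op_mult: "free_op \<Lambda> (p * q) g = free_op \<Lambda> p (free_op \<Lambda> q g)"
proof (induction p rule: poly_mapping_single_induct)
  case (single u a)
  show ?case
  proof (induction q rule: poly_mapping_single_induct)
    case zero
    have "free_op \<Lambda> 0 g = (\<lambda>f. 0 * free_op \<Lambda> 0 g f)" by (simp add: free_op_zero)
    then have "word_op \<Lambda> u (free_op \<Lambda> 0 g) = (\<lambda>f. 0)"
      using word_op_scale [of u 0 "free_op \<Lambda> 0 g"] by simp
    then show ?case by (simp add: fun_eq_iff free_op_single free_op_zero)
  next
    case (add p q)
    have "free_op \<Lambda> (p + q) g = (\<lambda>f. free_op \<Lambda> p g f + free_op \<Lambda> q g f)"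
      by (simp add: fun_eq_iff free_op_add)
    then show ?case
      using add by (simp add: fun_eq_iff free_op_single word_op_add distrib_left free_op_add)
  next
    case (single w b)
    have "free_op \<Lambda> (Poly_Mapping.single w b) g = (\<lambda>f. b * word_op \<Lambda> w g f)"
      by (simp add: fun_eq_iff free_op_single)
    then show ?case
      by (simp add: fun_eq_iff mult_single free_op_single word_op_plus word_op_scale mult.assoc)
  qed
qed (auto simp: fun_eq_iff free_op_zero free_op_add distrib_right)

lemma free_op_path_gen: "free_op \<Lambda> (path_gen \<kappa>) g = path_op \<kappa> g"
  by (simp add: fun_eq_iff path_gen_def free_gen_def free_op_single word_op_def)

lemma free_op_ghost_gen: "free_op \<Lambda> (ghost_gen \<Lambda> \<kappa>) g = ghost_op \<kappa> g"
  by (auto simp: fun_eq_iff ghost_gen_def free_gen_def free_op_single word_op_def vertex_op)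

lemma free_op_kp_relations:
  assumes "row_finite \<Lambda>" and "r \<in> kp_relations \<Lambda>"
  shows "free_op \<Lambda> r g f = 0"
proof -
  consider "r \<in> kp1 \<Lambda>" | "r \<in> kp2 \<Lambda>" | "r \<in> kp3 \<Lambda>" | "r \<in> kp4 \<Lambda>"
    using assms(2) by (auto simp: kp_relations_def)
  then show ?thesis
  proof cases
    case 1
    then show ?thesis
      by (auto simp: kp1_def free_op_diff free_op_mult free_op_path_gen free_op_zero vertex_op)
  next
    case 2
    then show ?thesis
      by (auto simp: kp2_def free_op_diff free_op_mult free_op_path_gen free_op_ghost_gen
          path_op_cmp ghost_op_cmp)
  next
    case 3
    then show ?thesis
      by (auto simp: kp3_def free_op_diff free_op_mult free_op_path_gen free_op_ghost_gen free_op_zero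
          ghost_path_op)
  next
    case 4
    then show ?thesis
      by (auto simp: sum_path_ghost_op [OF assms(1)] kp4_def free_op_diff free_op_mult free_op_sum free_op_path_gen free_op_ghost_gen)
  qed
qed

end

section \<open>Linear endomorphisms\<close>

lemma lookup_map_mult: "Poly_Mapping.lookup (Poly_Mapping.map ((*) c) p) w = c * Poly_Mapping.lookup p w"
  for c :: "'f::field"
  by (simp add: map.rep_eq when_def)

interpretation poly_mapping_space:
  vector_space "\<lambda>c. Poly_Mapping.map ((*) c) :: ('w \<Rightarrow>\<^sub>0 'f::field) \<Rightarrow> _"
  by unfold_locales (auto intro!: poly_mapping_eqI simp: lookup_map_mult lookup_add algebra_simps)

lemma map_mult_single: "Poly_Mapping.map ((*) c) (Poly_Mapping.single w b) = Poly_Mapping.single w (c * b)"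
  for c :: "'f::field"
  by (rule poly_mapping_eqI) (simp add: lookup_map_mult lookup_single when_def)

lemma map_mult_times:
  fixes c :: "'f::field" and p q :: "'w::monoid_add \<Rightarrow>\<^sub>0 'f"
  shows "Poly_Mapping.map ((*) c) p * q = Poly_Mapping.map ((*) c) (p * q)"
    and "p * Poly_Mapping.map ((*) c) q = Poly_Mapping.map ((*) c) (p * q)"
    and "p * Poly_Mapping.single 0 c = Poly_Mapping.map ((*) c) p"
proof -
  show 1: "p * Poly_Mapping.single 0 c = Poly_Mapping.map ((*) c) p" for p :: "'w \<Rightarrow>\<^sub>0 'f"
    by (induction p rule: poly_mapping_single_induct)
      (simp_all add: distrib_right poly_mapping_space.scale_right_distrib mult_single map_mult_single
        mult.commute [of _ c])
  have 2: "Poly_Mapping.single 0 c * p = Poly_Mapping.map ((*) c) p" for p :: "'w \<Rightarrow>\<^sub>0 'f"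
    by (induction p rule: poly_mapping_single_induct)
      (simp_all add: distrib_left poly_mapping_space.scale_right_distrib mult_single map_mult_single)
  show "Poly_Mapping.map ((*) c) p * q = Poly_Mapping.map ((*) c) (p * q)"
    by (simp only: 2 [symmetric] mult.assoc)
  show "p * Poly_Mapping.map ((*) c) q = Poly_Mapping.map ((*) c) (p * q)"
    by (simp only: 1 [symmetric] mult.assoc)
qed

text \<open>
  The ring of endomorphisms of a space \<open>'w \<Rightarrow>\<^sub>0 'f\<close> is a type, so that calculations in an algebra
  which embeds into it take place in a type class and need no side conditions.
\<close>

typedef (overloaded) ('w, 'f) lin_endo =
  "{g :: ('w \<Rightarrow>\<^sub>0 'f::field) \<Rightarrow> ('w \<Rightarrow>\<^sub>0 'f).
     (\<forall>x y. g (x + y) = g x + g y) \<and> (\<forall>c x. g (Poly_Mapping.map ((*) c) x) = Poly_Mapping.map ((*) c) (g x))}"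
  by (rule exI [of _ id]) simp

setup_lifting type_definition_lin_endo

instantiation lin_endo :: (type, field) ring_1
begin

lift_definition zero_lin_endo :: "('a, 'b) lin_endo" is "\<lambda>_. 0" by simp

lift_definition one_lin_endo :: "('a, 'b) lin_endo" is "\<lambda>x. x" by simp

lift_definition plus_lin_endo :: "('a, 'b) lin_endo \<Rightarrow> ('a, 'b) lin_endo \<Rightarrow> ('a, 'b) lin_endo"
  is "\<lambda>f g x. f x + g x"
  by (simp add: poly_mapping_space.scale_right_distrib algebra_simps)

lift_definition uminus_lin_endo :: "('a, 'b) lin_endo \<Rightarrow> ('a, 'b) lin_endo"
  is "\<lambda>f x. - f x" by simp

lift_definition minus_lin_endo :: "('a, 'b) lin_endo \<Rightarrow> ('a, 'b) lin_endo \<Rightarrow> ('a, 'b) lin_endo"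
  is "\<lambda>f g x. f x - g x"
  by (simp add: poly_mapping_space.scale_right_diff_distrib algebra_simps)

lift_definition times_lin_endo :: "('a, 'b) lin_endo \<Rightarrow> ('a, 'b) lin_endo \<Rightarrow> ('a, 'b) lin_endo"
  is "\<lambda>f g x. f (g x)" by simp

instance
proof
  show "(0 :: ('a, 'b) lin_endo) \<noteq> 1"
  proof
    assume "(0 :: ('a, 'b) lin_endo) = 1"
    then have "Rep_lin_endo (0 :: ('a, 'b) lin_endo) x = Rep_lin_endo 1 x" for x
      by simp
    then have "x = 0" for x :: "'a \<Rightarrow>\<^sub>0 'b"
      by (simp add: zero_lin_endo.rep_eq one_lin_endo.rep_eq)
    then have "Poly_Mapping.single undefined 1 = (0 :: 'a \<Rightarrow>\<^sub>0 'b)" .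
    then show False
      by (metis lookup_single_eq lookup_zero zero_neq_one)
  qed
qed (transfer; simp add: algebra_simps)+

end

lift_definition endo_scale :: "'f::field \<Rightarrow> ('w, 'f) lin_endo \<Rightarrow> ('w, 'f) lin_endo"
  is "\<lambda>c f x. Poly_Mapping.map ((*) c) (f x)"
  by (simp add: poly_mapping_space.scale_right_distrib mult.commute)

interpretation lin_endo: algebra_1 endo_scale
  by unfold_locales
    (transfer; simp add: poly_mapping_space.scale_right_distrib poly_mapping_space.scale_left_distrib)+

section \<open>Embedding a quotient of a free algebra\<close>

lemma (in vector_space) exists_projection:
  assumes "subspace W"
  obtains g where "\<And>x y. g (x + y) = g x + g y" "\<And>c x. g (scale c x) = scale c (g x)"
    "\<And>x. g x \<in> W" "\<And>x. x \<in> W \<Longrightarrow> g x = x"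
proof -
  interpret vector_space_pair scale scale ..
  obtain g where g: "range g \<subseteq> W" "Vector_Spaces.linear scale scale g" "\<forall>v\<in>W. g (id v) = v"
    using linear_exists_left_inverse_on [OF linear_id assms] by auto
  interpret g: Vector_Spaces.linear scale scale g by fact
  show thesis
    using that [of g] g g.add g.scale by auto
qed

abbreviation free_carrier :: "'x set \<Rightarrow> ('x fword \<Rightarrow>\<^sub>0 'f::field) set" where
  "free_carrier X \<equiv> Carr (free_algebra X)"

lemma mem_free_carrier:
  "p \<in> free_carrier X \<longleftrightarrow> (\<forall>w\<in>Poly_Mapping.keys p. letters w \<noteq> [] \<and> set (letters w) \<subseteq> X)"
  by (simp add: free_algebra_def)

lemma subspace_keys: "poly_mapping_space.subspace {p :: 'w \<Rightarrow>\<^sub>0 'f::field. \<forall>w\<in>Poly_Mapping.keys p. R w}"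
  by (rule poly_mapping_space.subspaceI)
    (auto simp: in_keys_iff lookup_add lookup_map_mult)

lemma subspace_free_carrier:
  "poly_mapping_space.subspace (free_carrier X :: ('x fword \<Rightarrow>\<^sub>0 'f::field) set)"
  unfolding free_algebra_def by (simp add: subspace_keys)

lemma free_carrier_mult:
  assumes "p \<in> free_carrier X" and "\<forall>w\<in>Poly_Mapping.keys q. set (letters w) \<subseteq> X"
  shows "p * q \<in> free_carrier X"
proof -
  have "letters w \<noteq> [] \<and> set (letters w) \<subseteq> X" if w: "w \<in> Poly_Mapping.keys (p * q)" for w
  proof -
    obtain u v where "w = u + v" "u \<in> Poly_Mapping.keys p" "v \<in> Poly_Mapping.keys q"
      using w keys_mult [of p q] by blast
    then show ?thesis using assms by (auto simp: mem_free_carrier plus_fword_def)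
  qed
  then show ?thesis by (simp add: mem_free_carrier)
qed

lemma two_sided_ideal_free_algebra:
  "two_sided_ideal (free_algebra X) I \<longleftrightarrow> I \<subseteq> free_carrier X \<and> poly_mapping_space.subspace I
     \<and> (\<forall>a\<in>free_carrier X. \<forall>i\<in>I. a * i \<in> I \<and> i * a \<in> I)"
  by (auto simp: two_sided_ideal_def alg_subspace_def free_algebra_def poly_mapping_space.subspace_def)

text \<open>
  The endomorphism \<open>T a\<close> is left multiplication by \<open>a\<close> followed by a linear projection with
  kernel \<open>I\<close>. It is faithful because the free algebra sits inside the unital ring of all
  \<open>'x fword \<Rightarrow>\<^sub>0 'f\<close>: the value of \<open>T a\<close> at \<open>1\<close> recovers \<open>a\<close> modulo \<open>I\<close>. The second projection \<open>\<pi>\<close>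
  discards words with letters outside \<open>X\<close>, because right multiplication by those need not
  preserve \<open>I\<close>.
\<close>

lemma quotient_embedding:
  fixes I :: "('x fword \<Rightarrow>\<^sub>0 'f::field) set"
  assumes I: "two_sided_ideal (free_algebra X) I"
  obtains T :: "('x fword \<Rightarrow>\<^sub>0 'f) \<Rightarrow> ('x fword, 'f) lin_endo"
  where "\<And>p q. T (p + q) = T p + T q"
    and "\<And>c p. T (Poly_Mapping.map ((*) c) p) = endo_scale c (T p)"
    and "\<And>p q. \<lbrakk>p \<in> free_carrier X; q \<in> free_carrier X\<rbrakk> \<Longrightarrow> T (p * q) = T p * T q"
    and "\<And>p. p \<in> free_carrier X \<Longrightarrow> T p = 0 \<longleftrightarrow> p \<in> I"
proof -
  let ?F = "free_carrier X :: ('x fword \<Rightarrow>\<^sub>0 'f) set"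
  let ?W = "{p :: 'x fword \<Rightarrow>\<^sub>0 'f. \<forall>w\<in>Poly_Mapping.keys p. set (letters w) \<subseteq> X}"
  have I_F: "I \<subseteq> ?F" and I_sub: "poly_mapping_space.subspace I"
    and I_left: "\<And>a i. \<lbrakk>a \<in> ?F; i \<in> I\<rbrakk> \<Longrightarrow> a * i \<in> I"
    and I_right: "\<And>a i. \<lbrakk>a \<in> ?F; i \<in> I\<rbrakk> \<Longrightarrow> i * a \<in> I"
    using I by (auto simp: two_sided_ideal_free_algebra)
  have F_W: "?F \<subseteq> ?W" by (auto simp: mem_free_carrier) blast
  have I_W: "i * x \<in> I" if i: "i \<in> I" and x: "x \<in> ?W" for i x
  proof -
    let ?c = "Poly_Mapping.lookup x 0" and ?x = "x - Poly_Mapping.single 0 (Poly_Mapping.lookup x 0)"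
    have "Poly_Mapping.lookup ?x 0 = 0" by (simp add: lookup_minus)
    moreover have "Poly_Mapping.lookup ?x w = Poly_Mapping.lookup x w" if "w \<noteq> 0" for w
      using that by (simp add: lookup_minus lookup_single)
    moreover have "letters w \<noteq> []" if "w \<noteq> 0" for w :: "'x fword"
      using that by (cases w) (simp add: zero_fword_def)
    ultimately have "letters w \<noteq> [] \<and> set (letters w) \<subseteq> X" if "w \<in> Poly_Mapping.keys ?x" for w
      using that x by (cases "w = 0") (auto simp: in_keys_iff)
    then have "?x \<in> ?F" by (simp add: mem_free_carrier)
    then have "i * ?x \<in> I" using I_right i by blast
    moreover have "i * Poly_Mapping.single 0 ?c \<in> I"
      unfolding map_mult_times using I_sub i by (rule poly_mapping_space.subspace_scale)
    ultimately have "i * ?x + i * Poly_Mapping.single 0 ?c \<in> I"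
      using I_sub by (intro poly_mapping_space.subspace_add)
    then show ?thesis by (simp add: distrib_left [symmetric])
  qed
  obtain g where g_add: "\<And>x y. g (x + y) = g x + g y"
    and g_scale: "\<And>c x. g (Poly_Mapping.map ((*) c) x) = Poly_Mapping.map ((*) c) (g x)"
    and g_I: "\<And>x. g x \<in> I" and g_id: "\<And>x. x \<in> I \<Longrightarrow> g x = x"
    by (rule poly_mapping_space.exists_projection [OF I_sub]) (rule that)
  obtain \<pi> where \<pi>_add: "\<And>x y. \<pi> (x + y) = \<pi> x + \<pi> y"
    and \<pi>_scale: "\<And>c x. \<pi> (Poly_Mapping.map ((*) c) x) = Poly_Mapping.map ((*) c) (\<pi> x)"
    and \<pi>_W: "\<And>x. \<pi> x \<in> ?W" and \<pi>_id: "\<And>x. x \<in> ?W \<Longrightarrow> \<pi> x = x"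
    by (rule poly_mapping_space.exists_projection [OF subspace_keys]) (rule that)
  define P where "P x = x - g x" for x
  have P_add: "P (x + y) = P x + P y" for x y
    by (simp add: P_def g_add)
  have P_scale: "P (Poly_Mapping.map ((*) c) x) = Poly_Mapping.map ((*) c) (P x)" for c x
    by (simp add: P_def g_scale poly_mapping_space.scale_right_diff_distrib)
  have P_I: "P x = 0" if "x \<in> I" for x
    using that by (simp add: P_def g_id)
  define T where "T a = Abs_lin_endo (\<lambda>x. P (a * \<pi> x))" for a
  have T: "Rep_lin_endo (T a) x = P (a * \<pi> x)" for a x
    unfolding T_def
    by (subst Abs_lin_endo_inverse) (auto simp: \<pi>_add \<pi>_scale P_add P_scale distrib_left map_mult_times)
  have T_eqI: "t = t'" if "\<And>x. Rep_lin_endo t x = Rep_lin_endo t' x" for t t' :: "('x fword, 'f) lin_endo"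
    using that by (simp add: Rep_lin_endo_inject [symmetric] fun_eq_iff)
  show thesis
  proof (rule that [of T])
    show "T (p + q) = T p + T q" for p q
      by (rule T_eqI) (simp add: T plus_lin_endo.rep_eq distrib_right P_add)
    show "T (Poly_Mapping.map ((*) c) p) = endo_scale c (T p)" for c p
      by (rule T_eqI) (simp add: T endo_scale.rep_eq map_mult_times P_scale)
    show "T (p * q) = T p * T q" if p: "p \<in> ?F" and q: "q \<in> ?F" for p q
    proof (rule T_eqI)
      fix x
      let ?y = "q * \<pi> x"
      have y: "?y \<in> ?F" using free_carrier_mult [OF q] \<pi>_W by blast
      then have "P ?y \<in> ?F"
        unfolding P_def using g_I I_F subspace_free_carrier
        by (intro poly_mapping_space.subspace_diff) auto
      then have "\<pi> (P ?y) = P ?y" using F_W by (intro \<pi>_id) blast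
      then have "Rep_lin_endo (T p * T q) x = P (p * P ?y)"
        by (simp add: T times_lin_endo.rep_eq)
      also have "\<dots> = P (p * P ?y) + P (p * g ?y)"
        using P_I [OF I_left [OF p g_I]] by simp
      also have "\<dots> = P (p * ?y)"
        by (simp add: P_add [symmetric] distrib_left [symmetric] P_def [of ?y])
      finally show "Rep_lin_endo (T (p * q)) x = Rep_lin_endo (T p * T q) x"
        by (simp add: T mult.assoc)
    qed
    show "T p = 0 \<longleftrightarrow> p \<in> I" if p: "p \<in> ?F" for p
    proof
      assume "T p = 0"
      then have "P (p * \<pi> 1) = 0" using T [of p 1] by (simp add: zero_lin_endo.rep_eq)
      moreover have "\<pi> 1 = 1" by (rule \<pi>_id) (simp add: zero_fword_def)
      ultimately have "p = g p" by (simp add: P_def)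
      then show "p \<in> I" using g_I [of p] by simp
    next
      assume "p \<in> I"
      then show "T p = 0"
        by (intro T_eqI) (simp add: T zero_lin_endo.rep_eq P_I I_W \<pi>_W del: mem_Collect_eq)
    qed
  qed
qed

section \<open>Transport along an embedding\<close>

text \<open>
  An injective homomorphism from an algebra given as a record into a ring that is a type. The
  locale translates subspaces, Lie ideals and commutators between the record \<open>R\<close> and the image of
  \<open>h\<close>.
\<close>

locale algebra_embedding = algebra_1 scale
  for scale :: "'f::field \<Rightarrow> 'a::ring_1 \<Rightarrow> 'a" (infixr "\<cdot>" 75) +
  fixes R :: "('f, 'b) kalg" and h :: "'b \<Rightarrow> 'a"
  assumes inj: "inj_on h (Carr R)"
    and zer_R: "zer R \<in> Carr R" "h (zer R) = 0"
    and add_R: "\<lbrakk>x \<in> Carr R; y \<in> Carr R\<rbrakk> \<Longrightarrow> add R x y \<in> Carr R"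
      "\<lbrakk>x \<in> Carr R; y \<in> Carr R\<rbrakk> \<Longrightarrow> h (add R x y) = h x + h y"
    and scl_R: "x \<in> Carr R \<Longrightarrow> scl R c x \<in> Carr R" "x \<in> Carr R \<Longrightarrow> h (scl R c x) = c \<cdot> h x"
    and mul_R: "\<lbrakk>x \<in> Carr R; y \<in> Carr R\<rbrakk> \<Longrightarrow> mul R x y \<in> Carr R"
      "\<lbrakk>x \<in> Carr R; y \<in> Carr R\<rbrakk> \<Longrightarrow> h (mul R x y) = h x * h y"
begin

definition img :: "'a set" where
  "img = h ` Carr R"

lemma h_eq_iff: "\<lbrakk>x \<in> Carr R; y \<in> Carr R\<rbrakk> \<Longrightarrow> h x = h y \<longleftrightarrow> x = y"
  using inj by (simp add: inj_on_eq_iff)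

lemma alg_subspace_iff: "alg_subspace R W \<longleftrightarrow> W \<subseteq> Carr R \<and> subspace (h ` W)"
proof
  assume W: "alg_subspace R W"
  then have WR: "W \<subseteq> Carr R" by (simp add: alg_subspace_def)
  have "subspace (h ` W)"
  proof (rule subspaceI)
    show "0 \<in> h ` W" using W zer_R(2) by (auto simp: alg_subspace_def image_iff intro: bexI [of _ "zer R"])
    show "x + y \<in> h ` W" if xy: "x \<in> h ` W" "y \<in> h ` W" for x y
    proof -
      obtain a b where ab: "a \<in> W" "b \<in> W" "x = h a" "y = h b" using xy by blast
      then have "a \<in> Carr R" "b \<in> Carr R" using WR by auto
      then have "x + y = h (add R a b)" "add R a b \<in> W"
        using W ab by (auto simp: alg_subspace_def add_R(2))
      then show ?thesis by blast
    qed
    show "c \<cdot> x \<in> h ` W" if x: "x \<in> h ` W" for c x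
    proof -
      obtain a where a: "a \<in> W" "x = h a" using x by blast
      then have "a \<in> Carr R" using WR by auto
      then have "c \<cdot> x = h (scl R c a)" "scl R c a \<in> W"
        using W a by (auto simp: alg_subspace_def scl_R(2))
      then show ?thesis by blast
    qed
  qed
  then show "W \<subseteq> Carr R \<and> subspace (h ` W)" using WR by simp
next
  assume W: "W \<subseteq> Carr R \<and> subspace (h ` W)"
  have mem: "x \<in> W" if "x \<in> Carr R" "h x \<in> h ` W" for x
    using that W h_eq_iff by (auto simp: subset_iff)
  show "alg_subspace R W"
    unfolding alg_subspace_def
  proof (intro conjI ballI allI)
    show "W \<subseteq> Carr R" using W by simp
    show "zer R \<in> W" using W by (intro mem) (auto simp: zer_R subspace_0)
    show "add R x y \<in> W" if "x \<in> W" "y \<in> W" for x y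
      using W that by (intro mem) (auto simp: subset_iff add_R intro!: subspace_add)
    show "scl R c x \<in> W" if "x \<in> W" for c x
      using W that by (intro mem) (auto simp: subset_iff scl_R intro!: subspace_scale)
  qed
qed

lemma subspace_img: "subspace img"
proof -
  have "alg_subspace R (Carr R)" by (simp add: alg_subspace_def zer_R add_R scl_R)
  then show ?thesis by (simp add: alg_subspace_iff img_def)
qed

lemma image_vimage: "S \<subseteq> img \<Longrightarrow> h ` {x \<in> Carr R. h x \<in> S} = S"
  by (auto simp: img_def)

lemma alg_span_eq:
  assumes S: "S \<subseteq> Carr R"
  shows "alg_span R S = {x \<in> Carr R. h x \<in> span (h ` S)}"
proof
  have "span (h ` S) \<subseteq> img"
    using S subspace_img by (intro span_minimal) (auto simp: img_def)
  then have "alg_subspace R {x \<in> Carr R. h x \<in> span (h ` S)}"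
    unfolding alg_subspace_iff by (auto simp: image_vimage)
  then show "alg_span R S \<subseteq> {x \<in> Carr R. h x \<in> span (h ` S)}"
    unfolding alg_span_def using S by (intro Inter_lower) (auto intro: span_base)
next
  show "{x \<in> Carr R. h x \<in> span (h ` S)} \<subseteq> alg_span R S"
    unfolding alg_span_def
  proof (intro Inter_greatest subsetI)
    fix W x
    assume "W \<in> {W. alg_subspace R W \<and> S \<subseteq> W}" and x: "x \<in> {x \<in> Carr R. h x \<in> span (h ` S)}"
    then have W: "W \<subseteq> Carr R" "subspace (h ` W)" "S \<subseteq> W" by (auto simp: alg_subspace_iff)
    then have "span (h ` S) \<subseteq> h ` W" by (intro span_minimal) auto
    then have "h x \<in> h ` W" using x by auto
    then show "x \<in> W" using x W(1) h_eq_iff by (auto simp: subset_iff)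
  qed
qed

lemma commutator_R:
  assumes "x \<in> Carr R" "y \<in> Carr R"
  shows "commutator R x y \<in> Carr R" "h (commutator R x y) = h x * h y - h y * h x"
  using assms by (simp_all add: commutator_def add_R scl_R mul_R)

lemma commutator_space_eq: "commutator_space R = {x \<in> Carr R. h x \<in> comm_span img}"
proof -
  have "h ` {commutator R x y | x y. x \<in> Carr R \<and> y \<in> Carr R} = {x * y - y * x | x y. x \<in> img \<and> y \<in> img}"
  proof (intro equalityI subsetI)
    fix z assume "z \<in> h ` {commutator R x y | x y. x \<in> Carr R \<and> y \<in> Carr R}"
    then obtain x y where "x \<in> Carr R" "y \<in> Carr R" "z = h (commutator R x y)" by blast
    then have "h x \<in> img" "h y \<in> img" "z = h x * h y - h y * h x"
      by (auto simp: img_def commutator_R)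
    then show "z \<in> {x * y - y * x | x y. x \<in> img \<and> y \<in> img}" by blast
  next
    fix z assume "z \<in> {x * y - y * x | x y. x \<in> img \<and> y \<in> img}"
    then obtain x y where "x \<in> Carr R" "y \<in> Carr R" "z = h x * h y - h y * h x"
      by (auto simp: img_def)
    then have "x \<in> Carr R" "y \<in> Carr R" "z = h (commutator R x y)"
      by (auto simp: commutator_R)
    then show "z \<in> h ` {commutator R x y | x y. x \<in> Carr R \<and> y \<in> Carr R}" by blast
  qed
  moreover have "{commutator R x y | x y. x \<in> Carr R \<and> y \<in> Carr R} \<subseteq> Carr R"
    by (auto simp: commutator_R)
  ultimately show ?thesis
    unfolding commutator_space_def comm_span_def by (simp add: alg_span_eq)
qed

sublocale subalgebra scale img
  by unfold_locales (rule subspace_img, auto simp: img_def mul_R(2) [symmetric] mul_R(1))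

lemma image_commutator_space: "h ` commutator_space R = comm_span img"
  unfolding commutator_space_eq by (rule image_vimage [OF comm_span_subset])

abbreviation lie :: "('f, 'b) kalg" where
  "lie \<equiv> commutator_lie_algebra R"

lemma lie_simps: "Carr lie = commutator_space R" "zer lie = zer R" "add lie = add R" "scl lie = scl R"
  "mul lie = commutator R"
  by (simp_all add: commutator_lie_algebra_def)

lemma commutator_space_Carr: "x \<in> commutator_space R \<Longrightarrow> x \<in> Carr R"
  by (simp add: commutator_space_eq)

lemma commutator_space_closed:
  "zer R \<in> commutator_space R"
  "\<lbrakk>x \<in> commutator_space R; y \<in> commutator_space R\<rbrakk> \<Longrightarrow> add R x y \<in> commutator_space R"
  "x \<in> commutator_space R \<Longrightarrow> scl R c x \<in> commutator_space R"
  "\<lbrakk>x \<in> Carr R; y \<in> Carr R\<rbrakk> \<Longrightarrow> commutator R x y \<in> commutator_space R"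
  by (auto simp: commutator_space_eq zer_R add_R scl_R commutator_R img_def comm_span_def
      span_zero span_add span_scale intro!: comm_in_comm_span [unfolded comm_span_def])

text \<open>All axioms can be checked after applying \<open>h\<close>, where they are identities in a ring.\<close>

lemma lie_algebra_lie: "lie_algebra lie"
proof
  note cl = commutator_space_closed commutator_space_Carr commutator_R(1) zer_R(1) add_R(1) scl_R(1)
  note hom = zer_R(2) add_R(2) scl_R(2) commutator_R(2)
  have eqI: "x = y" if "x \<in> Carr R" "y \<in> Carr R" "h x = h y" for x y
    using that by (simp add: h_eq_iff)
  note simps = lie_simps cl hom algebra_simps scale_mult_left scale_mult_right scale_right_diff_distrib
  fix c d and x y z
  show "zer lie \<in> Carr lie" by (simp add: simps)
  assume x: "x \<in> Carr lie"
  show "scl lie c x \<in> Carr lie" using x by (simp add: simps)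
  show "add lie x (zer lie) = x" using x by (intro eqI) (simp_all add: simps)
  show "add lie x (scl lie (- 1) x) = zer lie" using x by (intro eqI) (simp_all add: simps)
  show "scl lie 1 x = x" using x by (intro eqI) (simp_all add: simps)
  show "scl lie c (scl lie d x) = scl lie (c * d) x" using x by (intro eqI) (simp_all add: simps)
  show "scl lie (c + d) x = add lie (scl lie c x) (scl lie d x)"
    using x by (intro eqI) (simp_all add: simps)
  show "mul lie x x = zer lie" using x by (intro eqI) (simp_all add: simps)
  assume y: "y \<in> Carr lie"
  show "add lie x y \<in> Carr lie" "mul lie x y \<in> Carr lie" using x y by (simp_all add: simps)
  show "add lie x y = add lie y x" using x y by (intro eqI) (simp_all add: simps)
  show "scl lie c (add lie x y) = add lie (scl lie c x) (scl lie c y)"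
    using x y by (intro eqI) (simp_all add: simps)
  show "mul lie (scl lie c x) y = scl lie c (mul lie x y)"
    "mul lie x (scl lie c y) = scl lie c (mul lie x y)"
    using x y by (auto intro!: eqI simp: simps)
  assume z: "z \<in> Carr lie"
  show "add lie (add lie x y) z = add lie x (add lie y z)"
    using x y z by (intro eqI) (simp_all add: simps)
  show "mul lie (add lie x y) z = add lie (mul lie x z) (mul lie y z)"
    "mul lie x (add lie y z) = add lie (mul lie x y) (mul lie x z)"
    using x y z by (auto intro!: eqI simp: simps)
  show "add lie (add lie (mul lie x (mul lie y z)) (mul lie y (mul lie z x))) (mul lie z (mul lie x y)) = zer lie"
    using x y z by (intro eqI) (simp_all add: simps)
qed

lemma lie_alg_subspace_iff: "alg_subspace lie W \<longleftrightarrow> W \<subseteq> commutator_space R \<and> alg_subspace R W"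
  using commutator_space_Carr by (auto simp: alg_subspace_def lie_simps)

lemma lie_ideal_iff: "lie_ideal lie J \<longleftrightarrow> J \<subseteq> commutator_space R \<and> lie_ideal_in (comm_span img) (h ` J)"
proof -
  have comm: "(\<forall>x\<in>commutator_space R. \<forall>y\<in>J. commutator R x y \<in> J)
      \<longleftrightarrow> (\<forall>x\<in>comm_span img. \<forall>u\<in>h ` J. x * u - u * x \<in> h ` J)" if J: "J \<subseteq> commutator_space R"
  proof -
    have JR: "J \<subseteq> Carr R" using J commutator_space_Carr by auto
    have "commutator R x y \<in> J \<longleftrightarrow> h x * h y - h y * h x \<in> h ` J"
      if "x \<in> commutator_space R" "y \<in> J" for x y
    proof -
      have xy: "x \<in> Carr R" "y \<in> Carr R" using that JR commutator_space_Carr by auto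
      have "commutator R x y \<in> J \<longleftrightarrow> h (commutator R x y) \<in> h ` J"
        using inj_on_image_mem_iff [OF inj commutator_R(1) [OF xy] JR] by simp
      then show ?thesis by (simp add: commutator_R xy)
    qed
    then show ?thesis by (simp flip: image_commutator_space)
  qed
  have "subspace (h ` J) \<and> h ` J \<subseteq> comm_span img \<longleftrightarrow> alg_subspace lie J" if J: "J \<subseteq> commutator_space R"
    using J commutator_space_Carr
    by (auto simp: lie_alg_subspace_iff alg_subspace_iff simp flip: image_commutator_space)
  then show ?thesis
    unfolding lie_ideal_def lie_ideal_in_def lie_simps using comm lie_alg_subspace_iff by metis
qed

lemma simple_lie_algebra_if:
  assumes noncomm: "\<exists>x\<in>comm_span img. \<exists>y\<in>comm_span img. x * y - y * x \<noteq> 0"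
    and ideals: "\<And>U. lie_ideal_in (comm_span img) U \<Longrightarrow> U = {0} \<or> U = comm_span img"
  shows "simple_lie_algebra lie"
  unfolding simple_lie_algebra_def lie_simps
proof (intro conjI allI impI)
  obtain x y where xy: "x \<in> commutator_space R" "y \<in> commutator_space R" "h x * h y - h y * h x \<noteq> 0"
    using noncomm by (auto simp flip: image_commutator_space)
  have "commutator R x y \<in> lie_derived lie"
    unfolding lie_derived_def alg_span_def lie_simps using xy by blast
  moreover have "commutator R x y \<noteq> zer R"
    using xy(3) commutator_R(2) [of x y] xy(1,2) by (auto simp: commutator_space_Carr zer_R)
  ultimately show "lie_derived lie \<noteq> {zer R}" by auto
  fix J assume "lie_ideal lie J"
  then have J: "J \<subseteq> commutator_space R" "lie_ideal_in (comm_span img) (h ` J)"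
    by (auto simp: lie_ideal_iff)
  have JR: "J \<subseteq> Carr R" "commutator_space R \<subseteq> Carr R" using J(1) commutator_space_Carr by auto
  have "h ` J = h ` {zer R} \<or> h ` J = h ` commutator_space R"
    using ideals [OF J(2)] by (simp add: image_commutator_space zer_R)
  then show "J = {zer R} \<or> J = commutator_space R"
    using inj_on_image_eq_iff [OF inj] JR zer_R(1) by (metis empty_subsetI insert_subset)
qed (rule lie_algebra_lie)

lemma simple_lie_algebra_ideal:
  assumes simple: "simple_lie_algebra lie" and U: "lie_ideal_in (comm_span img) U"
  shows "U = {0} \<or> U = comm_span img"
proof -
  let ?J = "{x \<in> Carr R. h x \<in> U}"
  have sub: "U \<subseteq> comm_span img" using U by (simp add: lie_ideal_in_def)
  then have hJ: "h ` ?J = U" using comm_span_subset by (intro image_vimage) auto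
  have "?J \<subseteq> commutator_space R" using sub by (auto simp: commutator_space_eq)
  then have "lie_ideal lie ?J" using U by (simp add: lie_ideal_iff hJ)
  then have "?J = {zer R} \<or> ?J = commutator_space R"
    using simple by (auto simp: simple_lie_algebra_def lie_simps)
  then have "h ` ?J = h ` {zer R} \<or> h ` ?J = h ` commutator_space R" by metis
  then show ?thesis by (simp only: hJ image_commutator_space) (simp add: zer_R)
qed

text \<open>
  The zero algebra arises from the empty graph, which is aperiodic and cofinal.
\<close>

lemma not_simple_if_zero:
  assumes "img = {0}"
  shows "\<not> simple_lie_algebra lie"
proof
  assume "simple_lie_algebra lie"
  then have ne: "lie_derived lie \<noteq> {zer R}" by (simp add: simple_lie_algebra_def lie_simps)
  have "x = zer R" if "x \<in> Carr R" for x
  proof -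
    have "h x = h (zer R)" using that assms by (auto simp: img_def zer_R)
    then show ?thesis using that zer_R(1) by (simp add: h_eq_iff)
  qed
  then have Carr: "Carr R = {zer R}" using zer_R(1) by blast
  have "alg_subspace lie {zer R}"
    unfolding lie_alg_subspace_iff unfolding alg_subspace_def
    using Carr add_R(1) scl_R(1) commutator_space_closed(1) by auto
  moreover have "commutator R x y \<in> {zer R}" if "x \<in> Carr R" "y \<in> Carr R" for x y
    using commutator_R(1) [OF that] Carr by simp
  ultimately have "lie_derived lie \<subseteq> {zer R}"
    unfolding lie_derived_def alg_span_def lie_simps
    using commutator_space_Carr by (intro Inter_lower) auto
  moreover have "zer R \<in> lie_derived lie"
    unfolding lie_derived_def alg_span_def by (auto simp: alg_subspace_def lie_simps)
  ultimately show False using ne by auto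
qed

lemma alg_one_in_commutator_space:
  assumes e: "e \<in> img" and unit: "\<And>x. x \<in> img \<Longrightarrow> e * x = x \<and> x * e = x"
  shows "alg_one R \<in> commutator_space R \<longleftrightarrow> e \<in> comm_span img"
proof -
  obtain u where u: "u \<in> Carr R" "h u = e" using e by (auto simp: img_def)
  have "is_identity R u"
    unfolding is_identity_def
  proof (intro conjI ballI u(1))
    fix x assume x: "x \<in> Carr R"
    then have "h (mul R u x) = h x" "h (mul R x u) = h x"
      using u unit [of "h x"] by (auto simp: mul_R img_def)
    then show "mul R u x = x" "mul R x u = x"
      using x u(1) h_eq_iff mul_R(1) by metis+
  qed
  moreover have "u' = u" if "is_identity R u'" for u'
    using that \<open>is_identity R u\<close> unfolding is_identity_def by metis
  ultimately have "alg_one R = u"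
    unfolding alg_one_def by (rule the_equality)
  then show ?thesis using u by (simp add: commutator_space_eq)
qed

end

lemma coset_free_algebra: "coset (free_algebra X) I p = (+) p ` I"
  by (simp add: coset_def free_algebra_def)

text \<open>
  A map \<open>T\<close> with kernel \<open>I\<close> is constant on cosets, so \<open>h\<close> may evaluate it at any representative.
\<close>

lemma quotient_algebra_embedding:
  fixes T :: "('x fword \<Rightarrow>\<^sub>0 'f::field) \<Rightarrow> ('x fword, 'f) lin_endo"
  assumes I: "two_sided_ideal (free_algebra X) I"
    and T_add: "\<And>p q. T (p + q) = T p + T q"
    and T_scale: "\<And>c p. T (Poly_Mapping.map ((*) c) p) = endo_scale c (T p)"
    and T_mult: "\<And>p q. \<lbrakk>p \<in> free_carrier X; q \<in> free_carrier X\<rbrakk> \<Longrightarrow> T (p * q) = T p * T q"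
    and T_zero: "\<And>p. p \<in> free_carrier X \<Longrightarrow> T p = 0 \<longleftrightarrow> p \<in> I"
  defines "h \<equiv> \<lambda>X. T (SOME x. x \<in> X)"
  shows "algebra_embedding endo_scale (quotient_algebra (free_algebra X) I) h"
    and "h ` Carr (quotient_algebra (free_algebra X) I) = T ` free_carrier X"
proof -
  let ?F = "free_carrier X :: ('x fword \<Rightarrow>\<^sub>0 'f) set" and ?c = "\<lambda>p. (+) p ` I"
  let ?R = "quotient_algebra (free_algebra X) I"
  have I_F: "I \<subseteq> ?F" and I0: "0 \<in> I"
    and I_add: "\<And>x y. \<lbrakk>x \<in> I; y \<in> I\<rbrakk> \<Longrightarrow> x + y \<in> I"
    using I by (auto simp: two_sided_ideal_free_algebra poly_mapping_space.subspace_def)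
  have F0: "0 \<in> ?F" and F_add: "\<And>p q. \<lbrakk>p \<in> ?F; q \<in> ?F\<rbrakk> \<Longrightarrow> p + q \<in> ?F"
    and F_scale: "\<And>c p. p \<in> ?F \<Longrightarrow> Poly_Mapping.map ((*) c) p \<in> ?F"
    using subspace_free_carrier [of X] by (auto simp: poly_mapping_space.subspace_def)
  have F_diff: "p - q \<in> ?F" if "p \<in> ?F" "q \<in> ?F" for p q
    using poly_mapping_space.subspace_diff [OF subspace_free_carrier that] .
  have F_mult: "p * q \<in> ?F" if "p \<in> ?F" "q \<in> ?F" for p q
    using that by (intro free_carrier_mult) (auto simp: mem_free_carrier)
  have T_diff: "T (p - q) = T p - T q" for p q
    using T_add [of "p - q" q] by simp
  have T0: "T 0 = 0" using T_zero F0 I0 by blast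
  have mem: "x \<in> ?F \<and> T x = T p" if "p \<in> ?F" "x \<in> ?c p" for p x
    using that I_F T_zero F_add by (auto simp: T_add)
  have self: "p \<in> ?c p" for p using I0 by (auto simp: image_iff intro: bexI [of _ 0])
  have c_eq: "?c p = ?c q" if pq: "p \<in> ?F" "q \<in> ?F" "T p = T q" for p q
  proof -
    have *: "?c p \<subseteq> ?c q" if "p \<in> ?F" "q \<in> ?F" "T p = T q" for p q
    proof clarify
      fix i assume "i \<in> I"
      moreover have "p - q \<in> I" using that T_zero [OF F_diff] by (simp add: T_diff)
      ultimately have "(p - q) + i \<in> I" by (intro I_add)
      then have "q + ((p - q) + i) \<in> ?c q" by (rule imageI)
      then show "p + i \<in> ?c q" by simp
    qed
    show ?thesis using * [of p q] * [of q p] pq by auto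
  qed
  have h: "h (?c p) = T p" if "p \<in> ?F" for p
    unfolding h_def by (rule conjunct2 [OF mem [OF that]]) (rule someI [of _ p], rule self)
  have Carr: "Carr ?R = ?c ` ?F" and zer: "zer ?R = ?c 0"
    by (auto simp: quotient_algebra_def coset_free_algebra) (simp_all add: free_algebra_def)
  have add: "add ?R (?c p) (?c q) = ?c (p + q)" if "p \<in> ?F" "q \<in> ?F" for p q
  proof -
    have "add ?R (?c p) (?c q) = (\<Union>x\<in>?c p. \<Union>y\<in>?c q. ?c (x + y))"
      by (simp add: quotient_algebra_def coset_free_algebra) (simp add: free_algebra_def)
    also have "\<dots> = (\<Union>x\<in>?c p. \<Union>y\<in>?c q. ?c (p + q))"
      by (intro SUP_cong refl c_eq F_add) (use mem that in \<open>auto simp: T_add\<close>)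
    finally show ?thesis using self by auto
  qed
  have mul: "mul ?R (?c p) (?c q) = ?c (p * q)" if "p \<in> ?F" "q \<in> ?F" for p q
  proof -
    have "mul ?R (?c p) (?c q) = (\<Union>x\<in>?c p. \<Union>y\<in>?c q. ?c (x * y))"
      by (simp add: quotient_algebra_def coset_free_algebra) (simp add: free_algebra_def)
    also have "\<dots> = (\<Union>x\<in>?c p. \<Union>y\<in>?c q. ?c (p * q))"
    proof (intro SUP_cong refl c_eq F_mult)
      fix x y assume xy: "x \<in> ?c p" "y \<in> ?c q"
      show "x \<in> ?F" "y \<in> ?F" "p \<in> ?F" "q \<in> ?F" using mem xy that by blast+
      then show "T (x * y) = T (p * q)" using mem [OF that(1) xy(1)] mem [OF that(2) xy(2)] by (simp add: T_mult)
    qed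
    finally show ?thesis using self by auto
  qed
  have scl: "scl ?R c (?c p) = ?c (Poly_Mapping.map ((*) c) p)" if "p \<in> ?F" for c p
  proof -
    have "scl ?R c (?c p) = (\<Union>x\<in>?c p. ?c (Poly_Mapping.map ((*) c) x))"
      by (simp add: quotient_algebra_def coset_free_algebra) (simp add: free_algebra_def)
    also have "\<dots> = (\<Union>x\<in>?c p. ?c (Poly_Mapping.map ((*) c) p))"
      by (intro SUP_cong refl c_eq F_scale) (use mem that in \<open>auto simp: T_scale\<close>)
    finally show ?thesis using self by auto
  qed
  show "h ` Carr ?R = T ` ?F"
    unfolding Carr image_image by (intro image_cong refl h)
  show "algebra_embedding endo_scale ?R h"
  proof unfold_locales
    show "inj_on h (Carr ?R)"
    proof (rule inj_onI)
      fix x y assume "x \<in> Carr ?R" "y \<in> Carr ?R" and eq: "h x = h y"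
      then obtain p q where pq: "p \<in> ?F" "q \<in> ?F" "x = ?c p" "y = ?c q" unfolding Carr by blast
      then have "T p = T q" using eq h by simp
      then show "x = y" unfolding pq(3,4) by (rule c_eq [OF pq(1,2)])
    qed
    show "zer ?R \<in> Carr ?R"
      unfolding Carr zer using F0 by (rule imageI)
    show "h (zer ?R) = 0"
      by (simp only: zer h [OF F0] T0)
    fix x y c assume x: "x \<in> Carr ?R"
    then obtain p where p: "p \<in> ?F" "x = ?c p" by (auto simp: Carr)
    show "scl ?R c x \<in> Carr ?R" "h (scl ?R c x) = endo_scale c (h x)"
      using p by (auto simp: scl Carr h F_scale T_scale)
    assume "y \<in> Carr ?R"
    then obtain q where q: "q \<in> ?F" "y = ?c q" by (auto simp: Carr)
    show "add ?R x y \<in> Carr ?R" "h (add ?R x y) = h x + h y"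
      using p q by (auto simp: add Carr h F_add T_add)
    show "mul ?R x y \<in> Carr ?R" "h (mul ?R x y) = h x * h y"
      using p q by (auto simp: mul Carr h F_mult T_mult)
  qed
qed

section \<open>Simplicity of the Lie algebra of commutators\<close>

lemma ideal_generated_free_algebra:
  assumes "S \<subseteq> free_carrier X"
  shows "two_sided_ideal (free_algebra X) (ideal_generated (free_algebra X) S)"
    and "S \<subseteq> ideal_generated (free_algebra X) S"
proof -
  have "two_sided_ideal (free_algebra X) (free_carrier X)"
    unfolding two_sided_ideal_free_algebra
    by (auto simp: subspace_free_carrier intro!: free_carrier_mult) (auto simp: mem_free_carrier)
  then show "two_sided_ideal (free_algebra X) (ideal_generated (free_algebra X) S)"
    unfolding ideal_generated_def two_sided_ideal_free_algebra using assms
    by (auto intro!: poly_mapping_space.subspace_Inter simp: subset_iff)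
qed (auto simp: ideal_generated_def)

context k_graph
begin

abbreviation kp_free :: "('l kp_letter fword \<Rightarrow>\<^sub>0 'f::field) set" where
  "kp_free \<equiv> free_carrier (kp_generators \<Lambda>)"

abbreviation kp_ideal :: "('l kp_letter fword \<Rightarrow>\<^sub>0 'f::field) set" where
  "kp_ideal \<equiv> ideal_generated (free_algebra (kp_generators \<Lambda>)) (kp_relations \<Lambda>)"

lemma path_gen_free: "\<kappa> \<in> Mor \<Lambda> \<Longrightarrow> path_gen \<kappa> \<in> kp_free"
  by (simp add: mem_free_carrier path_gen_def free_gen_def kp_generators_def)

lemma ghost_gen_free: "\<kappa> \<in> Mor \<Lambda> \<Longrightarrow> ghost_gen \<Lambda> \<kappa> \<in> kp_free"
  by (auto simp: mem_free_carrier ghost_gen_def free_gen_def kp_generators_def)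

lemma kp_free_mult: "\<lbrakk>p \<in> kp_free; q \<in> kp_free\<rbrakk> \<Longrightarrow> p * q \<in> kp_free"
  by (rule free_carrier_mult) (auto simp: mem_free_carrier)

lemma kp_relations_free: "kp_relations \<Lambda> \<subseteq> kp_free"
proof -
  note intros = poly_mapping_space.subspace_diff [OF subspace_free_carrier]
    poly_mapping_space.subspace_0 [OF subspace_free_carrier]
    poly_mapping_space.subspace_sum [OF subspace_free_carrier]
    kp_free_mult path_gen_free ghost_gen_free cmp_Mor Obj_Mor [OF src_Obj]
  have "kp1 \<Lambda> \<subseteq> kp_free" by (auto simp: kp1_def intro!: intros intro: Obj_Mor)
  moreover have "kp2 \<Lambda> \<subseteq> kp_free" by (auto simp: kp2_def intro!: intros)
  moreover have "kp3 \<Lambda> \<subseteq> kp_free" by (auto simp: kp3_def intro!: intros)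
  moreover have "kp4 \<Lambda> \<subseteq> kp_free"
    by (auto simp: kp4_def paths_from_def intro!: intros intro: Obj_Mor)
  ultimately show ?thesis by (auto simp: kp_relations_def)
qed

lemma free_op_kp_ideal:
  fixes p :: "'l kp_letter fword \<Rightarrow>\<^sub>0 'f::field"
  assumes rf: "row_finite \<Lambda>" and p: "p \<in> kp_ideal"
  shows "free_op \<Lambda> p g f = 0"
proof -
  let ?N = "{p :: 'l kp_letter fword \<Rightarrow>\<^sub>0 'f. p \<in> kp_free \<and> (\<forall>g f. free_op \<Lambda> p g f = 0)}"
  have scale: "free_op \<Lambda> (Poly_Mapping.map ((*) c) p) g f = 0" if "\<forall>g f. free_op \<Lambda> p g f = 0"
    for c :: 'f and p g f
    using that by (simp add: map_mult_times(3) [symmetric] free_op_mult free_op_single fun_eq_iff)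
  have zero: "free_op \<Lambda> p (\<lambda>_. 0) = (\<lambda>_. 0)" for p :: "'l kp_letter fword \<Rightarrow>\<^sub>0 'f"
    using free_op_mult [of p 0] by (simp add: free_op_zero)
  have "two_sided_ideal (free_algebra (kp_generators \<Lambda>)) ?N"
    unfolding two_sided_ideal_free_algebra
  proof (intro conjI ballI)
    show "poly_mapping_space.subspace ?N"
      using scale subspace_free_carrier [of "kp_generators \<Lambda>"]
      by (auto simp: poly_mapping_space.subspace_def free_op_zero free_op_add)
    fix a i :: "'l kp_letter fword \<Rightarrow>\<^sub>0 'f" assume a: "a \<in> kp_free" and i: "i \<in> ?N"
    then have "free_op \<Lambda> i g = (\<lambda>_. 0)" for g by (simp add: fun_eq_iff)
    then show "a * i \<in> ?N" "i * a \<in> ?N"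
      using a i by (auto simp: kp_free_mult free_op_mult zero)
  qed auto
  moreover have "kp_relations \<Lambda> \<subseteq> ?N"
    using kp_relations_free free_op_kp_relations [OF rf] by auto
  ultimately have "kp_ideal \<subseteq> ?N"
    unfolding ideal_generated_def by (intro Inter_lower) auto
  then show ?thesis using p by auto
qed

text \<open>
  The ideal acts by zero on functions of infinite paths, whereas \<open>v\<close> fixes the value of the constant
  function \<open>1\<close> at an infinite path with range \<open>v\<close>.
\<close>

lemma vertex_not_in_kp_ideal:
  assumes rf: "row_finite \<Lambda>" and aperiodic: "aperiodic_graph \<Lambda>" and v: "v \<in> Obj \<Lambda>"
  shows "path_gen v \<notin> (kp_ideal :: ('l kp_letter fword \<Rightarrow>\<^sub>0 'f::field) set)"
proof
  assume "path_gen v \<in> (kp_ideal :: ('l kp_letter fword \<Rightarrow>\<^sub>0 'f) set)"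
  then have 0: "free_op \<Lambda> (path_gen v) g f = (0 :: 'f)" for g f
    by (rule free_op_kp_ideal [OF rf])
  obtain x where x: "x \<in> infinite_paths \<Lambda>" "x (0, 0) = v"
    using aperiodic v unfolding aperiodic_graph_def by (auto simp: cylinder_def deg_id)
  have "free_op \<Lambda> (path_gen v) (\<lambda>_. 1) (\<lambda>n. x (0, n)) = (1 :: 'f)"
    using coherent_initial_segments [OF x(1)] x(2) by (simp add: free_op_path_gen vertex_op v)
  then show False using 0 by simp
qed

text \<open>
  The images of the generators satisfy the relations by construction. Their products \<open>\<mu> \<nu>\<^sup>*\<close> span
  the image of the algebra, because the span contains all letters and is closed under
  multiplication.
\<close>

lemma kumjian_pask_embedding:
  assumes rf: "row_finite \<Lambda>" and ns: "no_sources \<Lambda>" and aperiodic: "aperiodic_graph \<Lambda>"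
  obtains P Q :: "'l \<Rightarrow> ('l kp_letter fword, 'f::field) lin_endo" and h
  where "kp_family \<Lambda> endo_scale P Q"
    and "algebra_embedding endo_scale (kumjian_pask TYPE('f) \<Lambda>) h"
    and "algebra_embedding.img (kumjian_pask TYPE('f) \<Lambda>) h = kp_family.kp_span \<Lambda> endo_scale P Q"
proof -
  note I = ideal_generated_free_algebra [OF kp_relations_free]
  obtain T :: "('l kp_letter fword \<Rightarrow>\<^sub>0 'f) \<Rightarrow> ('l kp_letter fword, 'f) lin_endo"
    where T_add: "\<And>p q. T (p + q) = T p + T q"
      and T_scale: "\<And>c p. T (Poly_Mapping.map ((*) c) p) = endo_scale c (T p)"
      and T_mult: "\<And>p q. \<lbrakk>p \<in> kp_free; q \<in> kp_free\<rbrakk> \<Longrightarrow> T (p * q) = T p * T q"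
      and T_zero: "\<And>p. p \<in> kp_free \<Longrightarrow> T p = 0 \<longleftrightarrow> p \<in> kp_ideal"
    by (rule quotient_embedding [OF I(1)]) (rule that)
  have T_diff: "T (p - q) = T p - T q" for p q
    using T_add [of "p - q" q] by simp
  have T0: "T 0 = 0" using T_add [of 0 0] by simp
  have T_sum: "T (\<Sum>i\<in>S. p i) = (\<Sum>i\<in>S. T (p i))" for S and p :: "'l \<Rightarrow> _"
    by (induction S rule: infinite_finite_induct) (auto simp: T0 T_add)
  have rel: "T p = T q" if "p - q \<in> kp_relations \<Lambda>" for p q
  proof -
    have "T (p - q) = 0" using T_zero [of "p - q"] that I(2) kp_relations_free by blast
    then show ?thesis by (simp add: T_diff)
  qed
  define P where "P \<kappa> = T (path_gen \<kappa>)" for \<kappa>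
  define Q where "Q \<kappa> = T (ghost_gen \<Lambda> \<kappa>)" for \<kappa>
  note gens = path_gen_free ghost_gen_free Obj_Mor cmp_Mor src_Obj
  have "kp_family \<Lambda> endo_scale P Q"
  proof (unfold_locales, rule ns)
    show "P v * P w = (if v = w then P w else 0)" if "v \<in> Obj \<Lambda>" "w \<in> Obj \<Lambda>" for v w
    proof -
      have "path_gen v * path_gen w - (if v = w then path_gen w else 0) \<in> kp_relations \<Lambda>"
        using that unfolding kp_relations_def kp1_def by blast
      from rel [OF this] show ?thesis
        using that by (simp add: T_mult gens T0 P_def split: if_splits)
    qed
    show "P \<kappa> * P \<mu> = P (cmp \<Lambda> \<kappa> \<mu>)" "Q \<mu> * Q \<kappa> = Q (cmp \<Lambda> \<kappa> \<mu>)"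
      if "\<kappa> \<in> Mor \<Lambda>" "\<mu> \<in> Mor \<Lambda>" "rng \<Lambda> \<mu> = src \<Lambda> \<kappa>" for \<kappa> \<mu>
    proof -
      have "path_gen \<kappa> * path_gen \<mu> - path_gen (cmp \<Lambda> \<kappa> \<mu>) \<in> kp_relations \<Lambda>"
        "ghost_gen \<Lambda> \<mu> * ghost_gen \<Lambda> \<kappa> - ghost_gen \<Lambda> (cmp \<Lambda> \<kappa> \<mu>) \<in> kp_relations \<Lambda>"
        using that unfolding kp_relations_def kp2_def by blast+
      from this [THEN rel] show "P \<kappa> * P \<mu> = P (cmp \<Lambda> \<kappa> \<mu>)" "Q \<mu> * Q \<kappa> = Q (cmp \<Lambda> \<kappa> \<mu>)"
        using that by (simp_all add: T_mult gens P_def Q_def)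
    qed
    show "Q \<kappa> * P \<mu> = (if \<kappa> = \<mu> then P (src \<Lambda> \<kappa>) else 0)"
      if "\<kappa> \<in> Mor \<Lambda>" "\<mu> \<in> Mor \<Lambda>" "deg \<Lambda> \<kappa> = deg \<Lambda> \<mu>" for \<kappa> \<mu>
    proof -
      have "ghost_gen \<Lambda> \<kappa> * path_gen \<mu> - (if \<kappa> = \<mu> then path_gen (src \<Lambda> \<kappa>) else 0) \<in> kp_relations \<Lambda>"
        using that unfolding kp_relations_def kp3_def by blast
      from rel [OF this] show ?thesis
        using that by (simp add: T_mult gens T0 P_def Q_def split: if_splits)
    qed
    show "P v = (\<Sum>\<kappa>\<in>paths_from \<Lambda> v n. P \<kappa> * Q \<kappa>)" if "v \<in> Obj \<Lambda>" "n \<noteq> 0" for v n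
    proof -
      have "path_gen v - (\<Sum>\<kappa>\<in>paths_from \<Lambda> v n. path_gen \<kappa> * ghost_gen \<Lambda> \<kappa>) \<in> kp_relations \<Lambda>"
        using that unfolding kp_relations_def kp4_def by blast
      from rel [OF this] show ?thesis
        by (auto simp: T_mult gens T_sum P_def Q_def paths_from_def intro!: sum.cong)
    qed
    show "Q v = P v" if "v \<in> Obj \<Lambda>" for v
      using that by (simp add: P_def Q_def path_gen_def ghost_gen_def)
    show "P v \<noteq> 0" if "v \<in> Obj \<Lambda>" for v
      using that T_zero [OF path_gen_free [OF Obj_Mor [OF that]]] vertex_not_in_kp_ideal [OF rf aperiodic that]
      by (simp add: P_def)
  qed
  then interpret kp_family \<Lambda> endo_scale P Q .
  note emb = quotient_algebra_embedding [OF I(1) T_add T_scale T_mult T_zero]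
  let ?h = "\<lambda>X. T (SOME x. x \<in> X)"
  interpret E: algebra_embedding endo_scale "kumjian_pask TYPE('f) \<Lambda>" ?h
    using emb(1) by (simp add: kumjian_pask_def)
  have "?h ` Carr (kumjian_pask TYPE('f) \<Lambda>) = T ` kp_free"
    using emb(2) by (simp add: kumjian_pask_def)
  then have img: "E.img = T ` kp_free"
    by (simp add: E.img_def)
  also have "\<dots> = kp_span"
  proof
    have letter: "T (Poly_Mapping.single (Word [x]) 1) \<in> kp_span" if x: "x \<in> kp_generators \<Lambda>" for x
    proof -
      have "P \<kappa> = T (Poly_Mapping.single (Word [Path \<kappa>]) 1)" for \<kappa>
        by (simp add: P_def path_gen_def free_gen_def)
      moreover have "Q \<kappa> = T (Poly_Mapping.single (Word [Ghost \<kappa>]) 1)" if "\<kappa> \<notin> Obj \<Lambda>" for \<kappa>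
        using that by (simp add: Q_def ghost_gen_def free_gen_def)
      moreover consider \<kappa> where "\<kappa> \<in> Mor \<Lambda>" "x = Path \<kappa>"
        | \<kappa> where "\<kappa> \<in> Mor \<Lambda>" "\<kappa> \<notin> Obj \<Lambda>" "x = Ghost \<kappa>"
        using x by (auto simp: kp_generators_def)
      ultimately show ?thesis
        using P_in_kp_span Q_in_kp_span by cases metis+
    qed
    have word: "T (Poly_Mapping.single (Word xs) 1) \<in> kp_span" if "xs \<noteq> []" "set xs \<subseteq> kp_generators \<Lambda>" for xs
      using that
    proof (induction xs rule: list_nonempty_induct)
      case (single x)
      then show ?case by (simp add: letter)
    next
      case (cons x xs)
      have "Poly_Mapping.single (Word (x # xs)) 1 = Poly_Mapping.single (Word [x]) (1::'f) * Poly_Mapping.single (Word xs) 1"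
        by (simp add: mult_single plus_fword_def)
      moreover have "Poly_Mapping.single (Word [x]) (1::'f) \<in> kp_free" "Poly_Mapping.single (Word xs) (1::'f) \<in> kp_free"
        using cons by (auto simp: mem_free_carrier)
      ultimately show ?case using cons letter [of x] by (simp add: T_mult kp_span_mult)
    qed
    show "T ` kp_free \<subseteq> kp_span"
    proof clarify
      fix p :: "'l kp_letter fword \<Rightarrow>\<^sub>0 'f" assume p: "p \<in> kp_free"
      have "T (Poly_Mapping.single w c) \<in> kp_span" if "w \<in> Poly_Mapping.keys p" for w c
      proof -
        have "T (Poly_Mapping.single w 1) \<in> kp_span"
          using word [of "letters w"] that p by (simp add: mem_free_carrier)
        then have "endo_scale c (T (Poly_Mapping.single w 1)) \<in> kp_span" by (rule scale_A)
        then show ?thesis by (simp add: T_scale [symmetric] map_mult_single)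
      qed
      then have "(\<Sum>w\<in>Poly_Mapping.keys p. T (Poly_Mapping.single w (Poly_Mapping.lookup p w))) \<in> kp_span"
        by (intro lin_endo.subspace_sum subspace_A)
      moreover have "T p = (\<Sum>w\<in>Poly_Mapping.keys p. T (Poly_Mapping.single w (Poly_Mapping.lookup p w)))"
      proof -
        have "T (\<Sum>i\<in>S. q i) = (\<Sum>i\<in>S. T (q i))" for S and q :: "'l kp_letter fword \<Rightarrow> _"
          by (induction S rule: infinite_finite_induct) (auto simp: T0 T_add)
        then show ?thesis using poly_mapping_eq_sum_single [of p] by metis
      qed
      ultimately show "T p \<in> kp_span" by simp
    qed
    show "kp_span \<subseteq> T ` kp_free"
      unfolding kp_span_def
    proof (rule lin_endo.span_minimal)
      show "lin_endo.subspace (T ` kp_free)"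
        using E.subspace_img img by simp
      have "P \<mu> * Q \<nu> = T (path_gen \<mu> * ghost_gen \<Lambda> \<nu>)" if "\<mu> \<in> Mor \<Lambda>" "\<nu> \<in> Mor \<Lambda>" for \<mu> \<nu>
        using that by (simp add: T_mult gens P_def Q_def)
      then show "{P \<mu> * Q \<nu> | \<mu> \<nu>. \<mu> \<in> Mor \<Lambda> \<and> \<nu> \<in> Mor \<Lambda>} \<subseteq> T ` kp_free"
        using kp_free_mult path_gen_free ghost_gen_free by blast
    qed
  qed
  finally show thesis
    using that [of P Q ?h] kp_family_axioms E.algebra_embedding_axioms by blast
qed

end

theorem theorem4p4:
  fixes \<Lambda> :: "('l, 'k::finite) kgraph"
  assumes "k_graph \<Lambda>"
    and "row_finite \<Lambda>"
    and "no_sources \<Lambda>"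
  shows "(aperiodic_graph \<Lambda> \<and> cofinal_graph \<Lambda> \<and> infinite (Obj \<Lambda>)
           \<longrightarrow> simple_lie_algebra (commutator_lie_algebra (kumjian_pask TYPE('f::field) \<Lambda>)))
       \<and> (aperiodic_graph \<Lambda> \<and> cofinal_graph \<Lambda> \<and> finite (Obj \<Lambda>)
           \<and> \<not> isomorphic (kumjian_pask TYPE('f) \<Lambda>) (field_algebra :: ('f, 'f) kalg)
           \<longrightarrow> (simple_lie_algebra (commutator_lie_algebra (kumjian_pask TYPE('f) \<Lambda>))
                \<longleftrightarrow> alg_one (kumjian_pask TYPE('f) \<Lambda>) \<notin> commutator_space (kumjian_pask TYPE('f) \<Lambda>)))"
proof -
  let ?R = "kumjian_pask TYPE('f) \<Lambda>"
  interpret k_graph \<Lambda> by (rule assms)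
  have main: "(infinite (Obj \<Lambda>) \<longrightarrow> simple_lie_algebra (commutator_lie_algebra ?R))
      \<and> (finite (Obj \<Lambda>) \<longrightarrow> (simple_lie_algebra (commutator_lie_algebra ?R)
           \<longleftrightarrow> alg_one ?R \<notin> commutator_space ?R))"
    if aperiodic: "aperiodic_graph \<Lambda>" and cofinal: "cofinal_graph \<Lambda>"
  proof -
    obtain P Q :: "'l \<Rightarrow> ('l kp_letter fword, 'f) lin_endo" and h
      where fam: "kp_family \<Lambda> endo_scale P Q" and emb: "algebra_embedding endo_scale ?R h"
        and img: "algebra_embedding.img ?R h = kp_family.kp_span \<Lambda> endo_scale P Q"
      by (rule kumjian_pask_embedding [OF assms(2,3) aperiodic])
    interpret kp_family \<Lambda> endo_scale P Q by (rule fam)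
    interpret E: algebra_embedding endo_scale ?R h by (rule emb)
    note img = img [simp]
    let ?L = "lin_endo.comm_span kp_span" and ?one = "\<Sum>v\<in>Obj \<Lambda>. P v"
    have simple: "simple_lie_algebra (commutator_lie_algebra ?R)"
      if ne: "Obj \<Lambda> \<noteq> {}"
        and central: "\<And>z. \<lbrakk>z \<in> ?L; \<And>r. r \<in> kp_span \<Longrightarrow> z * r = r * z\<rbrakk> \<Longrightarrow> z = 0"
    proof (rule E.simple_lie_algebra_if)
      show "\<exists>x\<in>lin_endo.comm_span E.img. \<exists>y\<in>lin_endo.comm_span E.img. x * y - y * x \<noteq> 0"
        using kp_comm_span_noncommutative [OF aperiodic cofinal ne] by simp
      fix U assume "lin_endo.lie_ideal_in (lin_endo.comm_span E.img) U"
      then have U: "lin_endo.lie_ideal_in ?L U" by simp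
      then have "0 \<in> U" "U \<subseteq> ?L" by (auto simp: lin_endo.lie_ideal_in_def lin_endo.subspace_0)
      then show "U = {0} \<or> U = lin_endo.comm_span E.img"
        using kp_lie_ideal [OF aperiodic cofinal ne U] central by auto
    qed
    have L_sub: "?L \<subseteq> kp_span" by (rule comm_span_subset)
    have inf: "simple_lie_algebra (commutator_lie_algebra ?R)" if inf: "infinite (Obj \<Lambda>)"
      using inf L_sub central_eq_zero_if_infinite [OF aperiodic cofinal inf]
      by (intro simple) auto
    have fin: "simple_lie_algebra (commutator_lie_algebra ?R) \<longleftrightarrow> alg_one ?R \<notin> commutator_space ?R"
      if fin: "finite (Obj \<Lambda>)"
    proof -
      have unit: "?one * x = x \<and> x * ?one = x" if "x \<in> kp_span" for x
        using local_unit [OF that] fin by auto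
      have one: "alg_one ?R \<in> commutator_space ?R \<longleftrightarrow> ?one \<in> ?L"
        using E.alg_one_in_commutator_space [of ?one] one_in_kp_span unit by simp
      show ?thesis
      proof (cases "Obj \<Lambda> = {}")
        case True
        \<comment> \<open>The algebra is zero, and its identity \<open>0\<close> is a commutator.\<close>
        then have "Mor \<Lambda> = {}" using src_Obj by auto
        then have "E.img = {0}" by (simp add: kp_span_def)
        then have "\<not> simple_lie_algebra (commutator_lie_algebra ?R)" by (rule E.not_simple_if_zero)
        moreover have "?one \<in> ?L" using True by (simp add: lin_endo.comm_span_def lin_endo.span_zero)
        ultimately show ?thesis using one by simp
      next
        case False
        show ?thesis
        proof (cases "?one \<in> ?L")
          case True
          \<comment> \<open>The multiples of the identity are a nonzero Lie ideal, but \<open>?L\<close> is not commutative.\<close>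
          let ?U = "lin_endo.span {?one}"
          have comm: "x * u - u * x = 0" if x: "x \<in> ?L" and u: "u \<in> ?U" for x u
          proof -
            obtain c where "u = endo_scale c ?one" using u by (auto simp: lin_endo.span_singleton)
            then show ?thesis
              using unit [of x] x L_sub
              by (auto simp: lin_endo.scale_mult_left lin_endo.scale_mult_right)
          qed
          have U_L: "?U \<subseteq> ?L"
            using True unfolding lin_endo.comm_span_def by (intro lin_endo.span_minimal) auto
          have U: "lin_endo.lie_ideal_in ?L ?U"
            unfolding lin_endo.lie_ideal_in_def
            by (intro conjI ballI lin_endo.subspace_span U_L) (simp only: comm lin_endo.span_zero)
          obtain x y where xy: "x \<in> ?L" "y \<in> ?L" "x * y - y * x \<noteq> 0"
            using kp_comm_span_noncommutative [OF aperiodic cofinal False] by blast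
          have "?U \<noteq> ?L"
            using xy comm by blast
          moreover have "?U \<noteq> {0}"
          proof
            assume "?U = {0}"
            then have "?one = 0" using lin_endo.span_base [of ?one "{?one}"] by auto
            then show False using unit [of x] xy L_sub by auto
          qed
          ultimately have "\<not> simple_lie_algebra (commutator_lie_algebra ?R)"
            using E.simple_lie_algebra_ideal [of ?U] U by auto
          then show ?thesis using one True by simp
        next
          case not_one: False
          have "z = 0" if z: "z \<in> ?L" "\<And>r. r \<in> kp_span \<Longrightarrow> z * r = r * z" for z
          proof -
            obtain c where c: "z = endo_scale c ?one"
              using central_eq_scalar [OF aperiodic cofinal fin] z L_sub by blast
            have "c = 0"
            proof (rule ccontr)
              assume "c \<noteq> 0"
              then have "endo_scale (1 / c) z = ?one" using c by simp
              moreover have "endo_scale (1 / c) z \<in> ?L"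
                using z(1) unfolding lin_endo.comm_span_def by (rule lin_endo.span_scale)
              ultimately have "?one \<in> ?L" by metis
              then show False using not_one by simp
            qed
            then show ?thesis using c by simp
          qed
          then show ?thesis using simple [OF False] one not_one by blast
        qed
      qed
    qed
    show ?thesis using inf fin by blast
  qed
  then show ?thesis by blast
qed

end
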